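(* Let $(M^{2m},J,g)$ be a standard Kähler locally symmetric manifold with curvature tensor $R$, let $(T^{*}_{1}M,{}^{BS}\hat g)$ be its unit cotangent bundle equipped with the Berger-type deformed Sasaki metric with constant $\delta$, and let $C=(\gamma(t),\vartheta(t))$ be a geodesic on $(T^{*}_{1}M,{}^{BS}\hat g)$, parametrized by arc length. Then the field of endomorphisms $$\mathcal{R}(\widetilde{\vartheta'},\widetilde{\vartheta})=R(\widetilde{\vartheta'},\widetilde{\vartheta})+\delta^{2}g^{-1}(\vartheta',\vartheta J)\,R(\widetilde{\vartheta},J\widetilde{\vartheta})$$ is parallel along the projected curve $\gamma=\pi\circ C$.
   Context: All objects are smooth. A standard Kähler manifold $(M^{2m},J,g)$ is a $2m$-dimensional manifold with an almost complex structure $J$ ($J^2=-I$) and a Riemannian metric $g$ with $g(JX,JY)=g(X,Y)$ such that $\nabla J=0$, where $\nabla$ is the Levi-Civita connection of $g$. Locally symmetric means $\nabla R=0$. The curvature convention is $R(X,Y)Z=\nabla_X\nabla_YZ-\nabla_Y\nabla_XZ-\nabla_{[X,Y]}Z$. $\pi$ is the projection to $M$. For a covector $\omega$, $\widetilde\omega$ is the vector with $g(\widetilde\omega,X)=\omega(X)$ for all $X$; $g^{-1}(\omega,\theta)=g(\widetilde\omega,\widetilde\theta)$; $\omega J$ is the covector $(\omega J)(X)=\omega(JX)$. In the coordinates $(x^i,p_i)$ on $T^{*}M$ induced by coordinates $(x^i)$ on $M$, with Christoffel symbols $\Gamma^k_{ij}$ of $g$, the horizontal lift of $X=X^i\partial_{x^i}$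 is ${}^{H}X=X^{i}\partial_{x^i}+p_{h}\Gamma^{h}_{ij}X^{j}\partial_{p_i}$ and the vertical lift of $\omega=\omega_idx^i$ is ${}^{V}\omega=\omega_i\partial_{p_i}$. The Berger-type deformed Sasaki metric ${}^{BS}g$ on $T^{*}M$, with real constant $\delta$, is the Riemannian metric defined at $(x,p)$ by ${}^{BS}g({}^{H}X,{}^{H}Y)=g(X,Y)$, ${}^{BS}g({}^{H}X,{}^{V}\theta)=0$, ${}^{BS}g({}^{V}\omega,{}^{V}\theta)=g^{-1}(\omega,\theta)+\delta^{2}g^{-1}(\omega,pJ)\,g^{-1}(\theta,pJ)$. The unit cotangent bundle is the hypersurface $T^{*}_1M=\{(x,p)\in T^{*}M: g^{-1}(p,p)=1\}$ and ${}^{BS}\hat g$ is the metric induced on it by ${}^{BS}g$. A curve $C=(\gamma(t),\vartheta(t))$ on $T_1^{*}M$ consists of a curve $\gamma$ on $M$ and a covector field $\vartheta$ along $\gamma$ with $g^{-1}(\vartheta,\vartheta)=1$; $\vartheta'=\nabla_{\gamma'}\vartheta$ is the covariant derivative along $\gamma$. *)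

theory Defs
  imports "HOL-Analysis.Analysis"
begin

section \<open>Smooth maps\<close>

primrec higher_diff_on :: "nat \<Rightarrow> 'a::real_normed_vector set \<Rightarrow> ('a \<Rightarrow> 'b::real_normed_vector) \<Rightarrow> bool" where
  "higher_diff_on 0 S f \<longleftrightarrow> continuous_on S f"
| "higher_diff_on (Suc k) S f \<longleftrightarrow>
     (\<forall>x\<in>S. f differentiable (at x)) \<and>
     (\<forall>v. higher_diff_on k S (\<lambda>x. frechet_derivative f (at x) v))"

text \<open>Used for open \<^term>\<open>S\<close> only.\<close>

definition smooth_on :: "'a::real_normed_vector set \<Rightarrow> ('a \<Rightarrow> 'b::real_normed_vector) \<Rightarrow> bool" where
  "smooth_on S f \<longleftrightarrow> (\<forall>k. higher_diff_on k S f)"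


section \<open>Riemannian geometry in one coordinate domain\<close>

text \<open>
  A tangent vector at a point of a coordinate domain in the Euclidean space \<^typ>\<open>'e\<close> is its component
  vector.  A covector is also stored by its components in the standard basis, so that
  \<open>p \<bullet> u\<close> is the value of the covector \<open>p\<close> on the vector \<open>u\<close>;  \<open>covec\<close> turns
  a linear form into its component vector.
\<close>

definition covec :: "('e::euclidean_space \<Rightarrow> real) \<Rightarrow> 'e" where
  "covec f = (\<Sum>b\<in>Basis. f b *\<^sub>R b)"

text \<open>For a scalar product \<^term>\<open>B\<close>, \<open>sharp B p\<close> is the vector denoted by a tilde over \<open>p\<close>.\<close>

definition sharp :: "('e::euclidean_space \<Rightarrow> 'e \<Rightarrow> real) \<Rightarrow> 'e \<Rightarrow> 'e" where
  "sharp B p = (THE v. \<forall>u. B v u = p \<bullet> u)"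

definition cometric :: "('e::euclidean_space \<Rightarrow> 'e \<Rightarrow> real) \<Rightarrow> 'e \<Rightarrow> 'e \<Rightarrow> real" where
  "cometric B p q = B (sharp B p) (sharp B q)"

text \<open>The covector \<open>p J\<close>.\<close>

definition covec_comp :: "'e::euclidean_space \<Rightarrow> ('e \<Rightarrow> 'e) \<Rightarrow> 'e" where
  "covec_comp p T = covec (\<lambda>u. p \<bullet> T u)"

definition metric_on :: "'e::euclidean_space set \<Rightarrow> ('e \<Rightarrow> 'e \<Rightarrow> 'e \<Rightarrow> real) \<Rightarrow> bool" where
  "metric_on V G \<longleftrightarrow>
     (\<forall>x\<in>V. bilinear (G x) \<and> (\<forall>u v. G x u v = G x v u) \<and> (\<forall>u. u \<noteq> 0 \<longrightarrow> G x u u > 0)) \<and>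
     (\<forall>u v. smooth_on V (\<lambda>x. G x u v))"

text \<open>
  \<open>christoffel G x u v\<close> is the vector with components \<open>\<Gamma>\<^sup>k\<^sub>i\<^sub>j u\<^sup>i v\<^sup>j\<close>, where
  \<open>\<Gamma>\<^sup>k\<^sub>i\<^sub>j = 1/2 g\<^sup>k\<^sup>l (\<partial>\<^sub>i g\<^sub>j\<^sub>l + \<partial>\<^sub>j g\<^sub>i\<^sub>l - \<partial>\<^sub>l g\<^sub>i\<^sub>j)\<close>.
\<close>

definition christoffel :: "('e::euclidean_space \<Rightarrow> 'e \<Rightarrow> 'e \<Rightarrow> real) \<Rightarrow> 'e \<Rightarrow> 'e \<Rightarrow> 'e \<Rightarrow> 'e" where
  "christoffel G x u v = sharp (G x) (covec (\<lambda>w.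
     (frechet_derivative (\<lambda>y. G y v w) (at x) u
      + frechet_derivative (\<lambda>y. G y u w) (at x) v
      - frechet_derivative (\<lambda>y. G y u v) (at x) w) / 2))"

definition nabla :: "('e::euclidean_space \<Rightarrow> 'e \<Rightarrow> 'e \<Rightarrow> real) \<Rightarrow> ('e \<Rightarrow> 'e) \<Rightarrow> ('e \<Rightarrow> 'e) \<Rightarrow> 'e \<Rightarrow> 'e" where
  "nabla G X Y x = frechet_derivative Y (at x) (X x) + christoffel G x (X x) (Y x)"

definition lie_bracket :: "('e::euclidean_space \<Rightarrow> 'e) \<Rightarrow> ('e \<Rightarrow> 'e) \<Rightarrow> 'e \<Rightarrow> 'e" where
  "lie_bracket X Y x = frechet_derivative Y (at x) (X x) - frechet_derivative X (at x) (Y x)"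

definition curvature_field ::
  "('e::euclidean_space \<Rightarrow> 'e \<Rightarrow> 'e \<Rightarrow> real) \<Rightarrow> ('e \<Rightarrow> 'e) \<Rightarrow> ('e \<Rightarrow> 'e) \<Rightarrow> ('e \<Rightarrow> 'e) \<Rightarrow> 'e \<Rightarrow> 'e" where
  "curvature_field G X Y Z x =
     nabla G X (nabla G Y Z) x - nabla G Y (nabla G X Z) x - nabla G (lie_bracket X Y) Z x"

text \<open>\<open>R(u,v)w\<close> at \<open>x\<close>: the vectors are extended to vector fields with constant components.\<close>

definition curvature :: "('e::euclidean_space \<Rightarrow> 'e \<Rightarrow> 'e \<Rightarrow> real) \<Rightarrow> 'e \<Rightarrow> 'e \<Rightarrow> 'e \<Rightarrow> 'e \<Rightarrow> 'e" where
  "curvature G x u v w = curvature_field G (\<lambda>_. u) (\<lambda>_. v) (\<lambda>_. w) x"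

definition velocity :: "(real \<Rightarrow> 'e::real_normed_vector) \<Rightarrow> real \<Rightarrow> 'e" where
  "velocity y t = vector_derivative y (at t)"

definition cov_deriv_along ::
  "('e::euclidean_space \<Rightarrow> 'e \<Rightarrow> 'e \<Rightarrow> real) \<Rightarrow> (real \<Rightarrow> 'e) \<Rightarrow> (real \<Rightarrow> 'e) \<Rightarrow> real \<Rightarrow> 'e" where
  "cov_deriv_along G y Z t = vector_derivative Z (at t) + christoffel G (y t) (velocity y t) (Z t)"

definition cov_deriv_covec_along ::
  "('e::euclidean_space \<Rightarrow> 'e \<Rightarrow> 'e \<Rightarrow> real) \<Rightarrow> (real \<Rightarrow> 'e) \<Rightarrow> (real \<Rightarrow> 'e) \<Rightarrow> real \<Rightarrow> 'e" where
  "cov_deriv_covec_along G y p t =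
     vector_derivative p (at t) - covec (\<lambda>u. p t \<bullet> christoffel G (y t) (velocity y t) u)"


section \<open>Manifolds and tensor fields\<close>

text \<open>A chart is its domain together with the coordinate map (relevant only on the domain).\<close>

type_synonym ('a, 'e) chart = "'a set \<times> ('a \<Rightarrow> 'e)"

abbreviation chart_range :: "('a, 'e) chart \<Rightarrow> 'e set" where
  "chart_range c \<equiv> snd c ` fst c"

definition transition :: "('a, 'e) chart \<Rightarrow> ('a, 'e) chart \<Rightarrow> 'e \<Rightarrow> 'e" where
  "transition c d = snd d \<circ> inv_into (fst c) (snd c)"

definition smooth_atlas :: "'a topology \<Rightarrow> ('a, 'e::euclidean_space) chart set \<Rightarrow> bool" where
  "smooth_atlas M A \<longleftrightarrow>
     Hausdorff_space M \<and> second_countable M \<and>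
     (\<Union>c\<in>A. fst c) = topspace M \<and>
     (\<forall>c\<in>A. openin M (fst c) \<and> open (chart_range c) \<and>
        homeomorphic_map (subtopology M (fst c)) (top_of_set (chart_range c)) (snd c)) \<and>
     (\<forall>c\<in>A. \<forall>d\<in>A. smooth_on (snd c ` (fst c \<inter> fst d)) (transition c d))"

text \<open>
  Tensor fields are families of components, one for each chart of the atlas, that obey the
  transformation law; \<open>chart_deriv c d q\<close> maps components at \<open>q\<close> of tangent vectors in the chart
  \<open>c\<close> to components in the chart \<open>d\<close>.
\<close>

definition chart_deriv :: "('a, 'e::euclidean_space) chart \<Rightarrow> ('a, 'e) chart \<Rightarrow> 'a \<Rightarrow> 'e \<Rightarrow> 'e" where
  "chart_deriv c d q = frechet_derivative (transition c d) (at (snd c q))"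

definition riemannian_metric ::
  "('a, 'e::euclidean_space) chart set \<Rightarrow> (('a, 'e) chart \<Rightarrow> 'e \<Rightarrow> 'e \<Rightarrow> 'e \<Rightarrow> real) \<Rightarrow> bool" where
  "riemannian_metric A g \<longleftrightarrow>
     (\<forall>c\<in>A. metric_on (chart_range c) (g c)) \<and>
     (\<forall>c\<in>A. \<forall>d\<in>A. \<forall>q \<in> fst c \<inter> fst d. \<forall>u v.
        g c (snd c q) u v = g d (snd d q) (chart_deriv c d q u) (chart_deriv c d q v))"

definition almost_complex ::
  "('a, 'e::euclidean_space) chart set \<Rightarrow> (('a, 'e) chart \<Rightarrow> 'e \<Rightarrow> 'e \<Rightarrow> 'e) \<Rightarrow> bool" where
  "almost_complex A J \<longleftrightarrow>
     (\<forall>c\<in>A. (\<forall>x\<in>chart_range c. linear (J c x) \<and> (\<forall>u. J c x (J c x u) = - u)) \<and>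
        (\<forall>u. smooth_on (chart_range c) (\<lambda>x. J c x u))) \<and>
     (\<forall>c\<in>A. \<forall>d\<in>A. \<forall>q \<in> fst c \<inter> fst d. \<forall>u.
        chart_deriv c d q (J c (snd c q) u) = J d (snd d q) (chart_deriv c d q u))"

definition standard_kaehler ::
  "('a, 'e::euclidean_space) chart set \<Rightarrow> (('a, 'e) chart \<Rightarrow> 'e \<Rightarrow> 'e \<Rightarrow> 'e \<Rightarrow> real) \<Rightarrow>
   (('a, 'e) chart \<Rightarrow> 'e \<Rightarrow> 'e \<Rightarrow> 'e) \<Rightarrow> bool" where
  "standard_kaehler A g J \<longleftrightarrow>
     riemannian_metric A g \<and> almost_complex A J \<and>
     (\<forall>c\<in>A. \<forall>x\<in>chart_range c. \<forall>u v. g c x (J c x u) (J c x v) = g c x u v) \<and>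
     (\<forall>c\<in>A. \<forall>X Y. smooth_on (chart_range c) X \<longrightarrow> smooth_on (chart_range c) Y \<longrightarrow>
        (\<forall>x\<in>chart_range c.
           nabla (g c) X (\<lambda>y. J c y (Y y)) x - J c x (nabla (g c) X Y x) = 0))"

definition locally_symmetric ::
  "('a, 'e::euclidean_space) chart set \<Rightarrow> (('a, 'e) chart \<Rightarrow> 'e \<Rightarrow> 'e \<Rightarrow> 'e \<Rightarrow> real) \<Rightarrow> bool" where
  "locally_symmetric A g \<longleftrightarrow>
     (\<forall>c\<in>A. \<forall>X Y Z W. smooth_on (chart_range c) X \<longrightarrow> smooth_on (chart_range c) Y \<longrightarrow>
        smooth_on (chart_range c) Z \<longrightarrow> smooth_on (chart_range c) W \<longrightarrow>
        (\<forall>x\<in>chart_range c.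
           nabla (g c) X (\<lambda>y. curvature (g c) y (Y y) (Z y) (W y)) x
           - curvature (g c) x (nabla (g c) X Y x) (Z x) (W x)
           - curvature (g c) x (Y x) (nabla (g c) X Z x) (W x)
           - curvature (g c) x (Y x) (Z x) (nabla (g c) X W x) = 0))"


section \<open>The Berger-type deformed Sasaki metric on the cotangent bundle\<close>

text \<open>
  A chart of the manifold induces coordinates \<open>(x, p)\<close> on the cotangent bundle, with values in
  \<^typ>\<open>'e \<times> 'e\<close>.  A tangent vector of the cotangent bundle at \<open>(x, p)\<close> is the pair of its
  components along the \<open>\<partial>\<^sub>x\<close> and the \<open>\<partial>\<^sub>p\<close>.
\<close>

definition hor_lift :: "('e::euclidean_space \<Rightarrow> 'e \<Rightarrow> 'e \<Rightarrow> real) \<Rightarrow> 'e \<times> 'e \<Rightarrow> 'e \<Rightarrow> 'e \<times> 'e" where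
  "hor_lift G z X = (X, covec (\<lambda>u. snd z \<bullet> christoffel G (fst z) u X))"

definition ver_lift :: "'e::euclidean_space \<Rightarrow> 'e \<times> 'e" where
  "ver_lift \<omega> = (0, \<omega>)"

text \<open>
  Every tangent vector at \<open>z\<close> is uniquely the sum of the horizontal lift of its first component and
  the vertical lift of \<open>ver_part G z \<xi>\<close>.
\<close>

definition ver_part :: "('e::euclidean_space \<Rightarrow> 'e \<Rightarrow> 'e \<Rightarrow> real) \<Rightarrow> 'e \<times> 'e \<Rightarrow> 'e \<times> 'e \<Rightarrow> 'e" where
  "ver_part G z \<xi> = snd (\<xi> - hor_lift G z (fst \<xi>))"

definition berger_sasaki ::
  "('e::euclidean_space \<Rightarrow> 'e \<Rightarrow> 'e \<Rightarrow> real) \<Rightarrow> ('e \<Rightarrow> 'e \<Rightarrow> 'e) \<Rightarrow> real \<Rightarrow>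
   'e \<times> 'e \<Rightarrow> 'e \<times> 'e \<Rightarrow> 'e \<times> 'e \<Rightarrow> real" where
  "berger_sasaki G J \<delta> z \<xi> \<eta> =
     (let x = fst z; p = snd z; pJ = covec_comp p (J x);
          \<omega> = ver_part G z \<xi>; \<theta> = ver_part G z \<eta>
      in G x (fst \<xi>) (fst \<eta>) + cometric (G x) \<omega> \<theta>
         + \<delta>\<^sup>2 * cometric (G x) \<omega> pJ * cometric (G x) \<theta> pJ)"

text \<open>The part over the domain of the chart \<open>c\<close> of the unit cotangent bundle, in coordinates.\<close>

definition unit_cotangent ::
  "('a, 'e::euclidean_space) chart \<Rightarrow> ('e \<Rightarrow> 'e \<Rightarrow> 'e \<Rightarrow> real) \<Rightarrow> ('e \<times> 'e) set" where
  "unit_cotangent c G = {(x, p). x \<in> chart_range c \<and> cometric (G x) p p = 1}"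

text \<open>A local parametrization (inverse of a chart) of a submanifold \<open>S\<close> by an open set \<open>W\<close>.\<close>

definition local_param :: "'v::euclidean_space set \<Rightarrow> 'f::euclidean_space set \<Rightarrow> ('f \<Rightarrow> 'v) \<Rightarrow> bool" where
  "local_param S W \<psi> \<longleftrightarrow>
     open W \<and> smooth_on W \<psi> \<and> (\<forall>w\<in>W. inj (frechet_derivative \<psi> (at w))) \<and>
     openin (top_of_set S) (\<psi> ` W) \<and> (\<exists>k. homeomorphism W (\<psi> ` W) \<psi> k)"

definition induced_metric ::
  "('v::euclidean_space \<Rightarrow> 'v \<Rightarrow> 'v \<Rightarrow> real) \<Rightarrow> ('f::euclidean_space \<Rightarrow> 'v) \<Rightarrow> 'f \<Rightarrow> 'f \<Rightarrow> 'f \<Rightarrow> real" where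
  "induced_metric B \<psi> w a b =
     B (\<psi> w) (frechet_derivative \<psi> (at w) a) (frechet_derivative \<psi> (at w) b)"


section \<open>Curves on the unit cotangent bundle\<close>

text \<open>
  A curve consists of a curve \<open>\<gamma>\<close> on the manifold and a covector field along it; \<open>\<theta> t c\<close> is the
  component vector of the covector at \<open>\<gamma> t\<close> in the chart \<open>c\<close> (relevant only if \<open>\<gamma> t\<close> lies in the
  domain of \<open>c\<close>).
\<close>

abbreviation times_in :: "real set \<Rightarrow> (real \<Rightarrow> 'a) \<Rightarrow> ('a, 'e) chart \<Rightarrow> real set" where
  "times_in I \<gamma> c \<equiv> {t \<in> I. \<gamma> t \<in> fst c}"

definition unit_cotangent_curve ::
  "'a topology \<Rightarrow> ('a, 'e::euclidean_space) chart set \<Rightarrow> (('a, 'e) chart \<Rightarrow> 'e \<Rightarrow> 'e \<Rightarrow> 'e \<Rightarrow> real) \<Rightarrow>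
   real set \<Rightarrow> (real \<Rightarrow> 'a) \<Rightarrow> (real \<Rightarrow> ('a, 'e) chart \<Rightarrow> 'e) \<Rightarrow> bool" where
  "unit_cotangent_curve M A g I \<gamma> \<theta> \<longleftrightarrow>
     continuous_map (top_of_set I) M \<gamma> \<and>
     (\<forall>c\<in>A. smooth_on (times_in I \<gamma> c) (\<lambda>t. snd c (\<gamma> t)) \<and>
        smooth_on (times_in I \<gamma> c) (\<lambda>t. \<theta> t c) \<and>
        (\<forall>t\<in>times_in I \<gamma> c. (snd c (\<gamma> t), \<theta> t c) \<in> unit_cotangent c (g c))) \<and>
     (\<forall>c\<in>A. \<forall>d\<in>A. \<forall>t \<in> times_in I \<gamma> c \<inter> times_in I \<gamma> d. \<forall>u.
        \<theta> t c \<bullet> u = \<theta> t d \<bullet> chart_deriv c d (\<gamma> t) u)"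

text \<open>
  The geodesic equation of the induced metric, in local coordinates of the unit cotangent bundle
  around every point of the curve.  The model space \<^typ>\<open>'f\<close> of these coordinates must have
  dimension \<open>2 * DIM('e) - 1\<close>.
\<close>

definition unit_cotangent_geodesic ::
  "'f::euclidean_space itself \<Rightarrow> ('a, 'e::euclidean_space) chart set \<Rightarrow>
   (('a, 'e) chart \<Rightarrow> 'e \<Rightarrow> 'e \<Rightarrow> 'e \<Rightarrow> real) \<Rightarrow> (('a, 'e) chart \<Rightarrow> 'e \<Rightarrow> 'e \<Rightarrow> 'e) \<Rightarrow> real \<Rightarrow>
   real set \<Rightarrow> (real \<Rightarrow> 'a) \<Rightarrow> (real \<Rightarrow> ('a, 'e) chart \<Rightarrow> 'e) \<Rightarrow> bool" where
  "unit_cotangent_geodesic F A g J \<delta> I \<gamma> \<theta> \<longleftrightarrow>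
     (\<forall>t0\<in>I. \<exists>c\<in>A. \<exists>(W :: 'f set) \<psi> N y.
        local_param (unit_cotangent c (g c)) W \<psi> \<and>
        open N \<and> t0 \<in> N \<and> N \<subseteq> times_in I \<gamma> c \<and> smooth_on N y \<and>
        (\<forall>t\<in>N. y t \<in> W \<and> \<psi> (y t) = (snd c (\<gamma> t), \<theta> t c) \<and>
           cov_deriv_along (induced_metric (berger_sasaki (g c) (J c) \<delta>) \<psi>) y (velocity y) t = 0))"

definition arc_length_parametrized ::
  "('a, 'e::euclidean_space) chart set \<Rightarrow>
   (('a, 'e) chart \<Rightarrow> 'e \<Rightarrow> 'e \<Rightarrow> 'e \<Rightarrow> real) \<Rightarrow> (('a, 'e) chart \<Rightarrow> 'e \<Rightarrow> 'e \<Rightarrow> 'e) \<Rightarrow> real \<Rightarrow>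
   real set \<Rightarrow> (real \<Rightarrow> 'a) \<Rightarrow> (real \<Rightarrow> ('a, 'e) chart \<Rightarrow> 'e) \<Rightarrow> bool" where
  "arc_length_parametrized A g J \<delta> I \<gamma> \<theta> \<longleftrightarrow>
     (\<forall>c\<in>A. \<forall>t\<in>times_in I \<gamma> c.
        let C = (\<lambda>s. (snd c (\<gamma> s), \<theta> s c))
        in berger_sasaki (g c) (J c) \<delta> (C t) (velocity C t) (velocity C t) = 1)"

text \<open>The endomorphism \<open>\<R>\<close>, where \<open>p\<close> and \<open>p'\<close> are the values of \<open>\<theta>\<close> and \<open>\<theta>'\<close>.\<close>

definition berger_curvature ::
  "('e::euclidean_space \<Rightarrow> 'e \<Rightarrow> 'e \<Rightarrow> real) \<Rightarrow> ('e \<Rightarrow> 'e \<Rightarrow> 'e) \<Rightarrow> real \<Rightarrow> 'e \<Rightarrow> 'e \<Rightarrow> 'e \<Rightarrow> 'e \<Rightarrow> 'e" where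
  "berger_curvature G J \<delta> x p' p w =
     curvature G x (sharp (G x) p') (sharp (G x) p) w
     + (\<delta>\<^sup>2 * cometric (G x) p' (covec_comp p (J x))) *\<^sub>R
         curvature G x (sharp (G x) p) (J x (sharp (G x) p)) w"

text \<open>
  A field \<open>E\<close> of endomorphisms along \<open>\<gamma>\<close> is parallel if \<open>\<nabla>(E Z) - E (\<nabla> Z) = 0\<close> for all vector
  fields \<open>Z\<close> along \<open>\<gamma>\<close>.  The differentiability of \<open>E Z\<close> is demanded because
  \<^const>\<open>vector_derivative\<close> is meaningless without it.
\<close>

definition parallel_endomorphism_along ::
  "('a, 'e::euclidean_space) chart set \<Rightarrow> (('a, 'e) chart \<Rightarrow> 'e \<Rightarrow> 'e \<Rightarrow> 'e \<Rightarrow> real) \<Rightarrow>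
   real set \<Rightarrow> (real \<Rightarrow> 'a) \<Rightarrow> (('a, 'e) chart \<Rightarrow> real \<Rightarrow> 'e \<Rightarrow> 'e) \<Rightarrow> bool" where
  "parallel_endomorphism_along A g I \<gamma> E \<longleftrightarrow>
     (\<forall>c\<in>A. \<forall>Z. smooth_on (times_in I \<gamma> c) Z \<longrightarrow>
        (\<forall>t\<in>times_in I \<gamma> c. let y = (\<lambda>s. snd c (\<gamma> s)) in
           (\<lambda>s. E c s (Z s)) differentiable (at t) \<and>
           cov_deriv_along (g c) y (\<lambda>s. E c s (Z s)) t - E c t (cov_deriv_along (g c) y Z t) = 0))"


section \<open>The defining properties of the notions above\<close>

lemma covec_inner: "linear f \<Longrightarrow> covec f \<bullet> u = f u"
proof -
  assume f: "linear f"
  have "f u = f (\<Sum>b\<in>Basis. (u \<bullet> b) *\<^sub>R b)"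
    by (simp add: euclidean_representation)
  also have "\<dots> = (\<Sum>b\<in>Basis. (u \<bullet> b) * f b)"
    using f by (simp add: linear_sum linear_scale)
  also have "\<dots> = covec f \<bullet> u"
    by (simp add: covec_def inner_sum_left inner_commute[of u] mult.commute)
  finally show ?thesis by simp
qed

lemma sharp_works:
  fixes B :: "'e::euclidean_space \<Rightarrow> 'e \<Rightarrow> real"
  assumes "bilinear B" and pos: "\<And>u. u \<noteq> 0 \<Longrightarrow> B u u > 0"
  shows "B (sharp B p) u = p \<bullet> u"
proof -
  have l1: "linear (B v)" and l2: "linear (\<lambda>v. B v u)" for u v
    using assms(1) by (auto simp: bilinear_def)
  define L where "L v = covec (B v)" for v
  have L: "L v \<bullet> u = B v u" for u v
    unfolding L_def by (rule covec_inner[OF l1])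
  have linL: "linear L"
    by (rule linearI; rule euclidean_eqI)
       (simp_all add: L inner_add_left linear_add[OF l2] linear_scale[OF l2])
  have "inj L"
  proof (subst linear_injective_0[OF linL], intro allI impI)
    fix v assume "L v = 0"
    then have "B v v = 0" using L[of v v] by simp
    then show "v = 0" using pos[of v] by force
  qed
  note inj = this
  have "surj L" by (rule linear_injective_imp_surjective[OF linL inj refl])
  then obtain v where v: "p = L v" by (rule surjE)
  have "\<exists>!v. \<forall>u. B v u = p \<bullet> u"
  proof (rule ex1I[of _ v])
    show "\<forall>u. B v u = p \<bullet> u" unfolding v L by simp
    fix v' assume v': "\<forall>u. B v' u = p \<bullet> u"
    have "L v' = L v"
    proof (rule euclidean_eqI)
      fix b
      have "L v' \<bullet> b = p \<bullet> b" using v' unfolding L by (rule spec)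
      then show "L v' \<bullet> b = L v \<bullet> b" unfolding v .
    qed
    with inj show "v' = v" by (rule injD)
  qed
  from theI'[OF this] show ?thesis unfolding sharp_def by (rule spec)
qed

lemma metric_on_sharp:
  assumes "metric_on V G" and "x \<in> V"
  shows "G x (sharp (G x) p) u = p \<bullet> u"
  using assms by (intro sharp_works) (auto simp: metric_on_def)

lemma metric_on_deriv:
  assumes "metric_on V G" and "open V" and "x \<in> V"
  shows "((\<lambda>y. G y u v) has_derivative frechet_derivative (\<lambda>y. G y u v) (at x)) (at x)"
proof -
  have "higher_diff_on (Suc 0) V (\<lambda>y. G y u v)"
    using assms(1) unfolding metric_on_def smooth_on_def by blast
  then show ?thesis using assms(3) by (simp add: frechet_derivative_works)
qed

lemma metric_on_deriv_sym:
  assumes "metric_on V G" and "open V" and "x \<in> V"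
  shows "frechet_derivative (\<lambda>y. G y u v) (at x) = frechet_derivative (\<lambda>y. G y v u) (at x)"
proof -
  have "((\<lambda>y. G y v u) has_derivative frechet_derivative (\<lambda>y. G y u v) (at x)) (at x)"
    by (rule has_derivative_transform_within_open[OF metric_on_deriv[OF assms] assms(2,3)])
       (use assms(1) in \<open>auto simp: metric_on_def\<close>)
  then show ?thesis by (rule frechet_derivative_at)
qed

lemma metric_on_deriv_linear:
  assumes "metric_on V G" and "open V" and "x \<in> V"
  shows "linear (frechet_derivative (\<lambda>y. G y u v) (at x))"
    and "linear (\<lambda>w. frechet_derivative (\<lambda>y. G y u w) (at x) a)"
    and "linear (\<lambda>w. frechet_derivative (\<lambda>y. G y w v) (at x) a)"
proof -
  note d = metric_on_deriv[OF assms]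
  show "linear (frechet_derivative (\<lambda>y. G y u v) (at x))"
    using d by (rule has_derivative_linear)
  have l: "linear (G y u)" if "y \<in> V" for y u
    using assms(1) that by (auto simp: metric_on_def bilinear_def)
  show *: "linear (\<lambda>w. frechet_derivative (\<lambda>y. G y u w) (at x) a)" for u
  proof (rule linearI)
    fix w1 w2
    have "((\<lambda>y. G y u (w1 + w2)) has_derivative
        (\<lambda>a. frechet_derivative (\<lambda>y. G y u w1) (at x) a + frechet_derivative (\<lambda>y. G y u w2) (at x) a)) (at x)"
      by (rule has_derivative_transform_within_open[OF has_derivative_add[OF d d] assms(2,3)])
         (simp add: linear_add[OF l])
    from fun_cong[OF frechet_derivative_at[OF this]]
    show "frechet_derivative (\<lambda>y. G y u (w1 + w2)) (at x) a =
        frechet_derivative (\<lambda>y. G y u w1) (at x) a + frechet_derivative (\<lambda>y. G y u w2) (at x) a"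
      by simp
  next
    fix r w
    have "((\<lambda>y. G y u (r *\<^sub>R w)) has_derivative
        (\<lambda>a. r *\<^sub>R frechet_derivative (\<lambda>y. G y u w) (at x) a)) (at x)"
      by (rule has_derivative_transform_within_open[OF has_derivative_scaleR_right[OF d] assms(2,3)])
         (simp add: linear_scale[OF l])
    from fun_cong[OF frechet_derivative_at[OF this]]
    show "frechet_derivative (\<lambda>y. G y u (r *\<^sub>R w)) (at x) a =
        r *\<^sub>R frechet_derivative (\<lambda>y. G y u w) (at x) a"
      by simp
  qed
  show "linear (\<lambda>w. frechet_derivative (\<lambda>y. G y w v) (at x) a)"
    using *[of v] by (simp add: metric_on_deriv_sym[OF assms, of _ v])
qed

lemma christoffel_works:
  assumes "metric_on V G" and "open V" and "x \<in> V"
  shows "G x (christoffel G x u v) w =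
     (frechet_derivative (\<lambda>y. G y v w) (at x) u + frechet_derivative (\<lambda>y. G y u w) (at x) v
      - frechet_derivative (\<lambda>y. G y u v) (at x) w) / 2"
proof -
  note l = metric_on_deriv_linear[OF assms]
  have "linear (\<lambda>w. (frechet_derivative (\<lambda>y. G y v w) (at x) u
      + frechet_derivative (\<lambda>y. G y u w) (at x) v - frechet_derivative (\<lambda>y. G y u v) (at x) w) / 2)"
    by (rule linearI) (simp_all add: linear_add[OF l(1)] linear_add[OF l(2)]
        linear_scale[OF l(1)] linear_scale[OF l(2)] field_simps)
  then show ?thesis
    by (simp add: christoffel_def metric_on_sharp[OF assms(1,3)] covec_inner)
qed

text \<open>The connection is torsion-free and metric, i.e. it is the Levi-Civita connection.\<close>

lemma christoffel_sym:
  assumes "metric_on V G" and "open V" and "x \<in> V"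
  shows "christoffel G x u v = christoffel G x v u"
  by (simp add: christoffel_def metric_on_deriv_sym[OF assms, of v u] add.commute)

lemma christoffel_metric:
  assumes "metric_on V G" and "open V" and "x \<in> V"
  shows "frechet_derivative (\<lambda>y. G y v w) (at x) u =
     G x (christoffel G x u v) w + G x v (christoffel G x u w)"
proof -
  have "G x v (christoffel G x u w) = G x (christoffel G x u w) v"
    using assms(1,3) by (auto simp: metric_on_def)
  then show ?thesis
    by (simp add: christoffel_works[OF assms] metric_on_deriv_sym[OF assms, of w v] field_simps)
qed

lemma ver_part_lifts:
  assumes "metric_on V G" and "open V" and "fst z \<in> V"
  shows "ver_part G z (hor_lift G z X) = 0" and "ver_part G z (ver_lift \<omega>) = \<omega>"
proof -
  show "ver_part G z (hor_lift G z X) = 0"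
    by (simp add: ver_part_def hor_lift_def)
  let ?x = "fst z"
  note l = metric_on_deriv_linear[OF assms]
  have "christoffel G ?x u 0 = 0" for u
  proof (rule ccontr)
    let ?c = "christoffel G ?x u 0"
    assume "?c \<noteq> 0"
    then have "G ?x ?c ?c > 0"
      using assms(1,3) by (auto simp: metric_on_def)
    moreover have "G ?x ?c ?c = 0"
      using linear_0[OF l(1)] linear_0[OF l(2)] linear_0[OF l(3)]
      by (simp add: christoffel_works[OF assms])
    ultimately show False by simp
  qed
  then show "ver_part G z (ver_lift \<omega>) = \<omega>"
    by (simp add: ver_part_def hor_lift_def ver_lift_def covec_def)
qed

text \<open>The three equations that define the Berger-type deformed Sasaki metric.\<close>

lemma berger_sasaki_lifts:
  fixes J :: "'e::euclidean_space \<Rightarrow> 'e \<Rightarrow> 'e"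
  assumes "metric_on V G" and "open V" and "fst z \<in> V"
  defines "x \<equiv> fst z" and "pJ \<equiv> covec_comp (snd z) (J (fst z))"
  shows "berger_sasaki G J \<delta> z (hor_lift G z X) (hor_lift G z Y) = G x X Y"
    and "berger_sasaki G J \<delta> z (hor_lift G z X) (ver_lift \<theta>) = 0"
    and "berger_sasaki G J \<delta> z (ver_lift \<omega>) (ver_lift \<theta>) =
      cometric (G x) \<omega> \<theta> + \<delta>\<^sup>2 * cometric (G x) \<omega> pJ * cometric (G x) \<theta> pJ"
proof -
  have l: "linear (G x v)" "linear (\<lambda>v. G x v u)" for u v
    using assms(1,3) by (auto simp: metric_on_def bilinear_def x_def)
  have c0: "cometric (G x) 0 p = 0" for p
    using metric_on_sharp[OF assms(1,3), of 0] by (simp add: cometric_def x_def)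
  note simps = berger_sasaki_def Let_def ver_part_lifts[OF assms(1-3)] c0[unfolded x_def] x_def pJ_def
  show "berger_sasaki G J \<delta> z (hor_lift G z X) (hor_lift G z Y) = G x X Y"
    by (simp add: simps) (simp add: hor_lift_def)
  show "berger_sasaki G J \<delta> z (hor_lift G z X) (ver_lift \<theta>) = 0"
    using linear_0[OF l(1)] by (simp add: simps) (simp add: ver_lift_def x_def)
  show "berger_sasaki G J \<delta> z (ver_lift \<omega>) (ver_lift \<theta>) =
      cometric (G x) \<omega> \<theta> + \<delta>\<^sup>2 * cometric (G x) \<omega> pJ * cometric (G x) \<theta> pJ"
    using linear_0[OF l(1)] by (simp add: simps) (simp add: ver_lift_def x_def)
qed

end

theory Submission
  imports Defs
begin

text \<open>
  Write \<open>u\<close> for the vector dual to \<open>\<theta>\<close>, \<open>u'\<close> for its covariant derivative along \<open>\<gamma>\<close> and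
  \<open>l = g(u', J u)\<close>, so that the endomorphism is \<open>R(u', u) - \<delta>\<^sup>2 l R(u, J u)\<close>.  Only the vertical part of the
  geodesic equation matters.  It says that \<open>u'' + \<delta>\<^sup>2 l' J u + 2 \<delta>\<^sup>2 l J u'\<close> is a multiple of \<open>u\<close>.
  Differentiating the endomorphism with \<open>\<nabla>R = 0\<close> and \<open>\<nabla>J = 0\<close>, inserting this value of \<open>u''\<close> and using
  \<open>R(J a, J b) = R(a, b)\<close>, hence \<open>R(u, J u') = R(u', J u)\<close>, makes all terms cancel.

  The same pullback formula for the Levi-Civita connection serves twice: it turns the geodesic
  equation in a parametrization of the unit cotangent bundle into an orthogonality relation in the
  cotangent bundle, and it carries the vertical equation from one chart of the manifold to another.
\<close>

section \<open>Calculus of smooth maps\<close>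

text \<open>The horizontal part drops out because \<nabla>R = 0 and \<nabla>J = 0 act along every
  curve, so differentiating the endomorphism never produces the acceleration of \<gamma>. The
  unspecified multiple of u is the reaction of the constraint g(u, u) = 1: a vertical vector is
  tangent to the unit bundle only if it is orthogonal to u. It is harmless since R(u, u) = 0. The
  coefficient 2 in the vertical equation has two equal sources: J u is differentiated along the
  curve, and the metric itself depends on p through p J. The same 2 reappears when R(u', J u) and
  R(u, J u') coincide, and this is why the terms balance. The obstacle is that the geodesic equation
  is stated in an unknown parametrization over some chart, through Christoffel symbols of a metric
  that is given only implicitly. Those symbols are never computed: each equation is tested against
  vectors, and torsion-freeness and metric compatibility do the rest. Invariance of R under J rests
  on pair symmetry, hence the full set of curvature symmetries below.\<close>

lemma higher_diff_on_cong:
  assumes "open S" and "\<And>x. x \<in> S \<Longrightarrow> f x = g x" and "higher_diff_on k S f"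
  shows "higher_diff_on k S g"
  using assms(2,3)
proof (induction k arbitrary: f g)
  case 0
  then show ?case using continuous_on_cong[of S S f g] by auto
next
  case (Suc k)
  have d: "(g has_derivative frechet_derivative f (at x)) (at x)" if "x \<in> S" for x
    by (rule has_derivative_transform_within_open[OF _ assms(1) that Suc.prems(1)])
       (use Suc.prems that in \<open>auto simp: frechet_derivative_works\<close>)
  have "frechet_derivative g (at x) = frechet_derivative f (at x)" if "x \<in> S" for x
    using frechet_derivative_at[OF d[OF that]] by simp
  then have eq: "frechet_derivative f (at x) v = frechet_derivative g (at x) v" if "x \<in> S" for x v
    using that by simp
  have "higher_diff_on k S (\<lambda>x. frechet_derivative f (at x) v)" for v
    using Suc.prems(2) by simp
  from Suc.IH[OF eq this] have "higher_diff_on k S (\<lambda>x. frechet_derivative g (at x) v)" for v .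
  moreover have "\<forall>x\<in>S. g differentiable (at x)" using d by (auto simp: differentiable_def)
  ultimately show ?case by simp
qed

text \<open>Uniqueness of derivatives on an open set lets the derivative delivered by any calculus
  rule stand in for \<open>frechet_derivative\<close>. The closure proofs for sums, products and
  compositions enter their step case here.\<close>

lemma higher_diff_on_SucI:
  assumes "open S" and "\<And>x. x \<in> S \<Longrightarrow> (f has_derivative f' x) (at x)"
    and "\<And>v. higher_diff_on k S (\<lambda>x. f' x v)"
  shows "higher_diff_on (Suc k) S f"
proof -
  have "f' x = frechet_derivative f (at x)" if "x \<in> S" for x
    by (rule frechet_derivative_at[OF assms(2)[OF that]])
  then have "higher_diff_on k S (\<lambda>x. frechet_derivative f (at x) v)" for v
    by (intro higher_diff_on_cong[OF assms(1) _ assms(3)[of v]]) simp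
  then show ?thesis using assms(2) by (auto simp: differentiable_def)
qed

lemma higher_diff_on_Suc_has_derivative:
  assumes "higher_diff_on (Suc k) S f" and "x \<in> S"
  shows "(f has_derivative frechet_derivative f (at x)) (at x)"
  using assms by (simp add: frechet_derivative_works)

lemma higher_diff_on_Suc_D: "higher_diff_on (Suc k) S f \<Longrightarrow> higher_diff_on k S f"
proof (induction k arbitrary: f)
  case 0
  then show ?case
    by (auto intro!: continuous_at_imp_continuous_on differentiable_imp_continuous_within)
next
  case (Suc k)
  have "higher_diff_on k S (\<lambda>x. frechet_derivative f (at x) v)" for v
    using Suc.prems by (intro Suc.IH) simp
  then show ?case using Suc.prems by simp
qed

lemma higher_diff_on_const: "higher_diff_on k S (\<lambda>_. c)"
  by (induction k arbitrary: c) auto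

lemma higher_diff_on_bounded_linear:
  assumes "bounded_linear l" and "open S" and "higher_diff_on k S f"
  shows "higher_diff_on k S (\<lambda>x. l (f x))"
  using assms(3)
proof (induction k arbitrary: f)
  case 0
  then show ?case using bounded_linear.continuous_on[OF assms(1)] by simp
next
  case (Suc k)
  show ?case
    by (rule higher_diff_on_SucI[OF assms(2)
          bounded_linear.has_derivative[OF assms(1) higher_diff_on_Suc_has_derivative[OF Suc.prems]]])
       (use Suc in auto)
qed

lemma higher_diff_on_add:
  assumes "open S" and "higher_diff_on k S f" and "higher_diff_on k S g"
  shows "higher_diff_on k S (\<lambda>x. f x + g x)"
  using assms(2,3)
proof (induction k arbitrary: f g)
  case 0
  then show ?case by (auto intro: continuous_on_add)
next
  case (Suc k)
  show ?case
    by (rule higher_diff_on_SucI[OF assms(1)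
          has_derivative_add[OF higher_diff_on_Suc_has_derivative[OF Suc.prems(1)]
            higher_diff_on_Suc_has_derivative[OF Suc.prems(2)]]])
       (use Suc in auto)
qed

lemma higher_diff_on_sum:
  assumes "open S" and "\<And>i. i \<in> K \<Longrightarrow> higher_diff_on k S (f i)"
  shows "higher_diff_on k S (\<lambda>x. \<Sum>i\<in>K. f i x)"
  using assms(2)
  by (induction K rule: infinite_finite_induct)
     (auto intro: higher_diff_on_const higher_diff_on_add[OF assms(1)])

text \<open>In the step case the product rule leaves one factor undifferentiated;
  \<open>higher_diff_on_Suc_D\<close> lowers its order so that the induction hypothesis
  applies.\<close>

lemma higher_diff_on_bilinear:
  assumes "bounded_bilinear b" and "open S" and "higher_diff_on k S f" and "higher_diff_on k S g"
  shows "higher_diff_on k S (\<lambda>x. b (f x) (g x))"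
  using assms(3,4)
proof (induction k arbitrary: f g)
  case 0
  then show ?case using bounded_bilinear.continuous_on[OF assms(1)] by auto
next
  case (Suc k)
  show ?case
  proof (rule higher_diff_on_SucI[OF assms(2)
          bounded_bilinear.FDERIV[OF assms(1) higher_diff_on_Suc_has_derivative[OF Suc.prems(1)]
            higher_diff_on_Suc_has_derivative[OF Suc.prems(2)]]])
    show "higher_diff_on k S (\<lambda>x. b (f x) (frechet_derivative g (at x) v)
        + b (frechet_derivative f (at x) v) (g x))" for v
      using Suc.prems
      by (intro higher_diff_on_add[OF assms(2)] Suc.IH)
         (auto dest: higher_diff_on_Suc_D simp del: higher_diff_on.simps(2),
           simp_all)
  qed auto
qed

lemma linear_eq_sum_Basis:
  fixes l :: "'e::euclidean_space \<Rightarrow> 'b::real_vector"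
  assumes "linear l"
  shows "l a = (\<Sum>b\<in>Basis. (a \<bullet> b) *\<^sub>R l b)"
proof -
  have "l a = l (\<Sum>b\<in>Basis. (a \<bullet> b) *\<^sub>R b)" by (simp add: euclidean_representation)
  then show ?thesis using assms by (simp add: linear_sum linear_scale)
qed

text \<open>Expanding \<open>a x\<close> in the basis gives a finite sum of scalar functions times
  \<open>F x b\<close>. Tensor fields are known to be smooth only on constant arguments; this is the
  device that admits varying ones.\<close>

lemma higher_diff_on_linear_apply:
  fixes F :: "'d::real_normed_vector \<Rightarrow> 'e::euclidean_space \<Rightarrow> 'b::real_normed_vector"
  assumes "open S" and "\<And>x. x \<in> S \<Longrightarrow> linear (F x)"
    and "\<And>e. higher_diff_on k S (\<lambda>x. F x e)" and "higher_diff_on k S a"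
  shows "higher_diff_on k S (\<lambda>x. F x (a x))"
proof (rule higher_diff_on_cong[OF assms(1)])
  show "(\<Sum>b\<in>Basis. (a x \<bullet> b) *\<^sub>R F x b) = F x (a x)" if "x \<in> S" for x
    by (rule linear_eq_sum_Basis[OF assms(2)[OF that], symmetric])
  show "higher_diff_on k S (\<lambda>x. \<Sum>b\<in>Basis. (a x \<bullet> b) *\<^sub>R F x b)"
  proof (rule higher_diff_on_sum[OF assms(1)])
    fix b :: 'e
    from higher_diff_on_bounded_linear[of "\<lambda>x. x \<bullet> b", OF bounded_linear_inner_left assms(1,4)]
    have "higher_diff_on k S (\<lambda>x. a x \<bullet> b)" .
    from higher_diff_on_bilinear[OF bounded_bilinear_scaleR assms(1) this assms(3)]
    show "higher_diff_on k S (\<lambda>x. (a x \<bullet> b) *\<^sub>R F x b)" .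
  qed
qed

text \<open>The chain rule produces a varying linear map applied to a varying vector, which is
  exactly the shape treated by \<open>higher_diff_on_linear_apply\<close>.\<close>

lemma higher_diff_on_compose:
  fixes f :: "'e::euclidean_space \<Rightarrow> 'b::real_normed_vector"
  assumes "open S" and "higher_diff_on k S g" and "higher_diff_on k T f" and "g ` S \<subseteq> T"
  shows "higher_diff_on k S (\<lambda>x. f (g x))"
  using assms(2,3)
proof (induction k arbitrary: f)
  case 0
  then show ?case using continuous_on_compose2[of T f S g] assms(4) by simp
next
  case (Suc k)
  have df: "(f has_derivative frechet_derivative f (at (g x))) (at (g x))" if "x \<in> S" for x
    using higher_diff_on_Suc_has_derivative[OF Suc.prems(2)] that assms(4) by blast
  have dg: "(g has_derivative frechet_derivative g (at x)) (at x)" if "x \<in> S" for x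
    using higher_diff_on_Suc_has_derivative[OF Suc.prems(1) that] .
  show ?case
  proof (rule higher_diff_on_SucI[OF assms(1) has_derivative_compose[OF dg df]])
    show "higher_diff_on k S (\<lambda>x. frechet_derivative f (at (g x)) (frechet_derivative g (at x) v))" for v
    proof (rule higher_diff_on_linear_apply[OF assms(1)])
      show "linear (frechet_derivative f (at (g x)))" if "x \<in> S" for x
        using df[OF that] by (rule has_derivative_linear)
      show "higher_diff_on k S (\<lambda>x. frechet_derivative f (at (g x)) e)" for e
        using Suc.prems by (intro Suc.IH) (auto dest: higher_diff_on_Suc_D simp del: higher_diff_on.simps(2), simp)
      show "higher_diff_on k S (\<lambda>x. frechet_derivative g (at x) v)"
        using Suc.prems by simp
    qed
  qed auto
qed

lemma higher_diff_on_subset: "higher_diff_on k S f \<Longrightarrow> T \<subseteq> S \<Longrightarrow> higher_diff_on k T f"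
proof (induction k arbitrary: f)
  case 0
  then show ?case by (auto intro: continuous_on_subset)
next
  case (Suc k)
  then show ?case by (auto simp: subset_iff)
qed

lemma smooth_on_cong:
  "open S \<Longrightarrow> (\<And>x. x \<in> S \<Longrightarrow> f x = g x) \<Longrightarrow> smooth_on S f \<Longrightarrow> smooth_on S g"
  unfolding smooth_on_def using higher_diff_on_cong[of S f g] by blast

lemma smooth_on_subset: "smooth_on S f \<Longrightarrow> T \<subseteq> S \<Longrightarrow> smooth_on T f"
  unfolding smooth_on_def using higher_diff_on_subset by blast

lemma smooth_on_const [intro]: "smooth_on S (\<lambda>_. c)"
  unfolding smooth_on_def using higher_diff_on_const by blast

lemma smooth_on_bounded_linear:
  "bounded_linear l \<Longrightarrow> open S \<Longrightarrow> smooth_on S f \<Longrightarrow> smooth_on S (\<lambda>x. l (f x))"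
  unfolding smooth_on_def using higher_diff_on_bounded_linear[of l S _ f] by blast

lemma smooth_on_add: "open S \<Longrightarrow> smooth_on S f \<Longrightarrow> smooth_on S g \<Longrightarrow> smooth_on S (\<lambda>x. f x + g x)"
  unfolding smooth_on_def using higher_diff_on_add[of S _ f g] by blast

lemma smooth_on_diff: "open S \<Longrightarrow> smooth_on S f \<Longrightarrow> smooth_on S g \<Longrightarrow> smooth_on S (\<lambda>x. f x - g x)"
  using smooth_on_add[OF _ _ smooth_on_bounded_linear[OF bounded_linear_minus[OF bounded_linear_ident]], of S f g]
  by simp

lemma smooth_on_sum:
  "open S \<Longrightarrow> (\<And>i. i \<in> K \<Longrightarrow> smooth_on S (f i)) \<Longrightarrow> smooth_on S (\<lambda>x. \<Sum>i\<in>K. f i x)"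
  unfolding smooth_on_def using higher_diff_on_sum[of S K _ f] by blast

lemma smooth_on_bilinear:
  "bounded_bilinear b \<Longrightarrow> open S \<Longrightarrow> smooth_on S f \<Longrightarrow> smooth_on S g \<Longrightarrow> smooth_on S (\<lambda>x. b (f x) (g x))"
  unfolding smooth_on_def using higher_diff_on_bilinear[of b S _ f g] by blast

lemmas smooth_on_scaleR = smooth_on_bilinear[OF bounded_bilinear_scaleR]
  and smooth_on_mult = smooth_on_bilinear[OF bounded_bilinear_mult]
  and smooth_on_inner = smooth_on_bilinear[OF bounded_bilinear_inner]

lemma smooth_on_linear_apply:
  fixes F :: "'d::real_normed_vector \<Rightarrow> 'e::euclidean_space \<Rightarrow> 'b::real_normed_vector"
  shows "open S \<Longrightarrow> (\<And>x. x \<in> S \<Longrightarrow> linear (F x)) \<Longrightarrow> (\<And>e. smooth_on S (\<lambda>x. F x e)) \<Longrightarrow>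
    smooth_on S a \<Longrightarrow> smooth_on S (\<lambda>x. F x (a x))"
  unfolding smooth_on_def using higher_diff_on_linear_apply[of S F _ a] by blast

lemma smooth_on_compose:
  fixes f :: "'e::euclidean_space \<Rightarrow> 'b::real_normed_vector"
  shows "open S \<Longrightarrow> smooth_on S g \<Longrightarrow> smooth_on T f \<Longrightarrow> g ` S \<subseteq> T \<Longrightarrow> smooth_on S (\<lambda>x. f (g x))"
  unfolding smooth_on_def using higher_diff_on_compose[of S _ g T f] by blast

lemma smooth_on_id: "smooth_on S (\<lambda>x. x)"
proof -
  have "higher_diff_on k S (\<lambda>x. x)" for k
    by (cases k) (auto intro: continuous_on_id higher_diff_on_const)
  then show ?thesis by (simp add: smooth_on_def)
qed

lemma smooth_on_covec:
  assumes "open S" and "\<And>u. smooth_on S (\<lambda>x. f x u)"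
  shows "smooth_on S (\<lambda>x. covec (f x))"
  unfolding covec_def
  by (intro smooth_on_sum smooth_on_scaleR assms smooth_on_const)

lemma smooth_on_has_derivative:
  assumes "smooth_on S f" and "x \<in> S"
  shows "(f has_derivative frechet_derivative f (at x)) (at x)"
  using assms higher_diff_on_Suc_has_derivative unfolding smooth_on_def by blast

lemma smooth_on_frechet_derivative:
  assumes "smooth_on S f"
  shows "smooth_on S (\<lambda>x. frechet_derivative f (at x) v)"
  unfolding smooth_on_def
proof
  fix k have "higher_diff_on (Suc k) S f" using assms unfolding smooth_on_def by blast
  then show "higher_diff_on k S (\<lambda>x. frechet_derivative f (at x) v)" by simp
qed

lemma smooth_on_continuous_on: "smooth_on S f \<Longrightarrow> continuous_on S f"
  unfolding smooth_on_def using higher_diff_on.simps(1) by blast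

lemma smooth_on_has_vector_derivative:
  fixes f :: "real \<Rightarrow> 'b::real_normed_vector"
  assumes "smooth_on S f" and "t \<in> S"
  shows "(f has_vector_derivative vector_derivative f (at t)) (at t)"
  using smooth_on_has_derivative[OF assms] vector_derivative_works[of f "at t"]
  by (auto simp: differentiable_def)

lemma smooth_on_vector_derivative:
  fixes f :: "real \<Rightarrow> 'b::real_normed_vector"
  assumes "open S" and "smooth_on S f"
  shows "smooth_on S (\<lambda>t. vector_derivative f (at t))"
proof (rule smooth_on_cong[OF assms(1) _ smooth_on_frechet_derivative[OF assms(2), of 1]])
  fix t assume "t \<in> S"
  have "frechet_derivative f (at t) = (\<lambda>s. s *\<^sub>R vector_derivative f (at t))"
    using smooth_on_has_vector_derivative[OF assms(2) \<open>t \<in> S\<close>] frechet_derivative_at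
    unfolding has_vector_derivative_def by fastforce
  then show "frechet_derivative f (at t) 1 = vector_derivative f (at t)" by simp
qed

text \<open>A Leibniz rule for families of linear maps that are differentiable on each fixed vector;
  again the basis expansion reduces it to products.\<close>

lemma has_derivative_linear_apply:
  fixes F :: "'d::real_normed_vector \<Rightarrow> 'e::euclidean_space \<Rightarrow> 'b::real_normed_vector"
  assumes lin: "\<forall>\<^sub>F y in nhds x. linear (F y)"
    and d: "\<And>e. ((\<lambda>y. F y e) has_derivative F' e) (at x)"
    and a: "(a has_derivative a') (at x)"
  shows "((\<lambda>y. F y (a y)) has_derivative (\<lambda>h. F' (a x) h + F x (a' h))) (at x)"
proof -
  have eq: "(\<Sum>b\<in>Basis. (c \<bullet> b) *\<^sub>R F y b) = F y c" if "linear (F y)" for y c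
    by (rule linear_eq_sum_Basis[OF that, symmetric])
  have ev: "\<forall>\<^sub>F y in at x. linear (F y)" and x: "linear (F x)"
    using lin by (auto simp: eventually_at_filter elim: eventually_mono dest: eventually_nhds_x_imp_x)
  have "((\<lambda>y. \<Sum>b\<in>Basis. (a x \<bullet> b) *\<^sub>R F y b) has_derivative
      (\<lambda>h. \<Sum>b\<in>Basis. (a x \<bullet> b) *\<^sub>R F' b h)) (at x)"
    by (intro has_derivative_sum has_derivative_scaleR_right d)
  then have "((\<lambda>y. F y (a x)) has_derivative (\<lambda>h. \<Sum>b\<in>Basis. (a x \<bullet> b) *\<^sub>R F' b h)) (at x)"
    by (rule has_derivative_transform_eventually) (use ev eq x in \<open>auto elim: eventually_mono\<close>)
  \<comment> \<open>\<open>F'\<close> is not assumed linear in its first argument. Comparing two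
    derivatives of the same function supplies the one instance of linearity that is used.\<close>
  from has_derivative_unique[OF this d[of "a x"]]
  have *: "(\<Sum>b\<in>Basis. (a x \<bullet> b) *\<^sub>R F' b h) = F' (a x) h" for h by (rule fun_cong)
  have "((\<lambda>y. \<Sum>b\<in>Basis. (a y \<bullet> b) *\<^sub>R F y b) has_derivative
      (\<lambda>h. \<Sum>b\<in>Basis. (a x \<bullet> b) *\<^sub>R F' b h + (a' h \<bullet> b) *\<^sub>R F x b)) (at x)"
    by (intro has_derivative_sum has_derivative_scaleR d has_derivative_inner_left a)
  then have "((\<lambda>y. \<Sum>b\<in>Basis. (a y \<bullet> b) *\<^sub>R F y b) has_derivative
      (\<lambda>h. F' (a x) h + F x (a' h))) (at x)"
    by (simp add: sum.distrib * eq[OF x])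
  then show ?thesis
    by (rule has_derivative_transform_eventually) (use ev eq x in \<open>auto elim: eventually_mono\<close>)
qed

lemma has_derivative_eventually_in_open:
  assumes "(y has_derivative y') (at x)" and "open V" and "y x \<in> V"
  shows "\<forall>\<^sub>F s in nhds x. y s \<in> V"
proof -
  have "isCont y x" using assms(1) by (rule has_derivative_continuous)
  then have "(y \<longlongrightarrow> y x) (nhds x)" by (simp add: isCont_def tendsto_at_iff_tendsto_nhds)
  then show ?thesis using assms(2,3) by (rule topological_tendstoD)
qed

text \<open>The mean value theorem is applied twice: in direction \<open>u\<close> to the difference
  of two parallel lines, then in direction \<open>v\<close> to the resulting derivative.\<close>

lemma second_difference_mean_value:
  fixes f :: "'d::real_normed_vector \<Rightarrow> real"
  assumes f: "smooth_on S f" and "s > 0"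
    and S: "\<And>a b. 0 \<le> a \<Longrightarrow> a \<le> s \<Longrightarrow> 0 \<le> b \<Longrightarrow> b \<le> s \<Longrightarrow> x + a *\<^sub>R u + b *\<^sub>R v \<in> S"
  obtains a b where "0 \<le> a" "a \<le> s" "0 \<le> b" "b \<le> s"
    "f (x + s *\<^sub>R u + s *\<^sub>R v) - f (x + s *\<^sub>R u) - f (x + s *\<^sub>R v) + f x =
       s * (s * frechet_derivative (\<lambda>y. frechet_derivative f (at y) u) (at (x + a *\<^sub>R u + b *\<^sub>R v)) v)"
proof -
  let ?D = "\<lambda>y. frechet_derivative f (at y) u"
  let ?g = "\<lambda>r. f (x + r *\<^sub>R u + s *\<^sub>R v) - f (x + r *\<^sub>R u)"
  have line: "((\<lambda>r. h (x + r *\<^sub>R u + c *\<^sub>R v)) has_real_derivative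
      frechet_derivative h (at (x + r *\<^sub>R u + c *\<^sub>R v)) u) (at r)"
    if "smooth_on S h" "0 \<le> r" "r \<le> s" "0 \<le> c" "c \<le> s" for h :: "'d \<Rightarrow> real" and r c
  proof -
    have h: "(h has_derivative frechet_derivative h (at (x + r *\<^sub>R u + c *\<^sub>R v))) (at (x + r *\<^sub>R u + c *\<^sub>R v))"
      by (rule smooth_on_has_derivative[OF that(1) S]) (use that in auto)
    have "((\<lambda>r. x + r *\<^sub>R u + c *\<^sub>R v) has_derivative (\<lambda>h. h *\<^sub>R u)) (at r)"
      by (auto intro!: derivative_eq_intros)
    from has_derivative_compose[OF this h] show ?thesis
      unfolding has_field_derivative_def
      by (simp add: linear_scale[OF has_derivative_linear[OF h]] mult.commute[of _ "frechet_derivative _ _ _"])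
  qed
  have line': "((\<lambda>q. h (x + r *\<^sub>R u + q *\<^sub>R v)) has_real_derivative
      frechet_derivative h (at (x + r *\<^sub>R u + q *\<^sub>R v)) v) (at q)"
    if "smooth_on S h" "0 \<le> r" "r \<le> s" "0 \<le> q" "q \<le> s" for h :: "'d \<Rightarrow> real" and r q
  proof -
    have h: "(h has_derivative frechet_derivative h (at (x + r *\<^sub>R u + q *\<^sub>R v))) (at (x + r *\<^sub>R u + q *\<^sub>R v))"
      by (rule smooth_on_has_derivative[OF that(1) S]) (use that in auto)
    have "((\<lambda>q. x + r *\<^sub>R u + q *\<^sub>R v) has_derivative (\<lambda>h. h *\<^sub>R v)) (at q)"
      by (auto intro!: derivative_eq_intros)
    from has_derivative_compose[OF this h] show ?thesis
      unfolding has_field_derivative_def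
      by (simp add: linear_scale[OF has_derivative_linear[OF h]] mult.commute[of _ "frechet_derivative _ _ _"])
  qed
  have "(?g has_real_derivative ?D (x + r *\<^sub>R u + s *\<^sub>R v) - ?D (x + r *\<^sub>R u)) (at r)"
    if "0 \<le> r" "r \<le> s" for r
    using DERIV_diff[OF line[OF f that, of s] line[OF f that, of 0]] assms(2) by simp
  from MVT2[OF assms(2), of ?g "\<lambda>r. ?D (x + r *\<^sub>R u + s *\<^sub>R v) - ?D (x + r *\<^sub>R u)", OF this]
  obtain a where a: "0 < a" "a < s"
    "?g s - ?g 0 = s * (?D (x + a *\<^sub>R u + s *\<^sub>R v) - ?D (x + a *\<^sub>R u))" by auto
  have "((\<lambda>q. ?D (x + a *\<^sub>R u + q *\<^sub>R v)) has_real_derivative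
      frechet_derivative ?D (at (x + a *\<^sub>R u + q *\<^sub>R v)) v) (at q)" if "0 \<le> q" "q \<le> s" for q
    using line'[OF smooth_on_frechet_derivative[OF f] _ _ that] a by simp
  from MVT2[OF assms(2), of "\<lambda>q. ?D (x + a *\<^sub>R u + q *\<^sub>R v)", OF this]
  obtain b where b: "0 < b" "b < s"
    "?D (x + a *\<^sub>R u + s *\<^sub>R v) - ?D (x + a *\<^sub>R u) =
      s * frechet_derivative ?D (at (x + a *\<^sub>R u + b *\<^sub>R v)) v" by auto
  show thesis
    by (rule that[of a b]) (use a b in \<open>auto simp: algebra_simps\<close>)
qed

text \<open>The second difference over a parallelogram does not change when \<open>u\<close> and
  \<open>v\<close> are exchanged, and in either order it is \<open>s * s\<close> times a mixed
  derivative at a point of that parallelogram. Continuity of the mixed derivatives at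
  \<open>x\<close> closes the gap as the parallelogram shrinks.\<close>

lemma second_derivative_symmetric_real:
  fixes f :: "'d::real_normed_vector \<Rightarrow> real"
  assumes f: "smooth_on S f" and "open S" and "x \<in> S"
  shows "frechet_derivative (\<lambda>y. frechet_derivative f (at y) u) (at x) v =
    frechet_derivative (\<lambda>y. frechet_derivative f (at y) v) (at x) u"
proof -
  define P where "P u v y = frechet_derivative (\<lambda>y. frechet_derivative f (at y) u) (at y) v" for u v y
  have cont: "continuous_on S (P u v)" for u v
    unfolding P_def by (intro smooth_on_continuous_on smooth_on_frechet_derivative f)
  have "\<bar>P u v x - P v u x\<bar> \<le> e" if "e > 0" for e
  proof -
    have "\<forall>\<^sub>F y in nhds x. \<bar>P u v y - P u v x\<bar> < e / 2" for u v
    proof -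
      have "isCont (P u v) x" using cont assms by (simp add: continuous_on_eq_continuous_at)
      then have "(P u v \<longlongrightarrow> P u v x) (nhds x)" by (simp add: isCont_def tendsto_at_iff_tendsto_nhds)
      from tendstoD[OF this, of "e / 2"] show ?thesis using that by (simp add: dist_real_def)
    qed
    from eventually_conj[OF eventually_conj[OF this[of u v] this[of v u]] eventually_nhds_in_open[OF assms(2,3)]]
    obtain d where d: "d > 0" "\<And>y. dist y x < d \<Longrightarrow>
      \<bar>P u v y - P u v x\<bar> < e / 2 \<and> \<bar>P v u y - P v u x\<bar> < e / 2 \<and> y \<in> S"
      unfolding eventually_nhds_metric by auto
    \<comment> \<open>Small enough to keep the whole parallelogram in the ball of radius
      \<open>d\<close>; the summand 1 makes the bound strict and covers
      \<open>u = v = 0\<close>.\<close>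
    define s where "s = d / (norm u + norm v + 1)"
    have n: "norm u + norm v + 1 > 0" by (smt (verit) norm_ge_zero)
    have s: "s > 0" unfolding s_def using d n by simp
    have near: "dist (x + a *\<^sub>R u + b *\<^sub>R v) x < d" "dist (x + b *\<^sub>R v + a *\<^sub>R u) x < d"
      if "0 \<le> a" "a \<le> s" "0 \<le> b" "b \<le> s" for a b
    proof -
      have "norm (a *\<^sub>R u + b *\<^sub>R v) \<le> a * norm u + b * norm v"
        using norm_triangle_ineq[of "a *\<^sub>R u" "b *\<^sub>R v"] that by simp
      also have "\<dots> \<le> s * norm u + s * norm v"
        using that by (intro add_mono mult_right_mono) auto
      also have "\<dots> < s * (norm u + norm v + 1)" using s by (simp add: algebra_simps)
      also have "\<dots> = d" unfolding s_def using n by simp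
      finally have n: "norm (a *\<^sub>R u + b *\<^sub>R v) < d" .
      from n show "dist (x + a *\<^sub>R u + b *\<^sub>R v) x < d" by (simp add: dist_norm algebra_simps)
      from n show "dist (x + b *\<^sub>R v + a *\<^sub>R u) x < d" by (simp add: dist_norm algebra_simps)
    qed
    obtain a b where ab: "0 \<le> a" "a \<le> s" "0 \<le> b" "b \<le> s"
      "f (x + s *\<^sub>R u + s *\<^sub>R v) - f (x + s *\<^sub>R u) - f (x + s *\<^sub>R v) + f x =
         s * (s * P u v (x + a *\<^sub>R u + b *\<^sub>R v))"
      unfolding P_def
      by (rule second_difference_mean_value[OF f s, of x u v]) (use d(2) near in blast)+
    obtain a' b' where ab': "0 \<le> a'" "a' \<le> s" "0 \<le> b'" "b' \<le> s"
      "f (x + s *\<^sub>R v + s *\<^sub>R u) - f (x + s *\<^sub>R v) - f (x + s *\<^sub>R u) + f x =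
         s * (s * P v u (x + a' *\<^sub>R v + b' *\<^sub>R u))"
      unfolding P_def
      by (rule second_difference_mean_value[OF f s, of x v u]) (use d(2) near in blast)+
    have "s * (s * P u v (x + a *\<^sub>R u + b *\<^sub>R v)) = s * (s * P v u (x + a' *\<^sub>R v + b' *\<^sub>R u))"
      unfolding ab(5)[symmetric] ab'(5)[symmetric] by (simp add: algebra_simps)
    then have "P u v (x + a *\<^sub>R u + b *\<^sub>R v) = P v u (x + a' *\<^sub>R v + b' *\<^sub>R u)" using s by simp
    moreover have "\<bar>P u v (x + a *\<^sub>R u + b *\<^sub>R v) - P u v x\<bar> < e / 2"
      using d(2)[OF near(1)[OF ab(1-4)]] by blast
    moreover have "\<bar>P v u (x + a' *\<^sub>R v + b' *\<^sub>R u) - P v u x\<bar> < e / 2"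
      using d(2)[OF near(2)[OF ab'(3,4,1,2)]] by blast
    ultimately show ?thesis by arith
  qed
  then have "\<bar>P u v x - P v u x\<bar> \<le> 0" by (rule field_le_epsilon) simp
  then show ?thesis unfolding P_def by simp
qed

lemma frechet_derivative_inner:
  assumes "smooth_on S f" and "y \<in> S"
  shows "frechet_derivative (\<lambda>y. f y \<bullet> b) (at y) w = frechet_derivative f (at y) w \<bullet> b"
  using frechet_derivative_at[OF has_derivative_inner_left[OF smooth_on_has_derivative[OF assms]], of b]
  by (metis)

text \<open>The two functions have the same set of derivatives at \<open>x\<close>, and
  \<open>frechet_derivative\<close> is a choice from that set; so differentiability is not
  assumed.\<close>

lemma frechet_derivative_cong_open:
  assumes "open S" and "x \<in> S" and "\<And>y. y \<in> S \<Longrightarrow> f y = g y"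
  shows "frechet_derivative f (at x) = frechet_derivative g (at x)"
proof -
  have "(f has_derivative D) (at x) \<longleftrightarrow> (g has_derivative D) (at x)" for D
    using has_derivative_transform_within_open[OF _ assms(1,2)] assms(3) by metis
  then show ?thesis unfolding frechet_derivative_def by simp
qed

lemma second_derivative_symmetric:
  fixes f :: "'d::real_normed_vector \<Rightarrow> 'b::euclidean_space"
  assumes f: "smooth_on S f" and "open S" and "x \<in> S"
  shows "frechet_derivative (\<lambda>y. frechet_derivative f (at y) u) (at x) v =
    frechet_derivative (\<lambda>y. frechet_derivative f (at y) v) (at x) u"
proof (rule euclidean_eqI)
  fix b :: 'b
  have *: "frechet_derivative (\<lambda>y. frechet_derivative f (at y) u) (at x) v \<bullet> b =
      frechet_derivative (\<lambda>y. frechet_derivative (\<lambda>y. f y \<bullet> b) (at y) u) (at x) v" for u v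
  proof -
    have "frechet_derivative (\<lambda>y. frechet_derivative (\<lambda>y. f y \<bullet> b) (at y) u) (at x)
       = frechet_derivative (\<lambda>y. frechet_derivative f (at y) u \<bullet> b) (at x)"
      by (rule frechet_derivative_cong_open[OF assms(2,3)]) (rule frechet_derivative_inner[OF f])
    then show ?thesis
      by (simp add: frechet_derivative_inner[OF smooth_on_frechet_derivative[OF f] assms(3)])
  qed
  show "frechet_derivative (\<lambda>y. frechet_derivative f (at y) u) (at x) v \<bullet> b =
    frechet_derivative (\<lambda>y. frechet_derivative f (at y) v) (at x) u \<bullet> b"
    unfolding *
    by (rule second_derivative_symmetric_real[OF smooth_on_bounded_linear[OF bounded_linear_inner_left assms(2,1)] assms(2,3)])
qed

text \<open>Since \<alpha> vanishes at \<open>x\<close>, it is of first order there, and its product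
  with \<phi> - \<phi>(x) is of smaller order already when \<phi> is continuous. This gives the
  derivative of \<open>sharp\<close> before any differentiability of it is known.\<close>

lemma has_derivative_scaleR_vanishing:
  fixes \<phi> :: "'d::real_normed_vector \<Rightarrow> 'b::real_normed_vector"
  assumes a: "(\<alpha> has_derivative \<alpha>') (at x)" and "\<alpha> x = 0" and \<phi>: "isCont \<phi> x"
  shows "((\<lambda>y. \<alpha> y *\<^sub>R \<phi> y) has_derivative (\<lambda>h. \<alpha>' h *\<^sub>R \<phi> x)) (at x)"
proof -
  have lin: "bounded_linear \<alpha>'" using a by (rule has_derivative_bounded_linear)
  then obtain K where K: "\<And>h. norm (\<alpha>' h) \<le> norm h * K" using bounded_linear.bounded by blast
  have lim: "((\<lambda>y. norm (\<alpha> y - \<alpha>' (y - x)) / norm (y - x)) \<longlongrightarrow> 0) (at x)"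
    using a assms(2) by (simp add: has_derivative_iff_norm)
  have "((\<lambda>y. norm (\<phi> y - \<phi> x)) \<longlongrightarrow> 0) (at x)"
    using \<phi> by (simp add: isCont_def tendsto_norm_zero_iff LIM_zero)
  from tendsto_mult[OF tendsto_add[OF lim tendsto_const[of K]] this]
  have lim0: "((\<lambda>y. (norm (\<alpha> y - \<alpha>' (y - x)) / norm (y - x) + K) * norm (\<phi> y - \<phi> x)) \<longlongrightarrow> 0) (at x)"
    by simp
  have "((\<lambda>y. \<alpha> y *\<^sub>R (\<phi> y - \<phi> x)) has_derivative (\<lambda>h. 0)) (at x)"
    unfolding has_derivative_iff_norm
  proof (intro conjI bounded_linear_zero tendsto_sandwich[OF _ _ tendsto_const lim0])
    have "norm (\<alpha> y *\<^sub>R (\<phi> y - \<phi> x)) / norm (y - x)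
        \<le> (norm (\<alpha> y - \<alpha>' (y - x)) / norm (y - x) + K) * norm (\<phi> y - \<phi> x)" if "y \<noteq> x" for y
    proof -
      have "norm (\<alpha> y) \<le> norm (\<alpha> y - \<alpha>' (y - x)) + norm (y - x) * K"
        using norm_triangle_sub[of "\<alpha> y" "\<alpha>' (y - x)"] K[of "y - x"] by simp
      then have "norm (\<alpha> y) / norm (y - x) \<le> (norm (\<alpha> y - \<alpha>' (y - x)) + norm (y - x) * K) / norm (y - x)"
        by (rule divide_right_mono) simp
      also have "\<dots> = norm (\<alpha> y - \<alpha>' (y - x)) / norm (y - x) + K"
        using that by (simp add: add_divide_distrib)
      finally have "norm (\<alpha> y) / norm (y - x) * norm (\<phi> y - \<phi> x)
          \<le> (norm (\<alpha> y - \<alpha>' (y - x)) / norm (y - x) + K) * norm (\<phi> y - \<phi> x)"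
        by (rule mult_right_mono) simp
      then show ?thesis by simp
    qed
    then show "\<forall>\<^sub>F y in at x. norm (\<alpha> y *\<^sub>R (\<phi> y - \<phi> x) - \<alpha> x *\<^sub>R (\<phi> x - \<phi> x) - 0) / norm (y - x)
        \<le> (norm (\<alpha> y - \<alpha>' (y - x)) / norm (y - x) + K) * norm (\<phi> y - \<phi> x)"
      by (auto simp: eventually_at intro: exI[of _ 1])
  qed simp
  from has_derivative_add[OF has_derivative_scaleR_left[OF a, of "\<phi> x"] this]
  show ?thesis by (simp add: algebra_simps)
qed

section \<open>Levi-Civita connection and curvature\<close>

lemma linear_covec:
  assumes "\<And>u. linear (\<lambda>v. f v u)"
  shows "linear (\<lambda>v. covec (f v))"
  by (rule linearI) (simp_all add: covec_def linear_add[OF assms] linear_scale[OF assms]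
      sum.distrib scaleR_left_distrib scaleR_sum_right)

locale riemannian_domain =
  fixes V :: "'e::euclidean_space set" and G :: "'e \<Rightarrow> 'e \<Rightarrow> 'e \<Rightarrow> real"
  assumes metric: "metric_on V G" and open_dom: "open V"
begin

lemma bil: "x \<in> V \<Longrightarrow> bilinear (G x)"
  and commute: "x \<in> V \<Longrightarrow> G x u v = G x v u"
  and pos: "x \<in> V \<Longrightarrow> u \<noteq> 0 \<Longrightarrow> G x u u > 0"
  and smooth_metric: "smooth_on V (\<lambda>x. G x u v)"
  using metric unfolding metric_on_def by blast+

lemma linear_right: "x \<in> V \<Longrightarrow> linear (G x u)"
  and linear_left: "x \<in> V \<Longrightarrow> linear (\<lambda>u. G x u v)"
  using bil[of x] by (auto simp: bilinear_def)

lemmas metric_simps =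
  linear_add[OF linear_right] linear_add[OF linear_left]
  linear_diff[OF linear_right] linear_diff[OF linear_left]
  linear_neg[OF linear_right] linear_neg[OF linear_left]
  linear_scale[OF linear_right] linear_scale[OF linear_left]
  linear_0[OF linear_right] linear_0[OF linear_left]

lemma nondegenerate:
  assumes "x \<in> V" and "\<And>u. G x v u = G x w u"
  shows "v = w"
proof (rule ccontr)
  assume "v \<noteq> w"
  then have "G x (v - w) (v - w) > 0" using pos[OF assms(1)] by simp
  then show False using assms by (simp add: metric_simps)
qed

lemma sharp: "x \<in> V \<Longrightarrow> G x (sharp (G x) p) u = p \<bullet> u"
  by (rule metric_on_sharp[OF metric])

lemma sharp_eqI: "x \<in> V \<Longrightarrow> (\<And>u. G x v u = p \<bullet> u) \<Longrightarrow> sharp (G x) p = v"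
  by (rule nondegenerate) (auto simp: sharp)

lemma linear_sharp: "x \<in> V \<Longrightarrow> linear (sharp (G x))"
  by (rule linearI) (auto intro!: sharp_eqI simp: metric_simps sharp inner_add_left)

lemma sharp_covec: "x \<in> V \<Longrightarrow> sharp (G x) (covec (G x v)) = v"
  by (rule sharp_eqI) (simp_all add: covec_inner[OF linear_right])

lemma covec_sharp: "x \<in> V \<Longrightarrow> covec (G x (sharp (G x) p)) = p"
  by (rule vector_eq_rdot[THEN iffD1]) (simp add: covec_inner[OF linear_right] sharp)

lemma linear_flat: "x \<in> V \<Longrightarrow> linear (\<lambda>v. covec (G x v))"
  by (rule linear_covec) (rule linear_left)

lemma cometric: "x \<in> V \<Longrightarrow> cometric (G x) p q = p \<bullet> sharp (G x) q"
  by (simp add: cometric_def sharp)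

lemma smooth_flat: "smooth_on V (\<lambda>x. covec (G x v))"
  by (rule smooth_on_covec[OF open_dom smooth_metric])

section \<open>Smooth dependence of the inverse metric on the base point\<close>

lemma sharp_locally_bounded:
  assumes "x0 \<in> V"
  obtains K where "\<forall>\<^sub>F x in nhds x0. \<forall>p. norm (sharp (G x) p) \<le> K * norm p"
proof -
  obtain K where K: "K > 0" "\<And>q. norm (sharp (G x0) q) \<le> K * norm q"
    using linear_bounded_pos[OF linear_sharp[OF assms]] by blast
  \<comment> \<open>A bound for the operator norm of the difference of the two flat maps at
    \<open>x0\<close> and \<open>x\<close>; it is continuous and vanishes at
    \<open>x0\<close>.\<close>
  define e where "e x = (\<Sum>b\<in>Basis. norm (covec (G x0 b) - covec (G x b)))" for x
  have "isCont (\<lambda>x. covec (G x b)) x0" for b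
    using smooth_on_continuous_on[OF smooth_flat] assms open_dom by (simp add: continuous_on_eq_continuous_at)
  then have "isCont e x0" unfolding e_def by (intro continuous_intros)
  then have "(e \<longlongrightarrow> 0) (nhds x0)" unfolding isCont_def tendsto_at_iff_tendsto_nhds by (simp add: e_def)
  \<comment> \<open>With this threshold the perturbation term in the equation for \<open>?v\<close>
    is at most half of \<open>norm ?v\<close> and can be absorbed, which turns the constant
    \<open>K\<close> into \<open>2 * K\<close>.\<close>
  then have "\<forall>\<^sub>F x in nhds x0. e x < 1 / (2 * K)" using K by (intro order_tendstoD(2)) auto
  then have "\<forall>\<^sub>F x in nhds x0. \<forall>p. norm (sharp (G x) p) \<le> 2 * K * norm p"
    using eventually_nhds_in_open[OF open_dom assms]
  proof eventually_elim
    case (elim x)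
    show ?case
    proof
      fix p
      let ?v = "sharp (G x) p"
      have l: "linear (\<lambda>v. covec (G x0 v) - covec (G x v))"
        by (rule linear_compose_sub[OF linear_flat[OF assms] linear_flat[OF elim(2)]])
      have "norm (covec (G x0 ?v) - covec (G x ?v)) \<le> (\<Sum>b\<in>Basis. norm ((?v \<bullet> b) *\<^sub>R (covec (G x0 b) - covec (G x b))))"
        by (subst linear_eq_sum_Basis[OF l]) (rule norm_sum)
      also have "\<dots> \<le> (\<Sum>b\<in>Basis. norm ?v * norm (covec (G x0 b) - covec (G x b)))"
        by (rule sum_mono) (simp add: mult_right_mono Basis_le_norm)
      also have "\<dots> = norm ?v * e x" by (simp add: e_def sum_distrib_left)
      also have "\<dots> \<le> norm ?v * (1 / (2 * K))" using elim(1) by (intro mult_left_mono) auto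
      finally have 1: "K * norm (covec (G x0 ?v) - covec (G x ?v)) \<le> norm ?v / 2"
        using K(1) by (simp add: field_simps)
      have "?v = sharp (G x0) p + sharp (G x0) (covec (G x0 ?v) - covec (G x ?v))"
        by (simp add: linear_diff[OF linear_sharp[OF assms]] sharp_covec[OF assms] covec_sharp[OF elim(2)])
      then have "norm ?v \<le> norm (sharp (G x0) p) + norm (sharp (G x0) (covec (G x0 ?v) - covec (G x ?v)))"
        by (metis norm_triangle_ineq)
      also have "\<dots> \<le> K * norm p + norm ?v / 2" by (intro add_mono order_trans[OF K(2) 1] K(2))
      finally show "norm ?v \<le> 2 * K * norm p" by simp
    qed
  qed
  then show thesis by (rule that)
qed

text \<open>With \<open>?q\<close> the value at \<open>x0\<close>, the difference
  \<open>sharp (G x) p - ?q\<close> equals \<open>sharp (G x) (p - covec (G x ?q))\<close>. The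
  argument tends to 0 and the maps \<open>sharp (G x)\<close> are uniformly bounded near
  \<open>x0\<close>.\<close>

lemma isCont_sharp:
  assumes "x0 \<in> V"
  shows "isCont (\<lambda>x. sharp (G x) p) x0"
proof -
  obtain K where K: "\<forall>\<^sub>F x in nhds x0. \<forall>p. norm (sharp (G x) p) \<le> K * norm p"
    by (rule sharp_locally_bounded[OF assms])
  let ?q = "sharp (G x0) p"
  have "isCont (\<lambda>x. covec (G x ?q)) x0"
    using smooth_on_continuous_on[OF smooth_flat] assms open_dom by (simp add: continuous_on_eq_continuous_at)
  then have "((\<lambda>x. covec (G x ?q)) \<longlongrightarrow> p) (nhds x0)"
    using tendsto_at_iff_tendsto_nhds[of "\<lambda>x. covec (G x ?q)" x0] unfolding isCont_def
    by (simp only: covec_sharp[OF assms])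
  then have lim: "((\<lambda>x. K * norm (p - covec (G x ?q))) \<longlongrightarrow> 0) (nhds x0)"
    by (auto intro!: tendsto_eq_intros)
  have "\<forall>\<^sub>F x in nhds x0. norm (sharp (G x) p - ?q) \<le> K * norm (p - covec (G x ?q))"
    using K eventually_nhds_in_open[OF open_dom assms]
  proof eventually_elim
    case (elim x)
    have "sharp (G x) p - ?q = sharp (G x) (p - covec (G x ?q))"
      by (simp add: linear_diff[OF linear_sharp[OF elim(2)]] sharp_covec[OF elim(2)])
    then show ?case using elim(1) by simp
  qed
  then have "((\<lambda>x. sharp (G x) p - ?q) \<longlongrightarrow> 0) (nhds x0)"
    by (rule Lim_null_comparison) (rule lim)
  then have "((\<lambda>x. sharp (G x) p) \<longlongrightarrow> ?q) (nhds x0)" by (rule iffD2[OF Lim_null])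
  then show ?thesis unfolding isCont_def by (rule iffD2[OF tendsto_at_iff_tendsto_nhds])
qed

text \<open>With \<open>q = sharp (G x0) p\<close> one has \<open>sharp (G x) p = q + sharp (G x) (p - covec (G x q))\<close>; the last
  argument vanishes at \<open>x0\<close>, so continuity of \<open>sharp (G x)\<close> in \<open>x\<close> suffices for the derivative.\<close>

lemma has_derivative_sharp:
  assumes "x0 \<in> V"
  shows "((\<lambda>x. sharp (G x) p) has_derivative
    (\<lambda>h. - sharp (G x0) (covec (\<lambda>u. frechet_derivative (\<lambda>y. G y (sharp (G x0) p) u) (at x0) h)))) (at x0)"
proof -
  let ?q = "sharp (G x0) p"
  let ?a' = "\<lambda>h. - covec (\<lambda>u. frechet_derivative (\<lambda>y. G y ?q u) (at x0) h)"
  have a: "((\<lambda>x. p - covec (G x ?q)) has_derivative ?a') (at x0)"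
    unfolding covec_def
    by (auto intro!: derivative_eq_intros metric_on_deriv[OF metric open_dom assms] simp: sum_negf)
  have "((\<lambda>x. \<Sum>b\<in>Basis. ((p - covec (G x ?q)) \<bullet> b) *\<^sub>R sharp (G x) b) has_derivative
      (\<lambda>h. \<Sum>b\<in>Basis. (?a' h \<bullet> b) *\<^sub>R sharp (G x0) b)) (at x0)"
    by (intro has_derivative_sum has_derivative_scaleR_vanishing has_derivative_inner_left a isCont_sharp assms)
       (simp add: covec_sharp[OF assms])
  then have "((\<lambda>x. \<Sum>b\<in>Basis. ((p - covec (G x ?q)) \<bullet> b) *\<^sub>R sharp (G x) b) has_derivative
      (\<lambda>h. sharp (G x0) (?a' h))) (at x0)"
    by (simp add: linear_eq_sum_Basis[OF linear_sharp[OF assms], symmetric] del: inner_minus_left)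
  then have "((\<lambda>x. sharp (G x) p - ?q) has_derivative (\<lambda>h. sharp (G x0) (?a' h))) (at x0)"
  proof (rule has_derivative_transform_within_open[OF _ open_dom assms])
    fix x assume x: "x \<in> V"
    show "(\<Sum>b\<in>Basis. ((p - covec (G x ?q)) \<bullet> b) *\<^sub>R sharp (G x) b) = sharp (G x) p - ?q"
      by (simp add: linear_eq_sum_Basis[OF linear_sharp[OF x], symmetric] linear_diff[OF linear_sharp[OF x]]
          sharp_covec[OF x] del: inner_diff_left)
  qed
  from has_derivative_add[OF this has_derivative_const[of ?q]]
  show ?thesis by (simp add: linear_neg[OF linear_sharp[OF assms]])
qed

text \<open>A bootstrap: the derivative of \<open>sharp\<close> is again expressed by
  \<open>sharp\<close> and derivatives of the metric, so order \<open>k\<close> for all covectors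
  gives order \<open>Suc k\<close>. Hence \<open>p\<close> is arbitrary in the induction.\<close>

lemma smooth_sharp_const: "smooth_on V (\<lambda>x. sharp (G x) p)"
  unfolding smooth_on_def
proof
  fix k show "higher_diff_on k V (\<lambda>x. sharp (G x) p)"
  proof (induction k arbitrary: p)
    case 0
    then show ?case by (simp add: continuous_at_imp_continuous_on isCont_sharp)
  next
    case (Suc k)
    show ?case
    proof (rule higher_diff_on_SucI[OF open_dom has_derivative_sharp])
      fix h
      have G: "higher_diff_on k V (\<lambda>x. frechet_derivative (\<lambda>y. G y e u) (at x) h)" for e u
        using smooth_on_frechet_derivative[OF smooth_metric] unfolding smooth_on_def by blast
      have 1: "higher_diff_on k V (\<lambda>x. frechet_derivative (\<lambda>y. G y (sharp (G x) p) u) (at x) h)" for u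
        by (rule higher_diff_on_linear_apply[OF open_dom
              metric_on_deriv_linear(3)[OF metric open_dom] G Suc.IH])
      have 2: "higher_diff_on k V (\<lambda>x. covec (\<lambda>u. frechet_derivative (\<lambda>y. G y (sharp (G x) p) u) (at x) h))"
        unfolding covec_def
        by (rule higher_diff_on_sum[OF open_dom])
           (rule higher_diff_on_bilinear[OF bounded_bilinear_scaleR open_dom 1 higher_diff_on_const])
      show "higher_diff_on k V (\<lambda>x. - sharp (G x) (covec (\<lambda>u. frechet_derivative (\<lambda>y. G y (sharp (G x) p) u) (at x) h)))"
        by (rule higher_diff_on_bounded_linear[OF bounded_linear_minus[OF bounded_linear_ident] open_dom])
           (rule higher_diff_on_linear_apply[OF open_dom linear_sharp Suc.IH 2])
    qed
  qed
qed

lemma smooth_sharp: "smooth_on V \<omega> \<Longrightarrow> smooth_on V (\<lambda>x. sharp (G x) (\<omega> x))"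
  by (rule smooth_on_linear_apply[OF open_dom linear_sharp smooth_sharp_const])

lemma smooth_christoffel: "smooth_on V (\<lambda>x. christoffel G x u v)"
  unfolding christoffel_def divide_inverse
  by (intro smooth_sharp smooth_on_covec smooth_on_mult smooth_on_add smooth_on_diff smooth_on_const
      open_dom smooth_on_frechet_derivative smooth_metric)

lemma christoffel_commute: "x \<in> V \<Longrightarrow> christoffel G x u v = christoffel G x v u"
  by (rule christoffel_sym[OF metric open_dom])

lemma linear_christoffel:
  assumes "x \<in> V"
  shows "linear (christoffel G x u)" and "linear (\<lambda>u. christoffel G x u v)"
proof -
  note l = metric_on_deriv_linear[OF metric open_dom assms]
  show *: "linear (christoffel G x u)" for u
    by (rule linearI; rule nondegenerate[OF assms])
       (simp_all add: metric_simps assms christoffel_works[OF metric open_dom assms]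
         linear_add[OF l(1)] linear_add[OF l(2)] linear_add[OF l(3)]
         linear_scale[OF l(1)] linear_scale[OF l(2)] linear_scale[OF l(3)] field_simps)
  show "linear (\<lambda>u. christoffel G x u v)"
    using *[of v] by (simp add: christoffel_commute[OF assms, of _ v])
qed

text \<open>Metric compatibility as a product rule, obtained by varying the base point, the first
  and the second argument in turn. The domain of \<open>y\<close> is any normed space because
  \<open>y\<close> is later the identity, a curve, or the map of a pullback.\<close>

lemma has_derivative_metric_along:
  assumes y: "(y has_derivative y') (at s)" and ys: "y s \<in> V"
    and a: "(a has_derivative a') (at s)" and b: "(b has_derivative b') (at s)"
  shows "((\<lambda>s. G (y s) (a s) (b s)) has_derivative
    (\<lambda>h. G (y s) (a' h + christoffel G (y s) (y' h) (a s)) (b s)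
       + G (y s) (a s) (b' h + christoffel G (y s) (y' h) (b s)))) (at s)"
proof -
  let ?D = "\<lambda>u v h. frechet_derivative (\<lambda>y. G y u v) (at (y s)) (y' h)"
  have ev: "\<forall>\<^sub>F s in nhds s. y s \<in> V" by (rule has_derivative_eventually_in_open[OF y open_dom ys])
  have 0: "((\<lambda>s. G (y s) u v) has_derivative ?D u v) (at s)" for u v
    by (rule has_derivative_compose[OF y metric_on_deriv[OF metric open_dom ys]])
  have 1: "((\<lambda>s. G (y s) (a s) v) has_derivative (\<lambda>h. ?D (a s) v h + G (y s) (a' h) v)) (at s)" for v
    by (rule has_derivative_linear_apply[OF _ 0 a]) (use ev linear_left in \<open>auto elim: eventually_mono\<close>)
  have "((\<lambda>s. G (y s) (a s) (b s)) has_derivative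
      (\<lambda>h. ?D (a s) (b s) h + G (y s) (a' h) (b s) + G (y s) (a s) (b' h))) (at s)"
    by (rule has_derivative_linear_apply[OF _ 1 b]) (use ev linear_right in \<open>auto elim: eventually_mono\<close>)
  then show ?thesis
    by (simp add: christoffel_metric[OF metric open_dom ys] metric_simps ys algebra_simps)
qed

end

lemma linear_frechet_derivative_param:
  assumes "open S" and "x \<in> S" and lin: "\<And>y. y \<in> S \<Longrightarrow> linear (F y)" and sm: "\<And>e. smooth_on S (\<lambda>y. F y e)"
  shows "linear (\<lambda>e. frechet_derivative (\<lambda>y. F y e) (at x) u)"
proof (rule linearI)
  note d = smooth_on_has_derivative[OF sm assms(2)]
  fix e1 e2 r
  have "((\<lambda>y. F y (e1 + e2)) has_derivative
      (\<lambda>u. frechet_derivative (\<lambda>y. F y e1) (at x) u + frechet_derivative (\<lambda>y. F y e2) (at x) u)) (at x)"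
    by (rule has_derivative_transform_within_open[OF has_derivative_add[OF d d] assms(1,2)])
       (simp add: linear_add[OF lin])
  from fun_cong[OF frechet_derivative_at[OF this]]
  show "frechet_derivative (\<lambda>y. F y (e1 + e2)) (at x) u =
      frechet_derivative (\<lambda>y. F y e1) (at x) u + frechet_derivative (\<lambda>y. F y e2) (at x) u"
    by simp
  have "((\<lambda>y. F y (r *\<^sub>R e1)) has_derivative (\<lambda>u. r *\<^sub>R frechet_derivative (\<lambda>y. F y e1) (at x) u)) (at x)"
    by (rule has_derivative_transform_within_open[OF has_derivative_scaleR_right[OF d] assms(1,2)])
       (simp add: linear_scale[OF lin])
  from fun_cong[OF frechet_derivative_at[OF this]]
  show "frechet_derivative (\<lambda>y. F y (r *\<^sub>R e1)) (at x) u = r *\<^sub>R frechet_derivative (\<lambda>y. F y e1) (at x) u"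
    by simp
qed

lemma frechet_derivative_linear_apply:
  fixes F :: "'d::real_normed_vector \<Rightarrow> 'e::euclidean_space \<Rightarrow> 'b::real_normed_vector"
  assumes "open S" and "x \<in> S" and lin: "\<And>y. y \<in> S \<Longrightarrow> linear (F y)" and sm: "\<And>e. smooth_on S (\<lambda>y. F y e)"
    and a: "smooth_on S a"
  shows "frechet_derivative (\<lambda>y. F y (a y)) (at x) u =
    frechet_derivative (\<lambda>y. F y (a x)) (at x) u + F x (frechet_derivative a (at x) u)"
proof -
  have "\<forall>\<^sub>F y in nhds x. linear (F y)"
    by (rule eventually_mono[OF eventually_nhds_in_open[OF assms(1,2)] lin])
  from has_derivative_linear_apply[OF this smooth_on_has_derivative[OF sm assms(2)]
      smooth_on_has_derivative[OF a assms(2)]]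
  show ?thesis by (rule frechet_derivative_at[THEN fun_cong, symmetric])
qed

lemma frechet_derivative_add:
  assumes "smooth_on S f" and "smooth_on S g" and "x \<in> S"
  shows "frechet_derivative (\<lambda>y. f y + g y) (at x) u = frechet_derivative f (at x) u + frechet_derivative g (at x) u"
  by (rule frechet_derivative_at[THEN fun_cong, symmetric])
     (intro has_derivative_add smooth_on_has_derivative[OF assms(1,3)] smooth_on_has_derivative[OF assms(2,3)])

section \<open>The curvature tensor and its symmetries\<close>

context riemannian_domain
begin

lemma smooth_nabla:
  assumes "smooth_on V a"
  shows "smooth_on V (nabla G (\<lambda>_. u) a)"
proof -
  have "smooth_on V (\<lambda>x. christoffel G x u (a x))"
    by (rule smooth_on_linear_apply[OF open_dom linear_christoffel(1) smooth_christoffel assms])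
  then have "smooth_on V (\<lambda>x. nabla G (\<lambda>_. u) a x)"
    unfolding nabla_def by (intro smooth_on_add open_dom smooth_on_frechet_derivative assms)
  then show ?thesis by simp
qed

lemma nabla_cong: "x \<in> V \<Longrightarrow> (\<And>y. y \<in> V \<Longrightarrow> a y = b y) \<Longrightarrow> nabla G X a x = nabla G X b x"
  unfolding nabla_def using frechet_derivative_cong_open[OF open_dom, of x a b] by simp

lemma nabla_const: "nabla G (\<lambda>_. u) (\<lambda>_. w) = (\<lambda>y. christoffel G y u w)"
  by (simp add: nabla_def frechet_derivative_const fun_eq_iff)

text \<open>Fields with constant components have zero Lie bracket, so the third term of
  \<open>curvature_field\<close> vanishes.\<close>

lemma curvature_eq:
  assumes "x \<in> V"
  shows "curvature G x u v w =
    nabla G (\<lambda>_. u) (\<lambda>y. christoffel G y v w) x - nabla G (\<lambda>_. v) (\<lambda>y. christoffel G y u w) x"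
  using linear_0[OF linear_christoffel(2)[OF assms]]
  by (simp add: curvature_def curvature_field_def nabla_const)
     (simp add: nabla_def lie_bracket_def frechet_derivative_const)

text \<open>\<open>curvature\<close> is defined through constant fields, but the field
  \<open>J y w\<close> varies with \<open>y\<close>. The second derivatives of \<open>a\<close>
  cancel by symmetry and the terms with one derivative of \<open>a\<close> cancel in pairs, so only
  the value \<open>a x\<close> survives.\<close>

lemma ricci_identity:
  assumes x: "x \<in> V" and a: "smooth_on V a"
  shows "nabla G (\<lambda>_. u) (nabla G (\<lambda>_. v) a) x - nabla G (\<lambda>_. v) (nabla G (\<lambda>_. u) a) x = curvature G x u v (a x)"
proof -
  have d: "frechet_derivative (\<lambda>y. christoffel G y v (a y)) (at x) u =
      frechet_derivative (\<lambda>y. christoffel G y v (a x)) (at x) u + christoffel G x v (frechet_derivative a (at x) u)" for u v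
    by (rule frechet_derivative_linear_apply[OF open_dom x linear_christoffel(1) smooth_christoffel a])
  have s: "smooth_on V (\<lambda>y. christoffel G y v (a y))" for v
    by (rule smooth_on_linear_apply[OF open_dom linear_christoffel(1) smooth_christoffel a])
  have n: "nabla G (\<lambda>_. u) a = (\<lambda>y. frechet_derivative a (at y) u + christoffel G y u (a y))" for u
    by (simp add: nabla_def fun_eq_iff)
  show ?thesis
    unfolding curvature_eq[OF x] n
    by (simp add: nabla_def frechet_derivative_add[OF smooth_on_frechet_derivative[OF a] s x] d
        linear_add[OF linear_christoffel(1)[OF x]] second_derivative_symmetric[OF a open_dom x, of u v])
qed

lemma smooth_curvature: "smooth_on V (\<lambda>x. curvature G x u v w)"
  by (rule smooth_on_cong[OF open_dom curvature_eq[symmetric]], assumption)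
     (intro smooth_on_diff open_dom smooth_nabla smooth_christoffel)

lemma linear_curvature:
  assumes x: "x \<in> V"
  shows "linear (\<lambda>w. curvature G x u v w)" and "linear (\<lambda>v. curvature G x u v w)"
    and "linear (\<lambda>u. curvature G x u v w)"
proof -
  note D = linear_frechet_derivative_param[OF open_dom x linear_christoffel(1) smooth_christoffel]
    linear_frechet_derivative_param[OF open_dom x linear_christoffel(2) smooth_christoffel]
  note \<Gamma> = linear_christoffel[OF x]
  have l: "linear (frechet_derivative (\<lambda>y. christoffel G y v w) (at x))" for v w
    by (rule has_derivative_linear[OF smooth_on_has_derivative[OF smooth_christoffel x]])
  note simps = curvature_eq[OF x] nabla_def linear_add[OF D(1)] linear_add[OF D(2)] linear_add[OF l]
    linear_add[OF \<Gamma>(1)] linear_add[OF \<Gamma>(2)]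
    linear_scale[OF D(1)] linear_scale[OF D(2)] linear_scale[OF l]
    linear_scale[OF \<Gamma>(1)] linear_scale[OF \<Gamma>(2)] scaleR_right_diff_distrib scaleR_right_distrib
  show "linear (\<lambda>w. curvature G x u v w)"
    by (rule linearI) (simp_all add: simps)
  show "linear (\<lambda>v. curvature G x u v w)"
    by (rule linearI) (simp_all add: simps)
  show "linear (\<lambda>u. curvature G x u v w)"
    by (rule linearI) (simp_all add: simps)
qed

lemma curvature_skew: "x \<in> V \<Longrightarrow> curvature G x u v w = - curvature G x v u w"
  by (simp add: curvature_eq)

lemma curvature_self: "x \<in> V \<Longrightarrow> curvature G x u u w = 0"
  by (simp add: curvature_eq)

text \<open>Torsion-freeness: after exchanging the two lower arguments of the Christoffel symbols,
  the six terms cancel in pairs.\<close>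

lemma curvature_bianchi:
  assumes x: "x \<in> V"
  shows "curvature G x u v w + curvature G x v w u + curvature G x w u v = 0"
proof -
  have "nabla G (\<lambda>_. u) (\<lambda>y. christoffel G y v w) x = nabla G (\<lambda>_. u) (\<lambda>y. christoffel G y w v) x" for u v w
    by (rule nabla_cong[OF x christoffel_commute])
  then show ?thesis by (simp add: curvature_eq[OF x])
qed

text \<open>The function \<open>G y w z\<close> is differentiated along \<open>u\<close> and
  \<open>v\<close> in both orders by metric compatibility. The mixed terms are symmetric in
  \<open>u\<close> and \<open>v\<close>, so equality of the two second derivatives leaves the
  skew-symmetry.\<close>

lemma curvature_metric_skew:
  assumes x: "x \<in> V"
  shows "G x (curvature G x u v w) z = - G x (curvature G x u v z) w"
proof -
  let ?\<Gamma> = "christoffel G"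
  let ?N = "\<lambda>u v w. nabla G (\<lambda>_. u) (\<lambda>y. ?\<Gamma> y v w) x"
  have "frechet_derivative (\<lambda>y. frechet_derivative (\<lambda>y. G y w z) (at y) v) (at x) u =
      G x (?N u v w) z + G x (?\<Gamma> x v w) (?\<Gamma> x u z) + G x (?\<Gamma> x u w) (?\<Gamma> x v z) + G x w (?N u v z)" for u v
  proof -
    note D = has_derivative_metric_along[OF has_derivative_ident x]
    have 1: "frechet_derivative (\<lambda>y. frechet_derivative (\<lambda>y. G y w z) (at y) v) (at x) =
        frechet_derivative (\<lambda>y. G y (?\<Gamma> y v w) z + G y w (?\<Gamma> y v z)) (at x)"
      by (rule frechet_derivative_cong_open[OF open_dom x]) (rule christoffel_metric[OF metric open_dom])
    show ?thesis unfolding 1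
      using fun_cong[OF frechet_derivative_at[OF has_derivative_add[OF
            D[OF smooth_on_has_derivative[OF smooth_christoffel x] has_derivative_const, of v w z]
            D[OF has_derivative_const smooth_on_has_derivative[OF smooth_christoffel x], of w v z]]], of u, symmetric]
      by (simp add: nabla_def)
  qed
  from this[of u v] this[of v u] second_derivative_symmetric[OF smooth_metric open_dom x, of w z v u]
  have "G x (?N u v w - ?N v u w) z + G x w (?N u v z - ?N v u z) = 0"
    by (simp add: metric_simps x)
  then show ?thesis
    unfolding curvature_eq[OF x] commute[OF x, of w] by simp
qed

text \<open>The classical consequence of four Bianchi identities and the two skew-symmetries. The
  listed instances make it a linear problem whose unknowns are the values of the curvature on
  permutations of the four vectors.\<close>

lemma curvature_pair_symmetry:
  assumes x: "x \<in> V"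
  shows "G x (curvature G x u v w) z = G x (curvature G x w z u) v"
proof -
  have B: "G x (curvature G x a b c) d + G x (curvature G x b c a) d + G x (curvature G x c a b) d = 0" for a b c d
    using arg_cong[OF curvature_bianchi[OF x, of a b c], of "\<lambda>r. G x r d"] by (simp add: metric_simps x)
  have S: "G x (curvature G x a b c) d = - G x (curvature G x b a c) d" for a b c d
    using curvature_skew[OF x, of a b c] by (simp add: metric_simps x)
  note M = curvature_metric_skew[OF x]
  show ?thesis
    using B[of u v w z] B[of v w z u] B[of w z u v] B[of z u v w]
      S[of u v w z] S[of u v z w] S[of v w u z] S[of v w z u] S[of w u v z] S[of w u z v]
      S[of w z u v] S[of w z v u] S[of z u v w] S[of z u w v] S[of z v u w] S[of z v w u]
      M[of u v w z] M[of v w u z] M[of w u v z] M[of w z u v] M[of z u v w] M[of z v u w] M[of v z u w]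
      M[of u w v z] M[of u z v w]
    by linarith
qed

end

section \<open>Parallel complex structure and its effect on curvature\<close>

locale kaehler_domain = riemannian_domain V G for V :: "'e::euclidean_space set" and G +
  fixes J :: "'e \<Rightarrow> 'e \<Rightarrow> 'e"
  assumes linear_J: "x \<in> V \<Longrightarrow> linear (J x)"
    and J_J: "x \<in> V \<Longrightarrow> J x (J x u) = - u"
    and smooth_J: "smooth_on V (\<lambda>x. J x u)"
    and J_isometry: "x \<in> V \<Longrightarrow> G x (J x u) (J x v) = G x u v"
    and J_parallel: "x \<in> V \<Longrightarrow>
      frechet_derivative (\<lambda>y. J y w) (at x) u = J x (christoffel G x u w) - christoffel G x u (J x w)"
begin

lemma J_skew: "x \<in> V \<Longrightarrow> G x (J x u) v = - G x u (J x v)"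
  using J_isometry[of x u "J x v"] by (simp add: J_J metric_simps)

text \<open>\<open>J_parallel\<close> is \<nabla>J = 0 on constant fields, solved for the partial
  derivative of \<open>J\<close>; the product rule extends it to varying fields.\<close>

lemma nabla_J:
  assumes x: "x \<in> V" and a: "smooth_on V a"
  shows "nabla G (\<lambda>_. u) (\<lambda>y. J y (a y)) x = J x (nabla G (\<lambda>_. u) a x)"
  by (simp add: nabla_def frechet_derivative_linear_apply[OF open_dom x linear_J smooth_J a]
      J_parallel[OF x] linear_add[OF linear_J[OF x]])

text \<open>The Ricci identity is applied to the field \<open>J y w\<close>, out of which
  \<open>J\<close> is pulled through both covariant derivatives.\<close>

lemma curvature_J:
  assumes x: "x \<in> V"
  shows "curvature G x u v (J x w) = J x (curvature G x u v w)"
proof -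
  have "nabla G (\<lambda>_. u) (nabla G (\<lambda>_. v) (\<lambda>y. J y w)) x = J x (nabla G (\<lambda>_. u) (\<lambda>y. christoffel G y v w) x)" for u v
  proof -
    have "nabla G (\<lambda>_. u) (nabla G (\<lambda>_. v) (\<lambda>y. J y w)) x = nabla G (\<lambda>_. u) (\<lambda>y. J y (christoffel G y v w)) x"
      by (rule nabla_cong[OF x]) (simp add: nabla_J[OF _ smooth_on_const, of _ v w] nabla_const)
    then show ?thesis by (simp add: nabla_J[OF x smooth_christoffel])
  qed
  then show ?thesis
    using ricci_identity[OF x smooth_J, of u v w] by (simp add: curvature_eq[OF x] linear_diff[OF linear_J[OF x]])
qed

text \<open>Pair symmetry moves the two factors \<open>J\<close> to the last two places, where
  \<open>curvature_J\<close> and the isometry property remove them.\<close>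

lemma curvature_J_J:
  assumes x: "x \<in> V"
  shows "curvature G x (J x u) (J x v) w = curvature G x u v w"
proof (rule nondegenerate[OF x])
  fix z
  have "G x (curvature G x (J x u) (J x v) w) z = G x (curvature G x w z (J x u)) (J x v)"
    by (rule curvature_pair_symmetry[OF x])
  also have "\<dots> = G x (curvature G x w z u) v" by (simp add: curvature_J[OF x] J_isometry[OF x])
  also have "\<dots> = G x (curvature G x u v w) z" by (rule curvature_pair_symmetry[OF x])
  finally show "G x (curvature G x (J x u) (J x v) w) z = G x (curvature G x u v w) z" .
qed

end

section \<open>Covariant derivatives along curves\<close>

lemma has_vector_derivative_linear_apply:
  fixes F :: "real \<Rightarrow> 'e::euclidean_space \<Rightarrow> 'b::real_normed_vector"
  assumes "\<forall>\<^sub>F s in nhds t. linear (F s)" and "\<And>e. ((\<lambda>s. F s e) has_vector_derivative F' e) (at t)"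
    and "(a has_vector_derivative a') (at t)"
  shows "((\<lambda>s. F s (a s)) has_vector_derivative (F' (a t) + F t (a'))) (at t)"
proof -
  have l: "linear (F t)" using assms(1) by (rule eventually_nhds_x_imp_x)
  have "((\<lambda>s. F s (a s)) has_derivative (\<lambda>h. h *\<^sub>R F' (a t) + F t (h *\<^sub>R a'))) (at t)"
    by (rule has_derivative_linear_apply[where F' = "\<lambda>e h. h *\<^sub>R F' e"])
       (use assms in \<open>simp_all add: has_vector_derivative_def\<close>)
  then show ?thesis by (simp add: has_vector_derivative_def linear_scale[OF l] scaleR_right_distrib)
qed

lemma has_vector_derivative_compose_linear:
  assumes y: "(y has_vector_derivative y') (at t)" and f: "(f has_derivative f') (at (y t))"
  shows "((\<lambda>s. f (y s)) has_vector_derivative f' y') (at t)"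
  using has_derivative_compose[OF y[unfolded has_vector_derivative_def] f]
  by (simp add: has_vector_derivative_def linear_scale[OF has_derivative_linear[OF f]])

lemma has_vector_derivative_eventually_in_open:
  "(y has_vector_derivative y') (at t) \<Longrightarrow> open V \<Longrightarrow> y t \<in> V \<Longrightarrow> \<forall>\<^sub>F s in nhds t. y s \<in> V"
  unfolding has_vector_derivative_def by (rule has_derivative_eventually_in_open)

text \<open>The time set is only open: the times at which a curve meets a chart domain need not form
  an interval.\<close>

locale curve_in_domain = riemannian_domain V G for V :: "'e::euclidean_space set" and G +
  fixes T :: "real set" and y :: "real \<Rightarrow> 'e"
  assumes open_times: "open T" and smooth_curve: "smooth_on T y" and curve_in: "t \<in> T \<Longrightarrow> y t \<in> V"
begin

abbreviation "cov \<equiv> cov_deriv_along G y"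
abbreviation "cov_covec \<equiv> cov_deriv_covec_along G y"

lemma curve_derivative: "t \<in> T \<Longrightarrow> (y has_vector_derivative velocity y t) (at t)"
  unfolding velocity_def by (rule smooth_on_has_vector_derivative[OF smooth_curve])

lemma eventually_curve_in: "t \<in> T \<Longrightarrow> \<forall>\<^sub>F s in nhds t. y s \<in> V"
  by (rule has_vector_derivative_eventually_in_open[OF curve_derivative open_dom curve_in])

lemma smooth_along:
  assumes "smooth_on V f"
  shows "smooth_on T (\<lambda>s. f (y s))"
  by (rule smooth_on_compose[OF open_times smooth_curve assms]) (use curve_in in auto)

lemma smooth_sharp_along:
  assumes "smooth_on T p"
  shows "smooth_on T (\<lambda>s. sharp (G (y s)) (p s))"
  by (rule smooth_on_linear_apply[OF open_times linear_sharp[OF curve_in] _ assms])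
     (assumption, rule smooth_along[OF smooth_sharp_const])

lemma smooth_velocity: "smooth_on T (velocity y)"
  using smooth_on_vector_derivative[OF open_times smooth_curve] by (simp add: velocity_def[abs_def])

lemma smooth_christoffel_along:
  assumes "smooth_on T Z"
  shows "smooth_on T (\<lambda>s. christoffel G (y s) (velocity y s) (Z s))"
proof (rule smooth_on_linear_apply[OF open_times linear_christoffel(1)[OF curve_in] _ assms])
  show "smooth_on T (\<lambda>s. christoffel G (y s) (velocity y s) e)" for e
    by (rule smooth_on_linear_apply[OF open_times linear_christoffel(2)[OF curve_in] _ smooth_velocity])
       (assumption, rule smooth_along[OF smooth_christoffel])
qed

lemma smooth_cov_deriv_covec: "smooth_on T p \<Longrightarrow> smooth_on T (cov_covec p)"
  unfolding cov_deriv_covec_along_def[abs_def]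
  by (intro smooth_on_diff open_times smooth_on_vector_derivative smooth_on_covec smooth_on_inner
      smooth_christoffel_along smooth_on_const)

lemma cov_deriv_const: "cov (\<lambda>_. w) t = christoffel G (y t) (velocity y t) w"
  by (simp add: cov_deriv_along_def)

lemma metric_along:
  assumes "t \<in> T" and "smooth_on T a" and "smooth_on T b"
  shows "((\<lambda>s. G (y s) (a s) (b s)) has_real_derivative G (y t) (cov a t) (b t) + G (y t) (a t) (cov b t)) (at t)"
proof -
  note d = smooth_on_has_vector_derivative[OF _ assms(1), unfolded has_vector_derivative_def]
  note y = curve_in[OF assms(1)]
  have s: "h *\<^sub>R a' + christoffel G (y t) (h *\<^sub>R velocity y t) z = h *\<^sub>R (a' + christoffel G (y t) (velocity y t) z)" for h a' z
    by (simp add: linear_scale[OF linear_christoffel(2)[OF y]] scaleR_right_distrib)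
  show ?thesis
    unfolding has_real_derivative_iff_has_vector_derivative has_vector_derivative_def
    using has_derivative_metric_along[OF curve_derivative[OF assms(1), unfolded has_vector_derivative_def]
        y d[OF assms(2)] d[OF assms(3)]]
    unfolding s cov_deriv_along_def
    by (simp add: metric_simps y algebra_simps)
qed

text \<open>Both sides are tested on a constant vector \<open>u\<close>: the function
  \<open>p s \<bullet> u\<close> is differentiated once directly and once as a scalar product with
  the dual vector.\<close>

lemma cov_deriv_sharp:
  assumes t: "t \<in> T" and p: "smooth_on T p"
  shows "cov (\<lambda>s. sharp (G (y s)) (p s)) t = sharp (G (y t)) (cov_covec p t)"
proof (rule nondegenerate[OF curve_in[OF t]])
  fix u
  note y = curve_in[OF t]
  have "((\<lambda>s. p s \<bullet> u) has_real_derivative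
      G (y t) (cov (\<lambda>s. sharp (G (y s)) (p s)) t) u + p t \<bullet> christoffel G (y t) (velocity y t) u) (at t)"
  proof (rule has_field_derivative_transform_within_open[OF _ open_times t])
    show "((\<lambda>s. G (y s) (sharp (G (y s)) (p s)) u) has_real_derivative
      G (y t) (cov (\<lambda>s. sharp (G (y s)) (p s)) t) u + p t \<bullet> christoffel G (y t) (velocity y t) u) (at t)"
      using metric_along[OF t smooth_sharp_along[OF p] smooth_on_const[of _ u]]
      by (simp add: cov_deriv_const sharp y)
  qed (simp add: sharp curve_in)
  moreover have "((\<lambda>s. p s \<bullet> u) has_real_derivative vector_derivative p (at t) \<bullet> u) (at t)"
    using has_derivative_inner_left[OF smooth_on_has_vector_derivative[OF p t, unfolded has_vector_derivative_def], of u]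
    by (simp add: has_real_derivative_iff_has_vector_derivative has_vector_derivative_def)
  ultimately have "G (y t) (cov (\<lambda>s. sharp (G (y s)) (p s)) t) u + p t \<bullet> christoffel G (y t) (velocity y t) u
      = vector_derivative p (at t) \<bullet> u"
    by (rule DERIV_unique)
  moreover have "linear (\<lambda>u. p t \<bullet> christoffel G (y t) (velocity y t) u)"
    by (rule linearI) (simp_all add: linear_add[OF linear_christoffel(1)[OF y]]
        linear_scale[OF linear_christoffel(1)[OF y]] inner_add_right)
  ultimately show "G (y t) (cov (\<lambda>s. sharp (G (y s)) (p s)) t) u = G (y t) (sharp (G (y t)) (cov_covec p t)) u"
    by (simp add: sharp y cov_deriv_covec_along_def inner_diff_left covec_inner)
qed

end

text \<open>The Gauss formula. The ambient expression \<open>?T\<close> is symmetric, and the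
  derivatives of the pulled-back metric are sums of two products with \<open>?T\<close>; in the
  Koszul combination four of the six products cancel and the other two agree. If the dimensions are
  equal this is the transformation law of the Christoffel symbols.\<close>

lemma pullback_christoffel:
  fixes W :: "'f::euclidean_space set" and V :: "'e::euclidean_space set"
  assumes W: "riemannian_domain W h" and V: "riemannian_domain V B"
    and \<psi>: "smooth_on W \<psi>" "\<psi> ` W \<subseteq> V"
    and h: "\<And>w a b. w \<in> W \<Longrightarrow> h w a b = B (\<psi> w) (frechet_derivative \<psi> (at w) a) (frechet_derivative \<psi> (at w) b)"
    and w: "w \<in> W"
  shows "h w (christoffel h w a b) c =
    B (\<psi> w) (frechet_derivative (\<lambda>z. frechet_derivative \<psi> (at z) b) (at w) a
      + christoffel B (\<psi> w) (frechet_derivative \<psi> (at w) a) (frechet_derivative \<psi> (at w) b))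
      (frechet_derivative \<psi> (at w) c)"
proof -
  interpret W: riemannian_domain W h by fact
  interpret V: riemannian_domain V B by fact
  let ?D = "frechet_derivative \<psi> (at w)"
  let ?T = "\<lambda>a b. frechet_derivative (\<lambda>z. frechet_derivative \<psi> (at z) b) (at w) a + christoffel B (\<psi> w) (?D a) (?D b)"
  have \<psi>w: "\<psi> w \<in> V" using \<psi>(2) w by blast
  have T: "?T a b = ?T b a" for a b
    using second_derivative_symmetric[OF \<psi>(1) W.open_dom w] V.christoffel_commute[OF \<psi>w] by simp
  have d: "frechet_derivative (\<lambda>y. h y b c) (at w) a = B (\<psi> w) (?T a b) (?D c) + B (\<psi> w) (?D b) (?T a c)" for a b c
  proof -
    have "((\<lambda>y. h y b c) has_derivative
      (\<lambda>a. B (\<psi> w) (?T a b) (?D c) + B (\<psi> w) (?D b) (?T a c))) (at w)"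
      by (rule has_derivative_transform_within_open[OF V.has_derivative_metric_along[OF
              smooth_on_has_derivative[OF \<psi>(1) w] \<psi>w
              smooth_on_has_derivative[OF smooth_on_frechet_derivative[OF \<psi>(1)] w]
              smooth_on_has_derivative[OF smooth_on_frechet_derivative[OF \<psi>(1)] w]] W.open_dom w])
         (simp add: h)
    then show ?thesis by (rule frechet_derivative_at[THEN fun_cong, symmetric])
  qed
  have "h w (christoffel h w a b) c = B (\<psi> w) (?T a b) (?D c)"
    unfolding christoffel_works[OF W.metric W.open_dom w] d T[of b a] T[of c a] T[of c b]
      V.commute[OF \<psi>w, of "?D b"] V.commute[OF \<psi>w, of "?D a"]
    by simp
  then show ?thesis .
qed

text \<open>The second derivative of \<psi> arises when the pushed-forward field is differentiated,
  and it is the one contained in \<open>pullback_christoffel\<close>. For an immersion only the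
  tangential part is determined, hence the test vector \<open>c\<close>.\<close>

lemma pullback_cov_deriv:
  fixes W :: "'f::euclidean_space set" and V :: "'e::euclidean_space set"
  assumes W: "curve_in_domain W h T y" and V: "riemannian_domain V B"
    and \<psi>: "smooth_on W \<psi>" "\<psi> ` W \<subseteq> V"
    and h: "\<And>w a b. w \<in> W \<Longrightarrow> h w a b = B (\<psi> w) (frechet_derivative \<psi> (at w) a) (frechet_derivative \<psi> (at w) b)"
    and Z: "smooth_on T Z" and t: "t \<in> T"
  shows "h (y t) (cov_deriv_along h y Z t) c =
    B (\<psi> (y t)) (cov_deriv_along B (\<lambda>s. \<psi> (y s)) (\<lambda>s. frechet_derivative \<psi> (at (y s)) (Z s)) t)
      (frechet_derivative \<psi> (at (y t)) c)"
proof -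
  interpret W: curve_in_domain W h T y by fact
  interpret V: riemannian_domain V B by fact
  let ?D = "frechet_derivative \<psi> (at (y t))"
  let ?D2 = "\<lambda>a b. frechet_derivative (\<lambda>z. frechet_derivative \<psi> (at z) b) (at (y t)) a"
  note yt = W.curve_in[OF t]
  have \<psi>y: "\<psi> (y t) \<in> V" using \<psi>(2) yt by blast
  have l: "linear (frechet_derivative \<psi> (at w))" if "w \<in> W" for w
    by (rule has_derivative_linear[OF smooth_on_has_derivative[OF \<psi>(1) that]])
  have vel: "velocity (\<lambda>s. \<psi> (y s)) t = ?D (velocity y t)"
    unfolding velocity_def[of "\<lambda>s. \<psi> (y s)"]
    by (rule vector_derivative_at[OF has_vector_derivative_compose_linear[OF W.curve_derivative[OF t]
            smooth_on_has_derivative[OF \<psi>(1) yt]]])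
  have "((\<lambda>s. frechet_derivative \<psi> (at (y s)) (Z s)) has_vector_derivative
      ?D2 (velocity y t) (Z t) + ?D (vector_derivative Z (at t))) (at t)"
  proof (rule has_vector_derivative_linear_apply[OF _ _ smooth_on_has_vector_derivative[OF Z t]])
    show "\<forall>\<^sub>F s in nhds t. linear (frechet_derivative \<psi> (at (y s)))"
      by (rule eventually_mono[OF W.eventually_curve_in[OF t] l])
    show "((\<lambda>s. frechet_derivative \<psi> (at (y s)) e) has_vector_derivative ?D2 (velocity y t) e) (at t)" for e
      by (rule has_vector_derivative_compose_linear[OF W.curve_derivative[OF t]
            smooth_on_has_derivative[OF smooth_on_frechet_derivative[OF \<psi>(1)] yt]])
  qed
  then have "vector_derivative (\<lambda>s. frechet_derivative \<psi> (at (y s)) (Z s)) (at t) =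
      ?D2 (velocity y t) (Z t) + ?D (vector_derivative Z (at t))"
    by (rule vector_derivative_at)
  then show ?thesis
    unfolding cov_deriv_along_def vel
    by (simp add: W.metric_simps V.metric_simps yt \<psi>y h[OF yt, of "vector_derivative Z (at t)"]
        pullback_christoffel[OF W.riemannian_domain_axioms V \<psi> h yt])
qed

section \<open>The vertical geodesic equation\<close>

context riemannian_domain
begin

lemma smooth_metric_compose:
  assumes "open S" and x: "smooth_on S x" "x ` S \<subseteq> V" and a: "smooth_on S a" and b: "smooth_on S b"
  shows "smooth_on S (\<lambda>z. G (x z) (a z) (b z))"
proof (rule smooth_on_linear_apply[OF assms(1) _ _ b])
  show "linear (G (x z) (a z))" if "z \<in> S" for z using x(2) that by (intro linear_right) auto
  show "smooth_on S (\<lambda>z. G (x z) (a z) e)" for e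
  proof (rule smooth_on_linear_apply[OF assms(1) _ _ a])
    show "linear (\<lambda>u. G (x z) u e)" if "z \<in> S" for z using x(2) that by (intro linear_left) auto
    show "smooth_on S (\<lambda>z. G (x z) u e)" for u
      by (rule smooth_on_compose[OF assms(1) x(1) smooth_metric x(2)])
  qed
qed

text \<open>Injectivity of the differential is what keeps the pulled-back form positive
  definite.\<close>

lemma metric_on_induced:
  fixes \<psi> :: "'f::euclidean_space \<Rightarrow> 'e"
  assumes W: "open W" and \<psi>: "smooth_on W \<psi>" "\<psi> ` W \<subseteq> V"
    and inj: "\<And>w. w \<in> W \<Longrightarrow> inj (frechet_derivative \<psi> (at w))"
  shows "metric_on W (induced_metric G \<psi>)"
proof -
  have l: "linear (frechet_derivative \<psi> (at w))" if "w \<in> W" for w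
    by (rule has_derivative_linear[OF smooth_on_has_derivative[OF \<psi>(1) that]])
  have V: "\<psi> w \<in> V" if "w \<in> W" for w using \<psi>(2) that by blast
  have "bilinear (induced_metric G \<psi> w)" if "w \<in> W" for w
    unfolding bilinear_def induced_metric_def
    by (intro conjI allI; rule linearI)
       (simp_all add: linear_add[OF l] linear_scale[OF l] metric_simps V that)
  moreover have "induced_metric G \<psi> w a b = induced_metric G \<psi> w b a" if "w \<in> W" for w a b
    unfolding induced_metric_def by (rule commute[OF V[OF that]])
  moreover have "induced_metric G \<psi> w a a > 0" if "w \<in> W" "a \<noteq> 0" for w a
    unfolding induced_metric_def
    using that inj[OF that(1)] linear_injective_0[OF l[OF that(1)]] by (intro pos V) auto
  moreover have "smooth_on W (\<lambda>w. induced_metric G \<psi> w a b)" for a b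
    unfolding induced_metric_def
    by (intro smooth_metric_compose W \<psi> smooth_on_frechet_derivative)
  ultimately show ?thesis unfolding metric_on_def by blast
qed

end

context kaehler_domain
begin

lemma covec_comp_inner: "x \<in> V \<Longrightarrow> covec_comp p (J x) \<bullet> u = p \<bullet> J x u"
proof -
  assume x: "x \<in> V"
  have "linear (\<lambda>u. p \<bullet> J x u)"
    by (rule linearI) (simp_all add: linear_add[OF linear_J[OF x]] linear_scale[OF linear_J[OF x]] inner_add_right)
  then show ?thesis by (simp add: covec_comp_def covec_inner)
qed

text \<open>\<open>J\<close> is skew for the metric. This minus sign turns the
  \<open>\<delta>\<^sup>2\<close> term of the endomorphism into a negative multiple of
  \<open>pairing\<close>.\<close>

lemma sharp_covec_comp: "x \<in> V \<Longrightarrow> sharp (G x) (covec_comp p (J x)) = - J x (sharp (G x) p)"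
  by (rule sharp_eqI) (simp_all add: metric_simps covec_comp_inner J_skew sharp)

lemma ver_part_eq: "ver_part G z \<xi> = snd \<xi> - covec (\<lambda>u. snd z \<bullet> christoffel G (fst z) u (fst \<xi>))"
  by (simp add: ver_part_def hor_lift_def)

lemma linear_ver_part:
  assumes x: "fst z \<in> V"
  shows "linear (ver_part G z)"
  by (rule linearI)
     (simp_all add: ver_part_eq covec_def linear_add[OF linear_christoffel(1)[OF x]]
       linear_scale[OF linear_christoffel(1)[OF x]] inner_add_right algebra_simps sum.distrib scaleR_sum_right)

lemma ver_part_vertical: "fst z \<in> V \<Longrightarrow> ver_part G z (0, \<eta>) = \<eta>"
  using ver_part_lifts(2)[OF metric open_dom, of z \<eta>] by (simp add: ver_lift_def)

text \<open>The sign from \<open>sharp_covec_comp\<close> occurs in both factors of the last term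
  and cancels.\<close>

lemma berger_sasaki_eq:
  assumes "fst z \<in> V"
  shows "berger_sasaki G J \<delta> z \<xi> \<eta> = G (fst z) (fst \<xi>) (fst \<eta>)
    + G (fst z) (sharp (G (fst z)) (ver_part G z \<xi>)) (sharp (G (fst z)) (ver_part G z \<eta>))
    + \<delta>\<^sup>2 * G (fst z) (sharp (G (fst z)) (ver_part G z \<xi>)) (J (fst z) (sharp (G (fst z)) (snd z)))
         * G (fst z) (sharp (G (fst z)) (ver_part G z \<eta>)) (J (fst z) (sharp (G (fst z)) (snd z)))"
  by (simp add: berger_sasaki_def Let_def cometric_def sharp_covec_comp assms metric_simps)

lemma smooth_fst_compose: "smooth_on V f \<Longrightarrow> smooth_on (V \<times> (UNIV::'b::real_normed_vector set)) (\<lambda>z. f (fst z))"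
  by (rule smooth_on_compose[OF open_Times[OF open_dom open_UNIV]
        smooth_on_bounded_linear[OF bounded_linear_fst open_Times[OF open_dom open_UNIV] smooth_on_id]]) auto

text \<open>For positivity, the \<open>\<delta>\<^sup>2\<close> term is a square, and a nonzero
  vector with zero base component has nonzero vertical part. The domain is the full cotangent
  bundle, which serves as the ambient space in the Gauss formula.\<close>

lemma berger_metric_on: "metric_on (V \<times> UNIV) (berger_sasaki G J \<delta>)"
proof -
  let ?U = "V \<times> (UNIV :: 'e set)"
  let ?S = "\<lambda>z \<xi>. sharp (G (fst z)) (ver_part G z \<xi>)"
  have U: "open ?U" by (intro open_Times open_dom open_UNIV)
  have fst_smooth: "smooth_on ?U fst" and snd_smooth: "smooth_on ?U snd"
    by (rule smooth_on_bounded_linear[OF bounded_linear_fst U smooth_on_id])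
       (rule smooth_on_bounded_linear[OF bounded_linear_snd U smooth_on_id])
  have sharp_smooth: "smooth_on ?U (\<lambda>z. sharp (G (fst z)) (p z))" if "smooth_on ?U p" for p
    by (rule smooth_on_linear_apply[OF U linear_sharp smooth_fst_compose[OF smooth_sharp_const] that]) auto
  have vp: "smooth_on ?U (\<lambda>z. ver_part G z \<xi>)" for \<xi>
    unfolding ver_part_eq
    by (intro smooth_on_diff U smooth_on_const smooth_on_covec smooth_on_inner snd_smooth
        smooth_fst_compose[OF smooth_christoffel])
  have Ju: "smooth_on ?U (\<lambda>z. J (fst z) (sharp (G (fst z)) (snd z)))"
    by (rule smooth_on_linear_apply[OF U linear_J smooth_fst_compose[OF smooth_J] sharp_smooth[OF snd_smooth]]) auto
  have smooth: "smooth_on ?U (\<lambda>z. berger_sasaki G J \<delta> z \<xi> \<eta>)" for \<xi> \<eta>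
  proof (rule smooth_on_cong[OF U berger_sasaki_eq[symmetric]])
    show "smooth_on ?U (\<lambda>z. G (fst z) (fst \<xi>) (fst \<eta>) + G (fst z) (?S z \<xi>) (?S z \<eta>)
      + \<delta>\<^sup>2 * G (fst z) (?S z \<xi>) (J (fst z) (sharp (G (fst z)) (snd z)))
         * G (fst z) (?S z \<eta>) (J (fst z) (sharp (G (fst z)) (snd z))))"
      by (intro smooth_on_add U smooth_on_mult smooth_on_const smooth_metric_compose fst_smooth sharp_smooth vp Ju) auto
  qed auto
  have l: "linear (?S z)" if "fst z \<in> V" for z
    using linear_compose[OF linear_ver_part linear_sharp, OF that that] by (simp add: o_def)
  have "bilinear (berger_sasaki G J \<delta> z)" if "z \<in> ?U" for z
  proof -
    have z: "fst z \<in> V" using that by auto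
    show ?thesis
      unfolding bilinear_def
      by (intro conjI allI; rule linearI)
         (simp_all add: berger_sasaki_eq z linear_add[OF l] linear_scale[OF l] metric_simps algebra_simps)
  qed
  moreover have "berger_sasaki G J \<delta> z \<xi> \<eta> = berger_sasaki G J \<delta> z \<eta> \<xi>" if "z \<in> ?U" for z \<xi> \<eta>
    using that by (auto simp: berger_sasaki_eq commute)
  moreover have "berger_sasaki G J \<delta> z \<xi> \<xi> > 0" if "z \<in> ?U" "\<xi> \<noteq> 0" for z \<xi>
  proof -
    have z: "fst z \<in> V" using that by auto
    have nn: "G (fst z) a a \<ge> 0" for a
      using pos[OF z, of a] by (cases "a = 0") (simp_all add: metric_simps z)
    have "G (fst z) (fst \<xi>) (fst \<xi>) + G (fst z) (?S z \<xi>) (?S z \<xi>) > 0"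
    proof (cases "fst \<xi> = 0")
      case True
      then have "ver_part G z \<xi> = snd \<xi>" using ver_part_vertical[OF z, of "snd \<xi>"] by (metis prod.collapse)
      moreover have "snd \<xi> \<noteq> 0" using True that(2) by (simp add: prod_eq_iff)
      ultimately have "?S z \<xi> \<noteq> 0"
        using covec_sharp[OF z, of "snd \<xi>"] linear_0[OF linear_flat[OF z]] by auto
      then show ?thesis using pos[OF z] nn by (simp add: add_nonneg_pos)
    next
      case False
      then show ?thesis using pos[OF z] nn by (simp add: add_pos_nonneg)
    qed
    then show ?thesis
      by (simp add: berger_sasaki_eq z mult.assoc add_pos_nonneg)
  qed
  ultimately show ?thesis using smooth unfolding metric_on_def by blast
qed

text \<open>With the components of \<xi> fixed, the vertical part is affine in \<open>p\<close>, so
  the metric along \<open>p + r *\<^sub>R \<eta>\<close> is a polynomial in \<open>r\<close> and its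
  linear coefficient is read off. The last summand stems from the dependence of p J on
  \<open>p\<close>.\<close>

lemma berger_vertical_derivative:
  assumes x: "x \<in> V"
  defines "S \<equiv> sharp (G x)"
  shows "frechet_derivative (\<lambda>z. berger_sasaki G J \<delta> z \<xi> \<xi>) (at (x, p)) (0, \<eta>) / 2 =
    (let w = S (ver_part G (x, p) \<xi>); w' = - S (covec (\<lambda>u. \<eta> \<bullet> christoffel G x u (fst \<xi>)))
     in G x w w' + \<delta>\<^sup>2 * G x w (J x (S p)) * (G x w' (J x (S p)) + G x w (J x (S \<eta>))))"
proof -
  let ?U = "V \<times> (UNIV :: 'e set)"
  have U: "open ?U" by (intro open_Times open_dom open_UNIV)
  define w where "w = S (ver_part G (x, p) \<xi>)"
  define w' where "w' = - S (covec (\<lambda>u. \<eta> \<bullet> christoffel G x u (fst \<xi>)))"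
  have lin: "linear S" unfolding S_def by (rule linear_sharp[OF x])
  have w: "S (ver_part G (x, p + r *\<^sub>R \<eta>) \<xi>) = w + r *\<^sub>R w'" for r
  proof -
    have "ver_part G (x, p + r *\<^sub>R \<eta>) \<xi> = ver_part G (x, p) \<xi> - r *\<^sub>R covec (\<lambda>u. \<eta> \<bullet> christoffel G x u (fst \<xi>))"
      by (simp add: ver_part_eq covec_def inner_add_left scaleR_left_distrib sum.distrib scaleR_sum_right)
    then show ?thesis by (simp add: w_def w'_def linear_diff[OF lin] linear_scale[OF lin])
  qed
  have "((\<lambda>r. berger_sasaki G J \<delta> (x, p + r *\<^sub>R \<eta>) \<xi> \<xi>) has_vector_derivative
      frechet_derivative (\<lambda>z. berger_sasaki G J \<delta> z \<xi> \<xi>) (at (x, p)) (0, \<eta>)) (at 0)"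
  proof -
    have "((\<lambda>r. p + r *\<^sub>R \<eta>) has_vector_derivative \<eta>) (at 0)"
      by (auto intro!: derivative_eq_intros)
    then have 1: "((\<lambda>r. (x, p + r *\<^sub>R \<eta>)) has_vector_derivative (0, \<eta>)) (at 0)"
      by (intro has_vector_derivative_Pair has_vector_derivative_const)
    have 2: "((\<lambda>z. berger_sasaki G J \<delta> z \<xi> \<xi>) has_derivative
        frechet_derivative (\<lambda>z. berger_sasaki G J \<delta> z \<xi> \<xi>) (at (x, p))) (at (x, p + 0 *\<^sub>R \<eta>))"
      using metric_on_deriv[OF berger_metric_on U, of "(x, p)"] x by simp
    from has_vector_derivative_compose_linear[OF 1 2] show ?thesis .
  qed
  moreover have "((\<lambda>r. berger_sasaki G J \<delta> (x, p + r *\<^sub>R \<eta>) \<xi> \<xi>) has_real_derivative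
      2 * (G x w w' + \<delta>\<^sup>2 * G x w (J x (S p)) * (G x w' (J x (S p)) + G x w (J x (S \<eta>))))) (at 0)"
  proof -
    have "berger_sasaki G J \<delta> (x, p + r *\<^sub>R \<eta>) \<xi> \<xi> = G x (fst \<xi>) (fst \<xi>) + (G x w w + 2 * r * G x w w' + r\<^sup>2 * G x w' w')
      + \<delta>\<^sup>2 * (G x w (J x (S p)) + r * (G x w' (J x (S p)) + G x w (J x (S \<eta>))) + r\<^sup>2 * G x w' (J x (S \<eta>)))\<^sup>2" for r
      using x by (simp add: berger_sasaki_eq w[unfolded S_def] S_def metric_simps
          linear_add[OF linear_sharp[OF x]] linear_scale[OF linear_sharp[OF x]]
          linear_add[OF linear_J[OF x]] linear_scale[OF linear_J[OF x]] commute[OF x, of w' w] algebra_simps power2_eq_square)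
    then show ?thesis
      by (auto intro!: derivative_eq_intros simp: algebra_simps)
  qed
  ultimately have "frechet_derivative (\<lambda>z. berger_sasaki G J \<delta> z \<xi> \<xi>) (at (x, p)) (0, \<eta>) =
      2 * (G x w w' + \<delta>\<^sup>2 * G x w (J x (S p)) * (G x w' (J x (S p)) + G x w (J x (S \<eta>))))"
    by (metis has_real_derivative_iff_has_vector_derivative DERIV_unique)
  then show ?thesis by (simp add: Let_def w_def w'_def)
qed

end

section \<open>Covector fields along a curve and the vertical acceleration\<close>

locale covector_curve = kaehler_domain V G J + curve_in_domain V G T y
  for V :: "'e::euclidean_space set" and G J T y +
  fixes p :: "real \<Rightarrow> 'e" and \<delta> :: real
  assumes smooth_covector: "smooth_on T p"
begin

text \<open>\<open>dual_vec\<close> is the vector \<open>u\<close>; \<open>pairing\<close> is \<open>l = - g\<^sup>-\<^sup>1(\<theta>', \<theta> J)\<close>; \<open>geodesic_defect\<close> is the left-hand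
  side of the vertical Euler-Lagrange equation of the energy of the deformed Sasaki metric.\<close>

definition dual_vec :: "real \<Rightarrow> 'e" where "dual_vec t = sharp (G (y t)) (p t)"
definition dual_vec_deriv :: "real \<Rightarrow> 'e" where "dual_vec_deriv t = sharp (G (y t)) (cov_covec p t)"
definition pairing :: "real \<Rightarrow> real" where "pairing t = G (y t) (dual_vec_deriv t) (J (y t) (dual_vec t))"
definition geodesic_defect :: "real \<Rightarrow> 'e" where
  "geodesic_defect t = cov dual_vec_deriv t + (\<delta>\<^sup>2 * deriv pairing t) *\<^sub>R J (y t) (dual_vec t)
     + (2 * \<delta>\<^sup>2 * pairing t) *\<^sub>R J (y t) (dual_vec_deriv t)"

lemma smooth_dual_vec: "smooth_on T dual_vec"
  unfolding dual_vec_def[abs_def] by (rule smooth_sharp_along[OF smooth_covector])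

lemma smooth_dual_vec_deriv: "smooth_on T dual_vec_deriv"
  unfolding dual_vec_deriv_def[abs_def] by (rule smooth_sharp_along[OF smooth_cov_deriv_covec[OF smooth_covector]])

lemma cov_dual_vec: "t \<in> T \<Longrightarrow> cov dual_vec t = dual_vec_deriv t"
  unfolding dual_vec_def[abs_def] dual_vec_deriv_def by (rule cov_deriv_sharp[OF _ smooth_covector])

lemma smooth_J_along: "smooth_on T a \<Longrightarrow> smooth_on T (\<lambda>s. J (y s) (a s))"
  by (rule smooth_on_linear_apply[OF open_times linear_J[OF curve_in] smooth_along[OF smooth_J]])

lemma cov_J:
  assumes t: "t \<in> T" and a: "smooth_on T a"
  shows "cov (\<lambda>s. J (y s) (a s)) t = J (y t) (cov a t)"
proof -
  have "((\<lambda>s. J (y s) (a s)) has_vector_derivative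
      (J (y t) (christoffel G (y t) (velocity y t) (a t)) - christoffel G (y t) (velocity y t) (J (y t) (a t)))
      + J (y t) (vector_derivative a (at t))) (at t)"
  proof (rule has_vector_derivative_linear_apply[OF _ _ smooth_on_has_vector_derivative[OF a t]])
    show "\<forall>\<^sub>F s in nhds t. linear (J (y s))"
      by (rule eventually_mono[OF eventually_curve_in[OF t] linear_J])
    show "((\<lambda>s. J (y s) e) has_vector_derivative
      (J (y t) (christoffel G (y t) (velocity y t) e) - christoffel G (y t) (velocity y t) (J (y t) e))) (at t)" for e
      using has_vector_derivative_compose_linear[OF curve_derivative[OF t]
          smooth_on_has_derivative[OF smooth_J curve_in[OF t], of e]]
      by (simp add: J_parallel curve_in[OF t])
  qed
  then show ?thesis
    by (simp add: cov_deriv_along_def vector_derivative_at linear_add[OF linear_J[OF curve_in[OF t]]])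
qed

lemma smooth_metric_along: "smooth_on T a \<Longrightarrow> smooth_on T b \<Longrightarrow> smooth_on T (\<lambda>s. G (y s) (a s) (b s))"
  by (rule smooth_metric_compose[OF open_times smooth_curve]) (use curve_in in auto)

lemma smooth_pairing: "smooth_on T pairing"
  unfolding pairing_def[abs_def] by (intro smooth_metric_along smooth_dual_vec_deriv smooth_J_along smooth_dual_vec)

lemma pairing_derivative: "t \<in> T \<Longrightarrow> (pairing has_real_derivative deriv pairing t) (at t)"
  using smooth_on_has_vector_derivative[OF smooth_pairing] has_real_derivative_iff_has_vector_derivative
    DERIV_imp_deriv by metis

text \<open>Testing the Levi-Civita acceleration with a vertical vector uses only the metric property:
  the Christoffel term of the constant field \<open>(0, \<eta>)\<close> is half a derivative of the metric.\<close>

lemma berger_acceleration_vertical: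
  assumes t: "t \<in> T"
  defines "C \<equiv> \<lambda>s. (y s, p s)" and "B \<equiv> berger_sasaki G J \<delta>"
  shows "B (C t) (cov_deriv_along B C (velocity C) t) (0, \<eta>) = G (y t) (sharp (G (y t)) \<eta>) (geodesic_defect t)"
proof -
  let ?U = "V \<times> (UNIV :: 'e set)"
  have U: "open ?U" by (intro open_Times open_dom open_UNIV)
  interpret B: riemannian_domain ?U B
    unfolding B_def by unfold_locales (rule berger_metric_on, rule U)
  have "smooth_on T (\<lambda>s. (y s, 0) + (0, p s))"
    by (rule smooth_on_add[OF open_times smooth_on_bounded_linear[OF _ open_times smooth_curve]
          smooth_on_bounded_linear[OF _ open_times smooth_covector]])
       (auto intro!: bounded_linear_intros bounded_linear_Pair)
  then have smC: "smooth_on T C" by (simp add: C_def)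
  interpret C: curve_in_domain ?U B T C
    by unfold_locales (use open_times smC curve_in in \<open>auto simp: C_def\<close>)
  have velC: "velocity C s = (velocity y s, vector_derivative p (at s))" if "s \<in> T" for s
    unfolding velocity_def C_def
    by (rule vector_derivative_at)
       (intro has_vector_derivative_Pair smooth_on_has_vector_derivative[OF _ that] smooth_curve smooth_covector)
  \<comment> \<open>The vertical part of the velocity is the covariant derivative of the covector.
    The lift has the arguments of the Christoffel symbol in the other order, so its symmetry
    enters.\<close>
  have vp: "ver_part G (C s) (velocity C s) = cov_covec p s" if "s \<in> T" for s
    by (simp add: ver_part_eq velC[OF that] cov_deriv_covec_along_def)
       (simp add: C_def christoffel_commute[OF curve_in[OF that], of _ "velocity y s"])
  define e where "e s = sharp (G (y s)) \<eta>" for s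
  have sme: "smooth_on T e" unfolding e_def[abs_def] by (rule smooth_sharp_along) auto
  \<comment> \<open>This is the vector \<open>w'\<close> of
    \<open>berger_vertical_derivative\<close>, so all terms with \<open>cov e t\<close> cancel when
    that derivative is subtracted below.\<close>
  have cove: "cov e t = - sharp (G (y t)) (covec (\<lambda>u. \<eta> \<bullet> christoffel G (y t) u (velocity y t)))"
    unfolding e_def[abs_def] cov_deriv_sharp[OF t smooth_on_const]
    by (simp add: cov_deriv_covec_along_def linear_neg[OF linear_sharp[OF curve_in[OF t]]]
        christoffel_commute[OF curve_in[OF t], of _ "velocity y t"])
  have fstC: "fst (C s) = y s" for s by (simp add: C_def)
  have Beq: "B (C s) (velocity C s) (0, \<eta>) = G (y s) (dual_vec_deriv s) (e s) + \<delta>\<^sup>2 * pairing s * G (y s) (e s) (J (y s) (dual_vec s))"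
    if "s \<in> T" for s
    using ver_part_vertical[of "C s" \<eta>] curve_in[OF that, folded fstC]
    by (simp add: B_def berger_sasaki_eq vp[OF that])
       (simp add: C_def dual_vec_deriv_def dual_vec_def e_def pairing_def metric_simps(9)[OF curve_in[OF that]])
  let ?y = "y t"
  note yt = curve_in[OF t]
  have "((\<lambda>s. B (C s) (velocity C s) (0, \<eta>)) has_real_derivative
      (G ?y (cov dual_vec_deriv t) (e t) + G ?y (dual_vec_deriv t) (cov e t)) + \<delta>\<^sup>2 * deriv pairing t * G ?y (e t) (J ?y (dual_vec t))
      + \<delta>\<^sup>2 * pairing t * (G ?y (cov e t) (J ?y (dual_vec t)) + G ?y (e t) (J ?y (dual_vec_deriv t)))) (at t)"
  proof (rule has_field_derivative_transform_within_open[OF _ open_times t Beq[symmetric]])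
    show "((\<lambda>s. G (y s) (dual_vec_deriv s) (e s) + \<delta>\<^sup>2 * pairing s * G (y s) (e s) (J (y s) (dual_vec s))) has_real_derivative
      (G ?y (cov dual_vec_deriv t) (e t) + G ?y (dual_vec_deriv t) (cov e t)) + \<delta>\<^sup>2 * deriv pairing t * G ?y (e t) (J ?y (dual_vec t))
      + \<delta>\<^sup>2 * pairing t * (G ?y (cov e t) (J ?y (dual_vec t)) + G ?y (e t) (J ?y (dual_vec_deriv t)))) (at t)"
      using metric_along[OF t sme smooth_J_along[OF smooth_dual_vec]]
      by (auto intro!: derivative_eq_intros metric_along[OF t smooth_dual_vec_deriv sme] pairing_derivative[OF t]
          simp: cov_J[OF t smooth_dual_vec] cov_dual_vec[OF t] algebra_simps)
  qed
  moreover have "((\<lambda>s. B (C s) (velocity C s) (0, \<eta>)) has_real_derivative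
      B (C t) (cov_deriv_along B C (velocity C) t) (0, \<eta>)
      + B (C t) (velocity C t) (christoffel B (C t) (velocity C t) (0, \<eta>))) (at t)"
    using C.metric_along[OF t C.smooth_velocity smooth_on_const[of _ "(0, \<eta>)"]] by (simp add: C.cov_deriv_const)
  moreover have "B (C t) (velocity C t) (christoffel B (C t) (velocity C t) (0, \<eta>)) =
      frechet_derivative (\<lambda>z. B z (velocity C t) (velocity C t)) (at (C t)) (0, \<eta>) / 2"
    using christoffel_metric[OF B.metric B.open_dom C.curve_in[OF t], of "velocity C t" "velocity C t" "(0, \<eta>)"]
      B.christoffel_commute[OF C.curve_in[OF t], of "velocity C t" "(0, \<eta>)"]
      B.commute[OF C.curve_in[OF t], of "velocity C t"] by simp
  moreover have "frechet_derivative (\<lambda>z. B z (velocity C t) (velocity C t)) (at (C t)) (0, \<eta>) / 2 =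
      G ?y (dual_vec_deriv t) (cov e t) + \<delta>\<^sup>2 * pairing t * (G ?y (cov e t) (J ?y (dual_vec t)) + G ?y (dual_vec_deriv t) (J ?y (e t)))"
    unfolding B_def C_def berger_vertical_derivative[OF yt]
    unfolding vp[OF t, unfolded C_def]
    by (simp add: Let_def velC[OF t, unfolded C_def] cove dual_vec_deriv_def pairing_def dual_vec_def e_def)
  ultimately have "B (C t) (cov_deriv_along B C (velocity C) t) (0, \<eta>) =
     G ?y (cov dual_vec_deriv t) (e t) + \<delta>\<^sup>2 * deriv pairing t * G ?y (e t) (J ?y (dual_vec t))
      + \<delta>\<^sup>2 * pairing t * (G ?y (e t) (J ?y (dual_vec_deriv t)) - G ?y (dual_vec_deriv t) (J ?y (e t)))"
    using DERIV_unique by (fastforce simp: algebra_simps)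
  \<comment> \<open>Skewness of \<open>J\<close> turns the remaining difference into a sum of two
    equal terms; this is the factor 2 in \<open>geodesic_defect\<close>.\<close>
  also have "G ?y (dual_vec_deriv t) (J ?y (e t)) = - G ?y (e t) (J ?y (dual_vec_deriv t))"
    using J_skew[OF yt, of "dual_vec_deriv t" "e t"] commute[OF yt, of "e t"] by simp
  finally show ?thesis
    by (simp add: geodesic_defect_def metric_simps yt e_def commute[OF yt, of "cov dual_vec_deriv t"] algebra_simps)
qed

end

section \<open>Parallelism and change of charts\<close>

lemma vector_derivative_cong_open:
  assumes "open T" and "t \<in> T" and "\<And>s. s \<in> T \<Longrightarrow> f s = g s"
  shows "vector_derivative f (at t) = vector_derivative g (at t)"
proof -
  have "(f has_vector_derivative D) (at t) \<longleftrightarrow> (g has_vector_derivative D) (at t)" for D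
    using has_vector_derivative_transform_within_open[OF _ assms(1,2)] assms(3) by metis
  then show ?thesis unfolding vector_derivative_def by simp
qed

lemma cov_deriv_along_cong:
  assumes "open T" and "t \<in> T" and "\<And>s. s \<in> T \<Longrightarrow> y s = y' s" and "\<And>s. s \<in> T \<Longrightarrow> a s = b s"
  shows "cov_deriv_along G y a t = cov_deriv_along G y' b t"
  using vector_derivative_cong_open[OF assms(1,2), of y y'] vector_derivative_cong_open[OF assms(1,2), of a b] assms
  by (simp add: cov_deriv_along_def velocity_def)

context curve_in_domain
begin

lemma cov_add:
  assumes "t \<in> T" and "smooth_on T a" and "smooth_on T b"
  shows "cov (\<lambda>s. a s + b s) t = cov a t + cov b t"
  using vector_derivative_at[OF has_vector_derivative_add[OF smooth_on_has_vector_derivative[OF assms(2,1)]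
      smooth_on_has_vector_derivative[OF assms(3,1)]]]
  by (simp add: cov_deriv_along_def linear_add[OF linear_christoffel(1)[OF curve_in[OF assms(1)]]])

lemma cov_scale:
  assumes "t \<in> T" and f: "(f has_real_derivative f') (at t)" and a: "smooth_on T a"
  shows "cov (\<lambda>s. f s *\<^sub>R a s) t = f' *\<^sub>R a t + f t *\<^sub>R cov a t"
  using vector_derivative_at[OF has_vector_derivative_scaleR[OF f smooth_on_has_vector_derivative[OF a assms(1)]]]
  by (simp add: cov_deriv_along_def linear_scale[OF linear_christoffel(1)[OF curve_in[OF assms(1)]]] scaleR_right_distrib)

lemma smooth_curvature_along:
  assumes "smooth_on T a" and "smooth_on T b" and "smooth_on T c"
  shows "smooth_on T (\<lambda>s. curvature G (y s) (a s) (b s) (c s))"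
proof (rule smooth_on_linear_apply[OF open_times linear_curvature(1)[OF curve_in] _ assms(3)])
  show "smooth_on T (\<lambda>s. curvature G (y s) (a s) (b s) e)" for e
  proof (rule smooth_on_linear_apply[OF open_times linear_curvature(2)[OF curve_in] _ assms(2)])
    show "smooth_on T (\<lambda>s. curvature G (y s) (a s) e' e)" for e'
      by (rule smooth_on_linear_apply[OF open_times linear_curvature(3)[OF curve_in] _ assms(1)])
         (assumption, rule smooth_along[OF smooth_curvature])
  qed
qed

text \<open>The hypothesis is \<nabla>R = 0 on constant fields, solved for the partial derivative.
  The three arguments are made time-dependent one after the other, and the Christoffel terms
  complete each derivative to a covariant one.\<close>

lemma cov_curvature:
  assumes parallel: "\<And>x a b c d. x \<in> V \<Longrightarrow> frechet_derivative (\<lambda>y. curvature G y b c d) (at x) a =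
      curvature G x (christoffel G x a b) c d + curvature G x b (christoffel G x a c) d
      + curvature G x b c (christoffel G x a d) - christoffel G x a (curvature G x b c d)"
    and t: "t \<in> T" and a: "smooth_on T a" and b: "smooth_on T b" and c: "smooth_on T c"
  shows "cov (\<lambda>s. curvature G (y s) (a s) (b s) (c s)) t =
    curvature G (y t) (cov a t) (b t) (c t) + curvature G (y t) (a t) (cov b t) (c t)
    + curvature G (y t) (a t) (b t) (cov c t)"
proof -
  let ?R = "\<lambda>s. curvature G (y s)" and ?\<Gamma> = "christoffel G (y t) (velocity y t)"
  let ?D = "\<lambda>f. vector_derivative f (at t)"
  note yt = curve_in[OF t]
  have ev: "\<forall>\<^sub>F s in nhds t. P (y s)" if "\<And>x. x \<in> V \<Longrightarrow> P x" for P
    by (rule eventually_mono[OF eventually_curve_in[OF t] that])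
  note d = smooth_on_has_vector_derivative[OF _ t]
  have 0: "((\<lambda>s. ?R s e1 e2 e3) has_vector_derivative
      ?R t (?\<Gamma> e1) e2 e3 + ?R t e1 (?\<Gamma> e2) e3 + ?R t e1 e2 (?\<Gamma> e3) - ?\<Gamma> (?R t e1 e2 e3)) (at t)" for e1 e2 e3
    using has_vector_derivative_compose_linear[OF curve_derivative[OF t]
        smooth_on_has_derivative[OF smooth_curvature yt, of e1 e2 e3]]
    by (simp add: parallel[OF yt])
  have 1: "((\<lambda>s. ?R s (a s) e2 e3) has_vector_derivative
      (?R t (?\<Gamma> (a t)) e2 e3 + ?R t (a t) (?\<Gamma> e2) e3 + ?R t (a t) e2 (?\<Gamma> e3) - ?\<Gamma> (?R t (a t) e2 e3))
      + ?R t (?D a) e2 e3) (at t)" for e2 e3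
    by (rule has_vector_derivative_linear_apply[OF ev 0 d[OF a]]) (rule linear_curvature(3))
  have 2: "((\<lambda>s. ?R s (a s) (b s) e3) has_vector_derivative
      ((?R t (?\<Gamma> (a t)) (b t) e3 + ?R t (a t) (?\<Gamma> (b t)) e3 + ?R t (a t) (b t) (?\<Gamma> e3) - ?\<Gamma> (?R t (a t) (b t) e3))
      + ?R t (?D a) (b t) e3) + ?R t (a t) (?D b) e3) (at t)" for e3
    using eventually_curve_in[OF t]
    by (intro has_vector_derivative_linear_apply[OF _ 1 d[OF b]]) (auto elim: eventually_mono intro: linear_curvature(2))
  have 3: "((\<lambda>s. ?R s (a s) (b s) (c s)) has_vector_derivative
      (((?R t (?\<Gamma> (a t)) (b t) (c t) + ?R t (a t) (?\<Gamma> (b t)) (c t) + ?R t (a t) (b t) (?\<Gamma> (c t)) - ?\<Gamma> (?R t (a t) (b t) (c t)))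
      + ?R t (?D a) (b t) (c t)) + ?R t (a t) (?D b) (c t)) + ?R t (a t) (b t) (?D c)) (at t)"
    using eventually_curve_in[OF t]
    by (intro has_vector_derivative_linear_apply[OF _ 2 d[OF c]]) (auto elim: eventually_mono intro: linear_curvature(1))
  note R = linear_curvature[OF yt]
  show ?thesis
    by (simp add: cov_deriv_along_def vector_derivative_at[OF 3] linear_add[OF R(1)] linear_add[OF R(2)] linear_add[OF R(3)])
qed

end

context covector_curve
begin

lemma berger_curvature_eq:
  assumes "t \<in> T"
  shows "berger_curvature G J \<delta> (y t) (cov_covec p t) (p t) w =
    curvature G (y t) (dual_vec_deriv t) (dual_vec t) w + (- (\<delta>\<^sup>2) * pairing t) *\<^sub>R curvature G (y t) (dual_vec t) (J (y t) (dual_vec t)) w"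
  using curve_in[OF assms]
  by (simp add: berger_curvature_def cometric_def sharp_covec_comp metric_simps pairing_def dual_vec_deriv_def dual_vec_def)

lemma berger_curvature_parallel:
  assumes parallel: "\<And>x a b c d. x \<in> V \<Longrightarrow> frechet_derivative (\<lambda>y. curvature G y b c d) (at x) a =
      curvature G x (christoffel G x a b) c d + curvature G x b (christoffel G x a c) d
      + curvature G x b c (christoffel G x a d) - christoffel G x a (curvature G x b c d)"
    and t: "t \<in> T" and geodesic: "geodesic_defect t = \<kappa> *\<^sub>R dual_vec t" and Z: "smooth_on T Z"
  defines "E \<equiv> \<lambda>s. berger_curvature G J \<delta> (y s) (cov_covec p s) (p s)"
  shows "(\<lambda>s. E s (Z s)) differentiable (at t)" and "cov (\<lambda>s. E s (Z s)) t = E t (cov Z t)"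
proof -
  let ?R = "curvature G (y t)" and ?J = "J (y t)"
  let ?f = "\<lambda>s. curvature G (y s) (dual_vec_deriv s) (dual_vec s) (Z s)"
  let ?g = "\<lambda>s. curvature G (y s) (dual_vec s) (J (y s) (dual_vec s)) (Z s)"
  note yt = curve_in[OF t]
  note smJ = smooth_J_along[OF smooth_dual_vec]
  have f: "smooth_on T ?f" by (rule smooth_curvature_along[OF smooth_dual_vec_deriv smooth_dual_vec Z])
  have g: "smooth_on T ?g" by (rule smooth_curvature_along[OF smooth_dual_vec smJ Z])
  have c: "((\<lambda>s. - (\<delta>\<^sup>2) * pairing s) has_real_derivative - (\<delta>\<^sup>2) * deriv pairing t) (at t)"
    by (rule DERIV_cmult[OF pairing_derivative[OF t]])
  have sc: "smooth_on T (\<lambda>s. (- (\<delta>\<^sup>2) * pairing s) *\<^sub>R ?g s)"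
    by (intro smooth_on_scaleR smooth_on_mult smooth_on_const open_times smooth_pairing g)
  have sm: "smooth_on T (\<lambda>s. ?f s + (- (\<delta>\<^sup>2) * pairing s) *\<^sub>R ?g s)"
    by (rule smooth_on_add[OF open_times f sc])
  have E: "?f s + (- (\<delta>\<^sup>2) * pairing s) *\<^sub>R ?g s = E s (Z s)" if "s \<in> T" for s
    unfolding E_def by (rule berger_curvature_eq[OF that, symmetric])
  from smooth_on_cong[OF open_times E sm] have "smooth_on T (\<lambda>s. E s (Z s))" .
  from smooth_on_has_derivative[OF this t] show "(\<lambda>s. E s (Z s)) differentiable (at t)"
    by (auto simp: differentiable_def)
  note R = linear_curvature[OF yt]
  \<comment> \<open>Invariance under \<open>J\<close> is applied to the pair u, J u': the square of
    \<open>J\<close> gives a sign, which skew-symmetry of the curvature removes.\<close>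
  have RJ: "?R (dual_vec t) (?J (dual_vec_deriv t)) w = ?R (dual_vec_deriv t) (?J (dual_vec t)) w" for w
    using curvature_J_J[OF yt, of "dual_vec t" "?J (dual_vec_deriv t)" w] curvature_skew[OF yt, of "?J (dual_vec t)" "dual_vec_deriv t" w]
      curvature_J_J[OF yt, of "dual_vec_deriv t" "?J (dual_vec t)" w]
    by (simp add: J_J[OF yt] linear_neg[OF R(2)])
  have dd: "cov dual_vec_deriv t = \<kappa> *\<^sub>R dual_vec t - (\<delta>\<^sup>2 * deriv pairing t) *\<^sub>R ?J (dual_vec t) - (2 * \<delta>\<^sup>2 * pairing t) *\<^sub>R ?J (dual_vec_deriv t)"
    using geodesic by (simp add: geodesic_defect_def algebra_simps)
  \<comment> \<open>The term with \<kappa> disappears here because R(u, u) = 0.\<close>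
  have Rd: "?R (cov dual_vec_deriv t) (dual_vec t) w = (\<delta>\<^sup>2 * deriv pairing t) *\<^sub>R ?R (dual_vec t) (?J (dual_vec t)) w
      + (2 * \<delta>\<^sup>2 * pairing t) *\<^sub>R ?R (dual_vec_deriv t) (?J (dual_vec t)) w" for w
    using curvature_skew[OF yt, of "?J (dual_vec t)" "dual_vec t" w] curvature_skew[OF yt, of "?J (dual_vec_deriv t)" "dual_vec t" w] RJ[of w]
    by (simp add: dd linear_diff[OF R(3)] linear_scale[OF R(3)] curvature_self[OF yt])
  have "cov (\<lambda>s. E s (Z s)) t = cov (\<lambda>s. ?f s + (- (\<delta>\<^sup>2) * pairing s) *\<^sub>R ?g s) t"
    by (rule cov_deriv_along_cong[OF open_times t refl E[symmetric]])
  also have "\<dots> = cov ?f t + (- (\<delta>\<^sup>2) * deriv pairing t) *\<^sub>R ?g t + (- (\<delta>\<^sup>2) * pairing t) *\<^sub>R cov ?g t"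
    unfolding cov_add[OF t f sc] cov_scale[OF t c g] by simp
  also have "cov ?f t = ?R (cov dual_vec_deriv t) (dual_vec t) (Z t) + ?R (dual_vec_deriv t) (cov dual_vec t) (Z t) + ?R (dual_vec_deriv t) (dual_vec t) (cov Z t)"
    by (rule cov_curvature[OF _ t smooth_dual_vec_deriv smooth_dual_vec Z]) (rule parallel)
  also have "cov ?g t = ?R (cov dual_vec t) (?J (dual_vec t)) (Z t) + ?R (dual_vec t) (cov (\<lambda>s. J (y s) (dual_vec s)) t) (Z t)
      + ?R (dual_vec t) (?J (dual_vec t)) (cov Z t)"
    by (rule cov_curvature[OF _ t smooth_dual_vec smJ Z]) (rule parallel)
  \<comment> \<open>By \<open>RJ\<close> the two terms from differentiating R(u, J u) agree, and
    together they match the coefficient \<open>2 * \<delta>\<^sup>2\<close> in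
    \<open>Rd\<close>.\<close>
  also have "?R (cov dual_vec_deriv t) (dual_vec t) (Z t) + ?R (dual_vec_deriv t) (cov dual_vec t) (Z t) + ?R (dual_vec_deriv t) (dual_vec t) (cov Z t)
      + (- (\<delta>\<^sup>2) * deriv pairing t) *\<^sub>R ?g t + (- (\<delta>\<^sup>2) * pairing t) *\<^sub>R
        (?R (cov dual_vec t) (?J (dual_vec t)) (Z t) + ?R (dual_vec t) (cov (\<lambda>s. J (y s) (dual_vec s)) t) (Z t)
          + ?R (dual_vec t) (?J (dual_vec t)) (cov Z t))
      = ?R (dual_vec_deriv t) (dual_vec t) (cov Z t) + (- (\<delta>\<^sup>2) * pairing t) *\<^sub>R ?R (dual_vec t) (?J (dual_vec t)) (cov Z t)"
    unfolding cov_J[OF t smooth_dual_vec] cov_dual_vec[OF t] RJ Rd curvature_self[OF yt]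
    by (simp add: algebra_simps) (metis mult_2 scaleR_left_distrib)
  also have "\<dots> = E t (cov Z t)"
    unfolding E_def by (rule berger_curvature_eq[OF t, symmetric])
  finally show "cov (\<lambda>s. E s (Z s)) t = E t (cov Z t)" .
qed

text \<open>The test covector is dual to \<open>?e\<close>, the component of the defect orthogonal
  to u, where the unit length makes the projection correct. Orthogonality of \<open>?e\<close> to
  the defect and to u then forces its norm to vanish.\<close>

lemma geodesic_defect_parallel_dual_vec:
  assumes t: "t \<in> T" and unit: "cometric (G (y t)) (p t) (p t) = 1"
    and orth: "\<And>\<eta>. \<eta> \<bullet> dual_vec t = 0 \<Longrightarrow> G (y t) (sharp (G (y t)) \<eta>) (geodesic_defect t) = 0"
  shows "geodesic_defect t = G (y t) (geodesic_defect t) (dual_vec t) *\<^sub>R dual_vec t"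
proof -
  note yt = curve_in[OF t]
  let ?e = "geodesic_defect t - G (y t) (geodesic_defect t) (dual_vec t) *\<^sub>R dual_vec t"
  have u: "G (y t) (dual_vec t) (dual_vec t) = 1" using unit by (simp add: cometric_def dual_vec_def)
  have "covec (G (y t) ?e) \<bullet> dual_vec t = 0"
    by (simp add: covec_inner[OF linear_right[OF yt]] metric_simps yt u)
  from orth[OF this] have "G (y t) ?e (geodesic_defect t) = 0" by (simp add: sharp_covec[OF yt])
  moreover have "G (y t) ?e (dual_vec t) = 0" by (simp add: metric_simps yt u)
  ultimately have "G (y t) ?e ?e = 0" by (simp add: metric_simps(3,7)[OF yt])
  with pos[OF yt, of ?e] show ?thesis by fastforce
qed

end

text \<open>Every ingredient of the defect is natural under a map that preserves metric and complex
  structure. This is needed since the geodesic equation is available in one chart near each time,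
  whereas parallelism is claimed in all charts.\<close>

lemma geodesic_defect_transition:
  fixes V V' :: "'e::euclidean_space set"
  assumes c: "covector_curve V G J T y p" and d: "covector_curve V' G' J' T y' p'"
    and \<tau>: "smooth_on V \<tau>" "\<tau> ` V \<subseteq> V'"
    and G: "\<And>x a b. x \<in> V \<Longrightarrow> G x a b = G' (\<tau> x) (frechet_derivative \<tau> (at x) a) (frechet_derivative \<tau> (at x) b)"
    and J: "\<And>x a. x \<in> V \<Longrightarrow> frechet_derivative \<tau> (at x) (J x a) = J' (\<tau> x) (frechet_derivative \<tau> (at x) a)"
    and y: "\<And>s. s \<in> T \<Longrightarrow> \<tau> (y s) = y' s"
    and p: "\<And>s a. s \<in> T \<Longrightarrow> p s \<bullet> a = p' s \<bullet> frechet_derivative \<tau> (at (y s)) a"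
    and t: "t \<in> T"
  shows "covector_curve.dual_vec G' y' p' t = frechet_derivative \<tau> (at (y t)) (covector_curve.dual_vec G y p t)"
    and "covector_curve.geodesic_defect G' J' y' p' \<delta> t =
      frechet_derivative \<tau> (at (y t)) (covector_curve.geodesic_defect G J y p \<delta> t)"
proof -
  interpret c: covector_curve V G J T y p \<delta> by fact
  interpret d: covector_curve V' G' J' T y' p' \<delta> by fact
  let ?D = "\<lambda>s. frechet_derivative \<tau> (at (y s))"
  have lin: "linear (?D s)" if "s \<in> T" for s
    by (rule has_derivative_linear[OF smooth_on_has_derivative[OF \<tau>(1) c.curve_in[OF that]]])
  have G': "G (y s) a b = G' (y' s) (?D s a) (?D s b)" if "s \<in> T" for s a b
    using G[OF c.curve_in[OF that]] y[OF that] by simp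
  \<comment> \<open>An isometric differential between spaces of equal dimension is onto, so testing
    against images loses nothing and the pullback formula determines the whole covariant
    derivative.\<close>
  have surj: "surj (?D s)" if "s \<in> T" for s
  proof -
    have "inj (?D s)"
    proof (subst linear_injective_0[OF lin[OF that]], intro allI impI)
      fix a assume "?D s a = 0"
      then have "G (y s) a a = 0"
        by (simp add: G'[OF that] d.metric_simps d.curve_in[OF that])
      then show "a = 0" using c.pos[OF c.curve_in[OF that], of a] by fastforce
    qed
    from linear_injective_imp_surjective[OF lin[OF that] this refl] show ?thesis .
  qed
  have eqI: "?D s a = b" if "s \<in> T" "\<And>e. G (y s) a e = G' (y' s) b (?D s e)" for s a b
  proof (rule d.nondegenerate[OF d.curve_in[OF that(1)]])
    fix u
    from surj[OF that(1)] obtain e where "u = ?D s e" by (rule surjE)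
    then show "G' (y' s) (?D s a) u = G' (y' s) b u" using that(2)[of e] G'[OF that(1)] by simp
  qed
  have cov: "d.cov Z' s = ?D s (c.cov Z s)"
    if "s \<in> T" "smooth_on T Z" "\<And>r. r \<in> T \<Longrightarrow> Z' r = ?D r (Z r)" for s Z Z'
  proof (rule eqI[symmetric, OF that(1)])
    fix e
    have "d.cov Z' s = cov_deriv_along G' (\<lambda>s. \<tau> (y s)) (\<lambda>s. ?D s (Z s)) s"
      by (rule cov_deriv_along_cong[OF c.open_times that(1)]) (simp_all add: y that)
    then show "G (y s) (c.cov Z s) e = G' (y' s) (d.cov Z' s) (?D s e)"
      using pullback_cov_deriv[OF c.curve_in_domain_axioms d.riemannian_domain_axioms \<tau> G that(2,1), of e] y[OF that(1)]
      by simp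
  qed
  have dual_vec: "d.dual_vec s = ?D s (c.dual_vec s)" if "s \<in> T" for s
    by (rule eqI[symmetric, OF that])
       (simp add: c.dual_vec_def d.dual_vec_def c.sharp d.sharp c.curve_in d.curve_in that p)
  then show "d.dual_vec t = ?D t (c.dual_vec t)" using t .
  have dual_vec_deriv: "d.dual_vec_deriv s = ?D s (c.dual_vec_deriv s)" if "s \<in> T" for s
    using cov[OF that c.smooth_dual_vec dual_vec] by (simp add: c.cov_dual_vec d.cov_dual_vec that)
  have J': "?D s (J (y s) a) = J' (y' s) (?D s a)" if "s \<in> T" for s a
    using J[OF c.curve_in[OF that]] y[OF that] by simp
  have pairing: "c.pairing s = d.pairing s" if "s \<in> T" for s
    by (simp add: c.pairing_def d.pairing_def G'[OF that] J'[OF that] dual_vec[OF that] dual_vec_deriv[OF that])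
  have "(d.pairing has_real_derivative deriv c.pairing t) (at t)"
    by (rule has_field_derivative_transform_within_open[OF c.pairing_derivative[OF t] c.open_times t pairing])
  then have "deriv d.pairing t = deriv c.pairing t" by (rule DERIV_imp_deriv)
  then show "d.geodesic_defect t = ?D t (c.geodesic_defect t)"
    by (simp add: c.geodesic_defect_def d.geodesic_defect_def cov[OF t c.smooth_dual_vec_deriv dual_vec_deriv] dual_vec dual_vec_deriv t pairing[OF t]
        linear_add[OF lin[OF t]] linear_scale[OF lin[OF t]] J'[OF t])
qed

section \<open>Geodesics of the unit cotangent bundle in the ambient bundle\<close>

context riemannian_domain
begin

text \<open>The tangent space of the unit cotangent bundle is the range of the derivative of any local
  parametrization: it lies in the kernel of a nonzero linear form and has the same dimension.\<close>

lemma vertical_tangent: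
  fixes \<psi> :: "'f::euclidean_space \<Rightarrow> 'e \<times> 'e"
  assumes dim: "DIM('f) = 2 * DIM('e) - 1"
    and \<psi>: "local_param {(x, p). x \<in> V \<and> cometric (G x) p p = 1} W \<psi>" and w: "w \<in> W"
    and \<eta>: "\<eta> \<bullet> sharp (G (fst (\<psi> w))) (snd (\<psi> w)) = 0"
  shows "(0, \<eta>) \<in> range (frechet_derivative \<psi> (at w))"
proof -
  let ?U = "V \<times> (UNIV :: 'e set)"
  have U: "open ?U" by (intro open_Times open_dom open_UNIV)
  have W: "open W" and sm\<psi>: "smooth_on W \<psi>" and inj: "inj (frechet_derivative \<psi> (at w))"
    and sub: "\<psi> ` W \<subseteq> {(x, p). x \<in> V \<and> cometric (G x) p p = 1}"
    using \<psi> w openin_imp_subset unfolding local_param_def by blast+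
  define F where "F z = snd z \<bullet> sharp (G (fst z)) (snd z)" for z
  define x where "x = fst (\<psi> w)"
  define p where "p = snd (\<psi> w)"
  have xp: "\<psi> w = (x, p)" by (simp add: x_def p_def)
  have x: "x \<in> V" and pp: "p \<bullet> sharp (G x) p = 1"
    using sub w xp by (force simp: cometric)+
  have snd_smooth: "smooth_on ?U snd"
    by (rule smooth_on_bounded_linear[OF bounded_linear_snd U smooth_on_id])
  have fst_smooth: "smooth_on ?U fst"
    by (rule smooth_on_bounded_linear[OF bounded_linear_fst U smooth_on_id])
  have "smooth_on ?U (\<lambda>z. sharp (G (fst z)) e)" for e
    by (rule smooth_on_compose[OF U fst_smooth smooth_sharp_const]) auto
  then have "smooth_on ?U (\<lambda>z. sharp (G (fst z)) (snd z))"
    by (intro smooth_on_linear_apply[OF U linear_sharp _ snd_smooth]) auto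
  then have smF: "smooth_on ?U F"
    unfolding F_def by (intro smooth_on_inner U snd_smooth)
  define L where "L = frechet_derivative F (at (x, p))"
  have F: "(F has_derivative L) (at (x, p))"
    unfolding L_def by (rule smooth_on_has_derivative[OF smF]) (use x in auto)
  have linL: "linear L" using F by (rule has_derivative_linear)
  have L: "L (0, e) = 2 * (e \<bullet> sharp (G x) p)" for e
  proof -
    have "((\<lambda>r. p + r *\<^sub>R e) has_vector_derivative e) (at 0)"
      by (auto intro!: derivative_eq_intros)
    then have 1: "((\<lambda>r. (x, p + r *\<^sub>R e)) has_vector_derivative (0, e)) (at 0)"
      by (intro has_vector_derivative_Pair has_vector_derivative_const)
    have 2: "(F has_derivative L) (at (x, p + 0 *\<^sub>R e))" using F by simp
    have "((\<lambda>r. F (x, p + r *\<^sub>R e)) has_real_derivative L (0, e)) (at 0)"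
      using has_vector_derivative_compose_linear[OF 1 2] by (simp add: has_real_derivative_iff_has_vector_derivative)
    moreover have "p \<bullet> sharp (G x) e = e \<bullet> sharp (G x) p"
      using commute[OF x] sharp[OF x] by metis
    then have "F (x, p + r *\<^sub>R e) = p \<bullet> sharp (G x) p + 2 * r * (e \<bullet> sharp (G x) p) + r\<^sup>2 * (e \<bullet> sharp (G x) e)" for r
      by (simp add: F_def linear_add[OF linear_sharp[OF x]] linear_scale[OF linear_sharp[OF x]]
          algebra_simps inner_add_left inner_add_right power2_eq_square)
    then have "((\<lambda>r. F (x, p + r *\<^sub>R e)) has_real_derivative 2 * (e \<bullet> sharp (G x) p)) (at 0)"
      by (auto intro!: derivative_eq_intros)
    ultimately show ?thesis by (rule DERIV_unique)
  qed
  let ?D = "frechet_derivative \<psi> (at w)"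
  have D: "(\<psi> has_derivative ?D) (at w)" by (rule smooth_on_has_derivative[OF sm\<psi> w])
  have linD: "linear ?D" using D by (rule has_derivative_linear)
  have LD: "L (?D h) = 0" for h
  proof -
    have "((\<lambda>w. F (\<psi> w)) has_derivative (\<lambda>h. L (?D h))) (at w)"
      by (rule has_derivative_compose[OF D]) (use F xp in simp)
    moreover have "((\<lambda>w. F (\<psi> w)) has_derivative (\<lambda>h. 0)) (at w)"
    proof (rule has_derivative_transform_within_open[OF has_derivative_const W w])
      show "1 = F (\<psi> w)" if "w \<in> W" for w
        using sub that by (force simp: F_def cometric)
    qed
    ultimately show ?thesis using has_derivative_unique by (metis (no_types, lifting))
  qed
  have a: "covec L \<bullet> z = L z" for z by (rule covec_inner[OF linL])
  \<comment> \<open>The radial direction certifies this: \<open>L (0, p)\<close> is 2 on the unit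
    bundle.\<close>
  have "covec L \<noteq> 0" using a[of "(0, p)"] L[of p] pp by auto
  then have "dim {z. covec L \<bullet> z = 0} = DIM('e \<times> 'e) - 1" by (rule dim_hyperplane)
  moreover have "dim (range ?D) = DIM('f)"
    using dim_image_eq[OF linD, of UNIV] inj by (simp add: dim_UNIV)
  moreover have "range ?D \<subseteq> {z. covec L \<bullet> z = 0}" by (auto simp: a LD)
  ultimately have "range ?D = {z. covec L \<bullet> z = 0}"
    using dim by (intro subspace_dim_equal subspace_hyperplane linear_subspace_image[OF linD]) simp_all
  then show ?thesis using \<eta> by (simp add: a L x_def p_def)
qed

end

text \<open>A vertical vector annihilating u is the image of some \<open>c\<close> under the
  differential of the parametrization. By the pullback formula, zero intrinsic acceleration means
  that the ambient acceleration is orthogonal to it, and \<open>berger_acceleration_vertical\<close>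
  evaluates that product.\<close>

lemma (in covector_curve) geodesic_defect_orthogonal:
  fixes \<psi> :: "'f::euclidean_space \<Rightarrow> 'e \<times> 'e"
  assumes dim: "DIM('f) = 2 * DIM('e) - 1"
    and \<psi>: "local_param {(x, p). x \<in> V \<and> cometric (G x) p p = 1} W \<psi>"
    and N: "open N" "t \<in> N" "N \<subseteq> T" and z: "smooth_on N z" "\<And>s. s \<in> N \<Longrightarrow> z s \<in> W"
      "\<And>s. s \<in> N \<Longrightarrow> \<psi> (z s) = (y s, p s)"
    and geodesic: "cov_deriv_along (induced_metric (berger_sasaki G J \<delta>) \<psi>) z (velocity z) t = 0"
    and \<eta>: "\<eta> \<bullet> dual_vec t = 0"
  shows "G (y t) (sharp (G (y t)) \<eta>) (geodesic_defect t) = 0"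
proof -
  let ?U = "V \<times> (UNIV :: 'e set)"
  let ?B = "berger_sasaki G J \<delta>"
  let ?h = "induced_metric ?B \<psi>"
  let ?C = "\<lambda>s. (y s, p s)"
  have t: "t \<in> T" using N by blast
  have U: "open ?U" by (intro open_Times open_dom open_UNIV)
  have W: "open W" and sm\<psi>: "smooth_on W \<psi>" and inj: "\<And>w. w \<in> W \<Longrightarrow> inj (frechet_derivative \<psi> (at w))"
    and sub: "\<psi> ` W \<subseteq> {(x, p). x \<in> V \<and> cometric (G x) p p = 1}"
    using \<psi> openin_imp_subset unfolding local_param_def by blast+
  have subU: "\<psi> ` W \<subseteq> ?U" using sub by auto
  interpret B: riemannian_domain ?U ?B by unfold_locales (rule berger_metric_on, rule U)
  interpret h: curve_in_domain W ?h N z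
    by unfold_locales (use B.metric_on_induced[OF W sm\<psi> subU inj] W N z in auto)
  have \<psi>zt: "\<psi> (z t) = (y t, p t)" by (rule z(3)[OF N(2)])
  have vel: "frechet_derivative \<psi> (at (z s)) (velocity z s) = velocity ?C s" if "s \<in> N" for s
  proof -
    have "((\<lambda>s. \<psi> (z s)) has_vector_derivative frechet_derivative \<psi> (at (z s)) (velocity z s)) (at s)"
      by (rule has_vector_derivative_compose_linear[OF h.curve_derivative[OF that]
            smooth_on_has_derivative[OF sm\<psi> z(2)[OF that]]])
    then have "(?C has_vector_derivative frechet_derivative \<psi> (at (z s)) (velocity z s)) (at s)"
      by (rule has_vector_derivative_transform_within_open[OF _ N(1) that z(3)])
    then show ?thesis unfolding velocity_def[of ?C] by (rule vector_derivative_at[symmetric])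
  qed
  have "cov_deriv_along ?B (\<lambda>s. \<psi> (z s)) (\<lambda>s. frechet_derivative \<psi> (at (z s)) (velocity z s)) t =
      cov_deriv_along ?B ?C (velocity ?C) t"
    by (rule cov_deriv_along_cong[OF N(1,2) z(3) vel])
  then have *: "?B (?C t) (cov_deriv_along ?B ?C (velocity ?C) t) (frechet_derivative \<psi> (at (z t)) c) = 0" for c
    using pullback_cov_deriv[OF h.curve_in_domain_axioms B.riemannian_domain_axioms sm\<psi> subU
        induced_metric_def h.smooth_velocity N(2), of c]
    by (simp add: geodesic \<psi>zt h.metric_simps(9)[OF z(2)[OF N(2)]] h.metric_simps(10)[OF z(2)[OF N(2)]])
  have "(0, \<eta>) \<in> range (frechet_derivative \<psi> (at (z t)))"
    by (rule vertical_tangent[OF dim \<psi> z(2)[OF N(2)]]) (use \<eta> in \<open>simp add: \<psi>zt dual_vec_def\<close>)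
  then obtain c where "frechet_derivative \<psi> (at (z t)) c = (0, \<eta>)" by (metis imageE)
  with *[of c] show ?thesis by (simp add: berger_acceleration_vertical[OF t])
qed

section \<open>From the atlas to coordinate domains\<close>

lemma (in kaehler_domain) kaehler_domain_subset:
  assumes "open S" and "S \<subseteq> V"
  shows "kaehler_domain S G J"
proof (intro kaehler_domain.intro riemannian_domain.intro kaehler_domain_axioms.intro)
  show "metric_on S G"
    using metric assms smooth_on_subset unfolding metric_on_def by blast
  show "smooth_on S (\<lambda>x. J x u)" for u
    by (rule smooth_on_subset[OF smooth_J assms(2)])
qed (use assms linear_J J_J J_isometry J_parallel in \<open>blast+\<close>)

lemma kaehler_domain_chart:
  assumes "standard_kaehler A g J" and "smooth_atlas M A" and c: "c \<in> A"
  shows "kaehler_domain (chart_range c) (g c) (J c)"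
proof (intro kaehler_domain.intro riemannian_domain.intro kaehler_domain_axioms.intro)
  show "metric_on (chart_range c) (g c)"
    using assms(1) c by (simp add: standard_kaehler_def riemannian_metric_def)
  show "open (chart_range c)" using assms(2) c by (simp add: smooth_atlas_def)
  have ac: "almost_complex A J" using assms(1) by (simp add: standard_kaehler_def)
  show "linear (J c x)" "J c x (J c x u) = - u" if "x \<in> chart_range c" for x u
    using ac c that unfolding almost_complex_def by blast+
  show "smooth_on (chart_range c) (\<lambda>x. J c x u)" for u
    using ac c unfolding almost_complex_def by blast
  show "g c x (J c x u) (J c x v) = g c x u v" if "x \<in> chart_range c" for x u v
    using assms(1) c that unfolding standard_kaehler_def by blast
  show "frechet_derivative (\<lambda>y. J c y w) (at x) u =
      J c x (christoffel (g c) x u w) - christoffel (g c) x u (J c x w)" if x: "x \<in> chart_range c" for x u w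
  proof -
    have "nabla (g c) (\<lambda>_. u) (\<lambda>y. J c y w) x - J c x (nabla (g c) (\<lambda>_. u) (\<lambda>_. w) x) = 0"
      using assms(1) c x smooth_on_const[of "chart_range c" u] smooth_on_const[of "chart_range c" w]
      unfolding standard_kaehler_def by blast
    then show ?thesis by (simp add: nabla_def frechet_derivative_const algebra_simps)
  qed
qed

text \<open>The condition is tested on fields with constant components, whose \<open>nabla\<close>
  is a bare Christoffel term, and solved for the partial derivative.\<close>

lemma locally_symmetric_chart:
  assumes "locally_symmetric A g" and c: "c \<in> A" and x: "x \<in> chart_range c"
  shows "frechet_derivative (\<lambda>y. curvature (g c) y u v w) (at x) a =
      curvature (g c) x (christoffel (g c) x a u) v w + curvature (g c) x u (christoffel (g c) x a v) w
      + curvature (g c) x u v (christoffel (g c) x a w) - christoffel (g c) x a (curvature (g c) x u v w)"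
proof -
  let ?K = "\<lambda>e. \<lambda>_::'b. e"
  have "nabla (g c) (?K a) (\<lambda>y. curvature (g c) y (?K u y) (?K v y) (?K w y)) x
           - curvature (g c) x (nabla (g c) (?K a) (?K u) x) (?K v x) (?K w x)
           - curvature (g c) x (?K u x) (nabla (g c) (?K a) (?K v) x) (?K w x)
           - curvature (g c) x (?K u x) (?K v x) (nabla (g c) (?K a) (?K w) x) = 0"
    using assms(1)[unfolded locally_symmetric_def, rule_format, OF c smooth_on_const smooth_on_const smooth_on_const smooth_on_const x, of a u v w] .
  then show ?thesis by (simp add: nabla_def frechet_derivative_const algebra_simps)
qed

lemma open_times_in:
  assumes "continuous_map (top_of_set I) M \<gamma>" and "open I" and "openin M U"
  shows "open {t \<in> I. \<gamma> t \<in> U}"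
  using openin_continuous_map_preimage[OF assms(1,3)] openin_open_trans[OF _ assms(2)] by simp

lemma chart_overlap:
  assumes "smooth_atlas M A" and c: "c \<in> A" and d: "d \<in> A"
  shows "open (snd c ` (fst c \<inter> fst d))"
    and "q \<in> fst c \<inter> fst d \<Longrightarrow> transition c d (snd c q) = snd d q"
proof -
  have co: "openin M (fst c)" "open (chart_range c)"
    and h: "homeomorphic_map (subtopology M (fst c)) (top_of_set (chart_range c)) (snd c)"
    and do: "openin M (fst d)"
    using assms unfolding smooth_atlas_def by blast+
  have ts: "topspace (subtopology M (fst c)) = fst c"
    using openin_subset[OF co(1)] by auto
  have "openin (subtopology M (fst c)) (fst c \<inter> fst d)"
    using do by (metis Int_commute openin_subtopology)
  then have "openin (top_of_set (chart_range c)) (snd c ` (fst c \<inter> fst d))"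
    using homeomorphic_map_openness_eq[OF h] by (metis ts inf_le1)
  then show "open (snd c ` (fst c \<inter> fst d))" using openin_open_trans co(2) by blast
  have "inj_on (snd c) (fst c)"
    using homeomorphic_imp_injective_map[OF h] by (simp only: ts)
  then show "transition c d (snd c q) = snd d q" if "q \<in> fst c \<inter> fst d"
    using that by (simp add: transition_def)
qed

theorem theorem5p11:
  fixes M :: "'a topology"
    and A :: "('a, 'e::euclidean_space) chart set"
    and g :: "('a, 'e) chart \<Rightarrow> 'e \<Rightarrow> 'e \<Rightarrow> 'e \<Rightarrow> real"
    and J :: "('a, 'e) chart \<Rightarrow> 'e \<Rightarrow> 'e \<Rightarrow> 'e"
    and m :: nat and \<delta> :: real
    and I :: "real set"
    and \<gamma> :: "real \<Rightarrow> 'a"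
    and \<theta> :: "real \<Rightarrow> ('a, 'e) chart \<Rightarrow> 'e"
  assumes "DIM('e) = 2 * m"
    and "DIM('f::euclidean_space) = 2 * DIM('e) - 1"
    and "smooth_atlas M A"
    and "standard_kaehler A g J"
    and "locally_symmetric A g"
    and "open I" and "is_interval I"
    and "unit_cotangent_curve M A g I \<gamma> \<theta>"
    and "unit_cotangent_geodesic TYPE('f) A g J \<delta> I \<gamma> \<theta>"
    and "arc_length_parametrized A g J \<delta> I \<gamma> \<theta>"
  shows "parallel_endomorphism_along A g I \<gamma>
     (\<lambda>c t. berger_curvature (g c) (J c) \<delta> (snd c (\<gamma> t))
        (cov_deriv_covec_along (g c) (\<lambda>s. snd c (\<gamma> s)) (\<lambda>s. \<theta> s c) t) (\<theta> t c))"
proof -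
  note atlas = assms(3) and kaehler = assms(4) and curve = assms(8)
  let ?y = "\<lambda>c s. snd c (\<gamma> s)" and ?p = "\<lambda>c s. \<theta> s c"
  have cont: "continuous_map (top_of_set I) M \<gamma>"
    and smy: "\<And>c. c \<in> A \<Longrightarrow> smooth_on (times_in I \<gamma> c) (?y c)"
    and smp: "\<And>c. c \<in> A \<Longrightarrow> smooth_on (times_in I \<gamma> c) (?p c)"
    and unit: "\<And>c t. c \<in> A \<Longrightarrow> t \<in> times_in I \<gamma> c \<Longrightarrow> (?y c t, ?p c t) \<in> unit_cotangent c (g c)"
    and covector: "\<And>c d t u. c \<in> A \<Longrightarrow> d \<in> A \<Longrightarrow> t \<in> times_in I \<gamma> c \<inter> times_in I \<gamma> d \<Longrightarrow>
        ?p c t \<bullet> u = ?p d t \<bullet> chart_deriv c d (\<gamma> t) u"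
    using curve unfolding unit_cotangent_curve_def by blast+
  have chart_open: "openin M (fst c)" if "c \<in> A" for c
    using atlas that unfolding smooth_atlas_def by blast
  \<comment> \<open>\<open>U\<close> is the domain of the chart itself for the curve in one chart,
    and the domain of the other chart for the curve on an overlap.\<close>
  have curve_chart: "covector_curve (snd c ` (fst c \<inter> U)) (g c) (J c) {t \<in> I. \<gamma> t \<in> fst c \<inter> U} (?y c) (?p c)"
    if c: "c \<in> A" and U: "openin M U" "open (snd c ` (fst c \<inter> U))" for c U
  proof -
    interpret c: kaehler_domain "chart_range c" "g c" "J c" by (rule kaehler_domain_chart[OF kaehler atlas c])
    have "snd c ` (fst c \<inter> U) \<subseteq> chart_range c" by blast
    then interpret k: kaehler_domain "snd c ` (fst c \<inter> U)" "g c" "J c"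
      by (rule c.kaehler_domain_subset[OF U(2)])
    have sub: "{t \<in> I. \<gamma> t \<in> fst c \<inter> U} \<subseteq> times_in I \<gamma> c" by blast
    show ?thesis
      by unfold_locales
        (use open_times_in[OF cont \<open>open I\<close> openin_Int[OF chart_open[OF c] U(1)]] smooth_on_subset[OF smy[OF c] sub]
          smooth_on_subset[OF smp[OF c] sub] in auto)
  qed
  show ?thesis
    unfolding parallel_endomorphism_along_def Let_def
  proof (intro ballI allI impI)
    fix c and Z :: "real \<Rightarrow> 'e" and t
    assume c: "c \<in> A" and Z: "smooth_on (times_in I \<gamma> c) Z" and t: "t \<in> times_in I \<gamma> c"
    have cr: "open (chart_range c)" using atlas c unfolding smooth_atlas_def by blast
    interpret c: covector_curve "chart_range c" "g c" "J c" "times_in I \<gamma> c" "?y c" "?p c" \<delta>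
      using curve_chart[OF c chart_open[OF c]] cr by simp
    have tI: "t \<in> I" using t by simp
    \<comment> \<open>The chart \<open>d\<close> is dictated by the geodesic equation and is in
      general different from the given \<open>c\<close>.\<close>
    from assms(9)[unfolded unit_cotangent_geodesic_def, rule_format, OF tI]
    obtain d W \<psi> N z where d: "d \<in> A" and \<psi>: "local_param (unit_cotangent d (g d)) (W :: 'f set) \<psi>"
      and N: "open N" "t \<in> N" "N \<subseteq> times_in I \<gamma> d" and z: "smooth_on N z"
      and geo: "\<And>t. t \<in> N \<Longrightarrow> z t \<in> W \<and> \<psi> (z t) = (?y d t, ?p d t) \<and>
           cov_deriv_along (induced_metric (berger_sasaki (g d) (J d) \<delta>) \<psi>) z (velocity z) t = 0"
      by blast
    have dr: "open (chart_range d)" using atlas d unfolding smooth_atlas_def by blast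
    interpret d: covector_curve "chart_range d" "g d" "J d" "times_in I \<gamma> d" "?y d" "?p d" \<delta>
      using curve_chart[OF d chart_open[OF d]] dr by simp
    have td: "t \<in> times_in I \<gamma> d" using N by blast
    have "d.geodesic_defect t = g d (?y d t) (d.geodesic_defect t) (d.dual_vec t) *\<^sub>R d.dual_vec t"
    proof (rule d.geodesic_defect_parallel_dual_vec[OF td])
      show "cometric (g d (?y d t)) (?p d t) (?p d t) = 1"
        using unit[OF d td] by (simp add: unit_cotangent_def)
      show "g d (?y d t) (sharp (g d (?y d t)) \<eta>) (d.geodesic_defect t) = 0" if "\<eta> \<bullet> d.dual_vec t = 0" for \<eta>
        by (rule d.geodesic_defect_orthogonal[OF assms(2) \<psi>[unfolded unit_cotangent_def] N z _ _ _ that])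
           (use geo N(2) in blast)+
    qed
    then obtain \<kappa> where \<kappa>: "d.geodesic_defect t = \<kappa> *\<^sub>R d.dual_vec t" by blast
    let ?D = "frechet_derivative (transition d c) (at (?y d t))"
    let ?S = "snd d ` (fst d \<inter> fst c)" and ?T = "{t \<in> I. \<gamma> t \<in> fst d \<inter> fst c}"
    note ov = chart_overlap[OF atlas d c]
    have tT: "t \<in> ?T" using t td by blast
    have sm\<tau>: "smooth_on ?S (transition d c)" using atlas c d unfolding smooth_atlas_def by blast
    have cd: "covector_curve ?S (g d) (J d) ?T (?y d) (?p d)"
      by (rule curve_chart[OF d chart_open[OF c] ov(1)])
    \<comment> \<open>The times are cut down to the overlap to match \<open>cd\<close>, while the
      range of \<open>c\<close> stays whole. \<open>geodesic_defect\<close> does not take the time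
      set as an argument, so its value at \<open>t\<close> is the one meant in the larger
      interpretation of \<open>c\<close>.\<close>
    have cc: "covector_curve (chart_range c) (g c) (J c) ?T (?y c) (?p c)"
    proof unfold_locales
      show "open ?T"
        by (rule open_times_in[OF cont \<open>open I\<close> openin_Int[OF chart_open[OF d] chart_open[OF c]]])
    qed (use smooth_on_subset[OF smy[OF c], of ?T] smooth_on_subset[OF smp[OF c], of ?T] in auto)
    have \<tau>: "transition d c ` ?S \<subseteq> chart_range c" using ov(2) by auto
    have G: "g d x a b = g c (transition d c x) (frechet_derivative (transition d c) (at x) a)
        (frechet_derivative (transition d c) (at x) b)" if x: "x \<in> ?S" for x a b
    proof -
      obtain q where q: "q \<in> fst d \<inter> fst c" "x = snd d q" using x by blast
      have "g d (snd d q) a b = g c (snd c q) (chart_deriv d c q a) (chart_deriv d c q b)"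
        using kaehler c d q(1) unfolding standard_kaehler_def riemannian_metric_def by blast
      then show ?thesis by (simp add: q(2) ov(2)[OF q(1)] chart_deriv_def)
    qed
    have J: "frechet_derivative (transition d c) (at x) (J d x a) =
        J c (transition d c x) (frechet_derivative (transition d c) (at x) a)" if x: "x \<in> ?S" for x a
    proof -
      obtain q where q: "q \<in> fst d \<inter> fst c" "x = snd d q" using x by blast
      have "chart_deriv d c q (J d (snd d q) a) = J c (snd c q) (chart_deriv d c q a)"
        using kaehler c d q(1) unfolding standard_kaehler_def almost_complex_def by blast
      then show ?thesis by (simp add: q(2) ov(2)[OF q(1)] chart_deriv_def)
    qed
    have y: "transition d c (?y d s) = ?y c s" if "s \<in> ?T" for s
      using ov(2) that by blast
    have p: "?p d s \<bullet> a = ?p c s \<bullet> frechet_derivative (transition d c) (at (?y d s)) a" if "s \<in> ?T" for s a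
      using covector[OF d c, of s a] that by (simp add: chart_deriv_def)
    have l: "linear ?D"
      by (rule has_derivative_linear[OF smooth_on_has_derivative[OF sm\<tau>]]) (use tT in blast)
    have "c.geodesic_defect t = ?D (d.geodesic_defect t)" "c.dual_vec t = ?D (d.dual_vec t)"
      by (rule geodesic_defect_transition[OF cd cc sm\<tau> \<tau> G J y p tT]; assumption)+
    then have defect: "c.geodesic_defect t = \<kappa> *\<^sub>R c.dual_vec t"
      by (simp add: \<kappa> linear_scale[OF l])
    show "(\<lambda>s. berger_curvature (g c) (J c) \<delta> (?y c s) (cov_deriv_covec_along (g c) (?y c) (?p c) s) (?p c s) (Z s))
        differentiable at t \<and>
      cov_deriv_along (g c) (?y c) (\<lambda>s. berger_curvature (g c) (J c) \<delta> (?y c s)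
          (cov_deriv_covec_along (g c) (?y c) (?p c) s) (?p c s) (Z s)) t
      - berger_curvature (g c) (J c) \<delta> (?y c t) (cov_deriv_covec_along (g c) (?y c) (?p c) t) (?p c t)
          (cov_deriv_along (g c) (?y c) Z t) = 0"
      using c.berger_curvature_parallel[OF locally_symmetric_chart[OF assms(5) c] t defect Z]
      by simp
  qed
qed

end
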